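(* The multiplicative Hilbert matrix $\left(\frac{1}{\sqrt{mn}\,\log (mn)}\right)_{m,n\ge 2}$ has a bounded symbol. That is, there is a function $B\in L^\infty(\mathbb{T}^\infty)$ such that \[ P_+B(z)=1+\sum_{n=2}^\infty\frac{z(n)}{\sqrt n\,\log n}. \]
   Context: $\mathbb{T}$ is the unit circle in $\mathbb{C}$, and $\mathbb{T}^\infty$ is the countably infinite product of copies of $\mathbb{T}$, equipped with its normalized Haar measure $m$. Each $z=(z_1,z_2,\ldots)\in\mathbb{T}^\infty$ is identified with the completely multiplicative character on the positive rationals, $z\colon\mathbb{Q}_+\to\mathbb{T}$, determined by $z(p_j)=z_j$, where $p_j$ is the $j$th prime. The functions $z\mapsto z(q)$, $q\in\mathbb{Q}_+$, form an orthonormal basis of $L^2(\mathbb{T}^\infty)$. The map $P_+$ is the orthogonal projection of $L^2(\mathbb{T}^\infty)$ onto the closed span of $\{z(n): n\in\mathbb{N}\}$, $\mathbb{N}=\{1,2,\dots\}$ (this closed span is the image $\mathscr{B}(\mathscr{H}^2)$ of the Hardy space $\mathscr{H}^2$ of Dirichlet series with square-summable coefficients under the Bohr lift $\sum a_n n^{-s}\mapsto\sum a_n z(n)$): for $F\in L^2(\mathbb{T}^\infty)$ with Fourier series $F(z)=\sum_{q\in\mathbb{Q}_+}a_q z(q)$, one has $P_+F(z)=\sum_{n\in\mathbb{N}}a_n z(n)$. The meaning of "has a bounded symbol" is exactly the existence of $B$ as stated. *)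

theory Defs
  imports "HOL-Probability.Probability" "HOL-Computational_Algebra.Primes"
begin

definition circle_measure :: "complex measure" where
  "circle_measure =
     distr (uniform_measure lborel {0..<1::real}) (restrict_space borel (sphere 0 1))
       (\<lambda>t. cis (2 * pi * t))"

lemma measurable_cis_circle:
  "(\<lambda>t. cis (2 * pi * t)) \<in> measurable (uniform_measure lborel {0..<1::real}) (restrict_space borel (sphere 0 1))"
  by (rule measurable_restrict_space2)
    (auto simp: measurable_cong_sets[OF sets_uniform_measure refl]
      intro!: borel_measurable_continuous_onI continuous_intros)

lemma sets_circle: "sets circle_measure = sets (restrict_space borel (sphere 0 1))"
  by (simp add: circle_measure_def)

lemma space_circle: "space circle_measure = sphere 0 1"
  by (simp add: circle_measure_def space_restrict_space)

lemma prob_space_circle: "prob_space circle_measure"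
  unfolding circle_measure_def
  by (rule prob_space.prob_space_distr[OF prob_space_uniform_measure measurable_cis_circle]) auto

lemma emeasure_circle:
  assumes "A \<in> sets circle_measure"
  shows "emeasure circle_measure A =
    (\<integral>\<^sup>+t. indicator A (cis (2 * pi * t)) * indicator {0..<1} t \<partial>lborel)"
proof -
  have A: "A \<in> sets borel" using assms
    by (auto simp: sets_circle sets_restrict_space)
  have m: "(\<lambda>t::real. cis (2 * pi * t)) \<in> borel_measurable borel"
    by (intro borel_measurable_continuous_onI continuous_intros)
  have "emeasure circle_measure A = (\<integral>\<^sup>+x. indicator A x \<partial>circle_measure)"
    using assms by simp
  also have "\<dots> = (\<integral>\<^sup>+t. indicator A (cis (2 * pi * t)) \<partial>uniform_measure lborel {0..<1::real})"
    unfolding circle_measure_def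
    by (rule nn_integral_distr[OF measurable_cis_circle])
      (use assms in \<open>simp add: sets_circle\<close>)
  also have "\<dots> = (\<integral>\<^sup>+t. indicator A (cis (2 * pi * t)) * indicator {0..<1} t \<partial>lborel) / 1"
    by (subst nn_integral_uniform_measure)
      (use measurable_compose[OF m borel_measurable_indicator[OF A]] in auto)
  finally show ?thesis by (simp add: divide_ennreal_def)
qed

lemma nn_integral_period:
  fixes g :: "real \<Rightarrow> ennreal"
  assumes [measurable]: "g \<in> borel_measurable borel"
    and per: "\<And>t. g (1 + t) = g t" and a: "0 \<le> a" "a \<le> 1"
  shows "(\<integral>\<^sup>+t. g (a + t) * indicator {0..<1} t \<partial>lborel) =
    (\<integral>\<^sup>+t. g t * indicator {0..<1} t \<partial>lborel)"
proof -
  have "(\<integral>\<^sup>+t. g t * indicator {a..<a+1} t \<partial>lborel) =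
      (\<integral>\<^sup>+t. g (a + t) * indicator {0..<1} t \<partial>lborel)"
    by (subst nn_integral_real_affine[where c=1 and t=a])
      (auto intro!: nn_integral_cong simp: indicator_def)
  moreover have "(\<integral>\<^sup>+t. g t * indicator {1..<a+1} t \<partial>lborel) =
      (\<integral>\<^sup>+t. g t * indicator {0..<a} t \<partial>lborel)"
    by (subst nn_integral_real_affine[where c=1 and t=1])
      (auto intro!: nn_integral_cong simp: indicator_def per)
  moreover have "(\<integral>\<^sup>+t. g t * indicator {a..<a+1} t \<partial>lborel) =
      (\<integral>\<^sup>+t. g t * indicator {a..<1} t \<partial>lborel) + (\<integral>\<^sup>+t. g t * indicator {1..<a+1} t \<partial>lborel)"
    by (subst nn_integral_add[symmetric])
      (use a in \<open>auto intro!: nn_integral_cong simp: indicator_def\<close>)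
  moreover have "(\<integral>\<^sup>+t. g t * indicator {0..<1} t \<partial>lborel) =
      (\<integral>\<^sup>+t. g t * indicator {a..<1} t \<partial>lborel) + (\<integral>\<^sup>+t. g t * indicator {0..<a} t \<partial>lborel)"
    by (subst nn_integral_add[symmetric])
      (use a in \<open>auto intro!: nn_integral_cong simp: indicator_def\<close>)
  ultimately show ?thesis by simp
qed

lemma measurable_circle_mult:
  assumes "cmod w = 1"
  shows "(\<lambda>x. w * x) \<in> measurable circle_measure circle_measure"
  unfolding measurable_cong_sets[OF sets_circle sets_circle]
  by (intro measurable_restrict_space2 measurable_restrict_space1)
    (use assms in \<open>auto simp: space_restrict_space norm_mult\<close>)

lemma distr_circle_mult:
  assumes w: "cmod w = 1"
  shows "distr circle_measure circle_measure (\<lambda>x. w * x) = circle_measure"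
proof (rule measure_eqI)
  fix A assume "A \<in> sets (distr circle_measure circle_measure (\<lambda>x. w * x))"
  then have A: "A \<in> sets circle_measure" by simp
  then have Ab: "A \<in> sets borel" by (auto simp: sets_circle sets_restrict_space)
  obtain b where b: "0 \<le> b" "b < 2 * pi" "w = cis b"
    using w by (metis Arg2pi_eq Arg2pi_ge_0 Arg2pi_lt_2pi cis_conv_exp of_real_1 mult_1)
  define a where "a = b / (2 * pi)"
  have a: "0 \<le> a" "a \<le> 1" "w = cis (2 * pi * a)" using b by (auto simp: a_def field_simps)
  define g :: "real \<Rightarrow> ennreal" where "g t = indicator A (cis (2 * pi * t))" for t
  have m: "(\<lambda>t::real. cis (2 * pi * t)) \<in> borel_measurable borel"
    by (intro borel_measurable_continuous_onI continuous_intros)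
  have g: "g \<in> borel_measurable borel"
    unfolding g_def by (rule measurable_compose[OF m borel_measurable_indicator[OF Ab]])
  have per: "g (1 + t) = g t" for t
    by (simp add: g_def distrib_left flip: cis_mult)
  let ?B = "(\<lambda>x. w * x) -` A \<inter> space circle_measure"
  have "emeasure (distr circle_measure circle_measure (\<lambda>x. w * x)) A = emeasure circle_measure ?B"
    by (rule emeasure_distr[OF measurable_circle_mult[OF w] A])
  also have "\<dots> = (\<integral>\<^sup>+t. indicator ?B (cis (2 * pi * t)) * indicator {0..<1} t \<partial>lborel)"
    by (rule emeasure_circle[OF measurable_sets[OF measurable_circle_mult[OF w] A]])
  also have "\<dots> = (\<integral>\<^sup>+t. g (a + t) * indicator {0..<1} t \<partial>lborel)"
    by (intro nn_integral_cong)
      (auto simp: g_def indicator_def a(3) space_circle cis_mult distrib_left)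
  also have "\<dots> = emeasure circle_measure A"
    unfolding nn_integral_period[OF g per a(1,2)] by (simp add: emeasure_circle[OF A] g_def)
  finally show "emeasure (distr circle_measure circle_measure (\<lambda>x. w * x)) A =
    emeasure circle_measure A" .
qed simp

text \<open>
  Coordinates are indexed from \<open>0\<close>: \<open>z j\<close> is the coordinate attached to the \<open>(j+1)\<close>-st prime.
  Since the circle is second countable, the product sigma-algebra is the Borel sigma-algebra of
  the compact group \<open>\<T>\<^sup>\<infinity>\<close>, and its normalized Haar measure is the product of the normalized arc
  length measures; see \<open>prob_space_torus\<close> and \<open>distr_torus_mult\<close> below.
\<close>

definition torus :: "(nat \<Rightarrow> complex) measure" where
  "torus = PiM UNIV (\<lambda>_. circle_measure)"

lemma prob_space_torus: "prob_space torus"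
  unfolding torus_def by (rule prob_space_PiM) (rule prob_space_circle)

lemma distr_torus_mult:
  assumes w: "\<And>j. cmod (w j) = 1"
  shows "distr torus torus (\<lambda>z j. w j * z j) = torus"
proof -
  interpret P: product_prob_space "\<lambda>_::nat. circle_measure" UNIV
    by (intro product_prob_spaceI prob_space_circle)
  have m: "(\<lambda>z j. w j * z j) \<in> measurable torus torus"
    unfolding torus_def
  proof (rule measurable_PiM_single')
    fix j :: nat
    have "(\<lambda>z. z j) \<in> measurable (PiM UNIV (\<lambda>_::nat. circle_measure)) circle_measure"
      by (rule measurable_component_singleton) simp
    from measurable_compose[OF this measurable_circle_mult[OF w[of j]]]
    show "(\<lambda>z. w j * z j) \<in> measurable (PiM UNIV (\<lambda>_::nat. circle_measure)) circle_measure" .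
  qed (auto simp: space_PiM space_circle norm_mult w PiE_iff)
  show ?thesis
    unfolding torus_def
  proof (rule P.PiM_eq)
    fix J :: "nat set" and F
    assume J: "finite J" "J \<subseteq> UNIV" and F: "\<And>j. j \<in> J \<Longrightarrow> F j \<in> sets circle_measure"
    let ?M = "PiM UNIV (\<lambda>_::nat. circle_measure)"
    let ?F = "\<lambda>j. (\<lambda>x. w j * x) -` F j \<inter> space circle_measure"
    have F': "?F j \<in> sets circle_measure" if "j \<in> J" for j
      using measurable_sets[OF measurable_circle_mult[OF w] F[OF that]] .
    have "emeasure (distr ?M ?M (\<lambda>z j. w j * z j)) (prod_emb UNIV (\<lambda>_. circle_measure) J (Pi\<^sub>E J F))
      = emeasure ?M ((\<lambda>z j. w j * z j) -` prod_emb UNIV (\<lambda>_. circle_measure) J (Pi\<^sub>E J F) \<inter> space ?M)"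
      using m J F by (intro emeasure_distr) (auto simp: torus_def intro!: sets_PiM_I)
    also have "(\<lambda>z j. w j * z j) -` prod_emb UNIV (\<lambda>_. circle_measure) J (Pi\<^sub>E J F) \<inter> space ?M
      = prod_emb UNIV (\<lambda>_. circle_measure) J (Pi\<^sub>E J ?F)"
      by (auto simp: prod_emb_def space_PiM space_circle PiE_iff norm_mult w)
    also have "emeasure ?M \<dots> = (\<Prod>j\<in>J. emeasure circle_measure (?F j))"
      using J F' by (intro P.emeasure_PiM_emb) auto
    also have "\<dots> = (\<Prod>j\<in>J. emeasure circle_measure (F j))"
    proof (rule prod.cong[OF refl])
      fix j assume j: "j \<in> J"
      have "emeasure circle_measure (?F j)
        = emeasure (distr circle_measure circle_measure (\<lambda>x. w j * x)) (F j)"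
        by (rule emeasure_distr[OF measurable_circle_mult[OF w] F[OF j], symmetric])
      then show "emeasure circle_measure (?F j) = emeasure circle_measure (F j)"
        by (simp add: distr_circle_mult[OF w])
    qed
    finally show "emeasure (distr ?M ?M (\<lambda>z j. w j * z j))
      (prod_emb UNIV (\<lambda>_. circle_measure) J (Pi\<^sub>E J F)) = (\<Prod>j\<in>J. emeasure circle_measure (F j))" .
  qed simp
qed

definition nth_prime :: "nat \<Rightarrow> nat" where
  "nth_prime = enumerate {p. prime p}"

text \<open>The value \<open>z(n)\<close> of the completely multiplicative character determined by \<open>z\<close>, for \<open>n \<ge> 1\<close>.\<close>

definition bohr_char :: "nat \<Rightarrow> (nat \<Rightarrow> complex) \<Rightarrow> complex" where
  "bohr_char n z = (\<Prod>j | nth_prime j dvd n. z j ^ multiplicity (nth_prime j) n)"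

lemma prime_nth_prime: "prime (nth_prime j)"
  using enumerate_in_set[OF primes_infinite] by (auto simp: nth_prime_def)

lemma inj_nth_prime: "inj nth_prime"
  unfolding nth_prime_def by (rule inj_enumerate[OF primes_infinite])

lemma finite_nth_prime_dvd: "n \<noteq> 0 \<Longrightarrow> finite {j. nth_prime j dvd n}"
  by (rule finite_imageD[where f = nth_prime])
    (auto intro: finite_subset[of _ "{..n}"] dvd_imp_le inj_on_subset[OF inj_nth_prime])

lemma bohr_char_superset:
  assumes "n \<noteq> 0" "finite J" "{j. nth_prime j dvd n} \<subseteq> J"
  shows "bohr_char n z = (\<Prod>j\<in>J. z j ^ multiplicity (nth_prime j) n)"
  unfolding bohr_char_def
  by (rule prod.mono_neutral_left) (use assms in \<open>auto simp: not_dvd_imp_multiplicity_0\<close>)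

lemma bohr_char_1: "bohr_char 1 z = 1"
  by (subst bohr_char_superset[of _ "{}"]) (use prime_nth_prime in \<open>auto simp del: One_nat_def, metis not_prime_1\<close>)

lemma bohr_char_nth_prime: "bohr_char (nth_prime j) z = z j"
proof -
  have "{i. nth_prime i dvd nth_prime j} \<subseteq> {j}"
    using primes_dvd_imp_eq[OF prime_nth_prime prime_nth_prime] injD[OF inj_nth_prime] by blast
  moreover have "nth_prime j \<noteq> 0" using prime_nth_prime[of j] by (intro notI) simp
  ultimately have "bohr_char (nth_prime j) z = (\<Prod>i\<in>{j}. z i ^ multiplicity (nth_prime i) (nth_prime j))"
    by (intro bohr_char_superset) auto
  then show ?thesis using prime_nth_prime[of j] by (simp add: multiplicity_prime)
qed

lemma bohr_char_mult:
  assumes "m \<noteq> 0" "n \<noteq> 0"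
  shows "bohr_char (m * n) z = bohr_char m z * bohr_char n z"
proof -
  let ?J = "{j. nth_prime j dvd m * n}"
  have J: "finite ?J" using assms by (intro finite_nth_prime_dvd) auto
  have "bohr_char m z * bohr_char n z = (\<Prod>j\<in>?J. z j ^ multiplicity (nth_prime j) (m * n))"
    using assms J prime_nth_prime
    by (subst (1 2) bohr_char_superset[of _ ?J])
      (auto simp: prime_elem_multiplicity_mult_distrib power_add prod.distrib)
  then show ?thesis using assms J by (simp add: bohr_char_def)
qed

definition L2 :: "'a measure \<Rightarrow> ('a \<Rightarrow> complex) set" where
  "L2 M = {f \<in> borel_measurable M. integrable M (\<lambda>x. (cmod (f x))\<^sup>2)}"

definition Linf :: "'a measure \<Rightarrow> ('a \<Rightarrow> complex) set" where
  "Linf M = {f \<in> borel_measurable M. \<exists>C. AE x in M. cmod (f x) \<le> C}"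

definition L2_norm :: "'a measure \<Rightarrow> ('a \<Rightarrow> complex) \<Rightarrow> real" where
  "L2_norm M f = sqrt (\<integral>x. (cmod (f x))\<^sup>2 \<partial>M)"

definition L2_inner :: "'a measure \<Rightarrow> ('a \<Rightarrow> complex) \<Rightarrow> ('a \<Rightarrow> complex) \<Rightarrow> complex" where
  "L2_inner M f g = (\<integral>x. f x * cnj (g x) \<partial>M)"

text \<open>The \<open>L\<^sup>2\<close>-closure of the finite linear combinations of the functions \<open>z(n)\<close>, \<open>n \<ge> 1\<close>.\<close>

definition H2 :: "((nat \<Rightarrow> complex) \<Rightarrow> complex) set" where
  "H2 = {f \<in> L2 torus. \<forall>\<epsilon>>0. \<exists>S a. finite S \<and> S \<subseteq> {1..} \<and>
           L2_norm torus (\<lambda>z. f z - (\<Sum>n\<in>S. a n * bohr_char n z)) < \<epsilon>}"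

text \<open>
  Elements of \<open>L\<^sup>2\<close> are represented by functions rather than by classes modulo null sets, so the
  orthogonal projection \<open>P\<^sub>+\<close> onto \<open>H2\<close> is a relation: \<open>is_P_plus F G\<close> says that \<open>G\<close> represents
  \<open>P\<^sub>+ F\<close>, and determines \<open>G\<close> up to a null set.
\<close>

definition is_P_plus ::
  "((nat \<Rightarrow> complex) \<Rightarrow> complex) \<Rightarrow> ((nat \<Rightarrow> complex) \<Rightarrow> complex) \<Rightarrow> bool" where
  "is_P_plus F G \<longleftrightarrow>
     F \<in> L2 torus \<and> G \<in> H2 \<and> (\<forall>h\<in>H2. L2_inner torus (\<lambda>z. F z - G z) h = 0)"

definition L2_tendsto :: "'a measure \<Rightarrow> (nat \<Rightarrow> 'a \<Rightarrow> complex) \<Rightarrow> ('a \<Rightarrow> complex) \<Rightarrow> bool" where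
  "L2_tendsto M f g \<longleftrightarrow>
     (\<forall>N. f N \<in> L2 M) \<and> g \<in> L2 M \<and> (\<lambda>N. L2_norm M (\<lambda>x. f N x - g x)) \<longlonglongrightarrow> 0"

end

theory Submission
  imports Defs "HOL-Complex_Analysis.Cauchy_Integral_Formula" "HOL-Real_Asymp.Real_Asymp"
begin

text \<open>Why a bounded symbol exists. For \<open>n \<ge> 2\<close>, \<open>n powr (-1/2) / ln n\<close> is \<open>n powr (-3/2) / ln n\<close> plus the
integral of \<open>n powr (-1/2-\<delta>)\<close> over \<open>0 < \<delta> \<le> 1\<close>, and for \<open>n = 1\<close> the integral is the required
coefficient \<open>1\<close>. The first term gives an absolutely convergent series, so it suffices to find a bounded function whose coefficient at \<open>z(n)\<close> is this integral for all
\<open>n \<ge> 1\<close>. For fixed \<open>\<delta>\<close> the coefficients \<open>n powr (-1/2-\<delta>)\<close> describe evaluation of a function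
on the polydisc at the point with coordinates \<open>r\<^sub>p = p powr (-1/2-\<delta>)\<close>. Evaluation is represented by
the product over \<open>p\<close> of \<open>(1 - r\<^sub>p cnj z\<^sub>p) / ((1 - r\<^sub>p\<^sup>2) (1 - r\<^sub>p z\<^sub>p))\<close>, which has constant
modulus \<open>\<zeta>(1 + 2\<delta>)\<close>. This is of size \<open>1 / \<delta>\<close>, so adding up the moduli over \<open>\<delta>\<close> loses a logarithm.

The logarithm is recovered by localizing. In the coordinates \<open>w\<^sub>p = (z\<^sub>p - r\<^sub>p) / (1 - r\<^sub>p z\<^sub>p)\<close> the
point of evaluation is the origin. There, by the mean value property on the discs
\<open>u \<mapsto> u w\<close>, evaluation of an analytic function is also given by averaging over any set \<open>A\<close> of positive
measure that is invariant under \<open>w \<mapsto> u w\<close> for unimodular \<open>u\<close>. So the representing function may be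
multiplied by \<open>1\<^sub>A(w) / m(A)\<close> without changing the coefficients at \<open>z(n)\<close>
(\<open>localized_kernel_coefficient\<close>). If the sets have measure at least \<open>1/2\<close> and if every \<open>z\<close> is in the
support only for \<open>\<delta>\<close> in a bounded number of dyadic shells \<open>2^(-k-1) < \<delta> \<le> 2^(-k)\<close>, the integral of the
moduli is bounded, because one shell contributes \<open>O(1)\<close>.

Such sets are cut out by laws of large numbers. Fix a window of primes, those for which \<open>log (log p)\<close> is
in an interval of length about \<open>2^i log 2\<close>, smoothed by the weights
\<open>p powr (-d\<^sub>1) - p powr (-d\<^sub>2)\<close>. For most \<open>w\<close> the weighted sum of \<open>w\<^sub>p / sqrt p\<close> over the window is small
compared with \<open>2^i\<close>, as its variance is only \<open>O(2^i)\<close>. Let \<open>\<delta>'\<close> be much smaller than \<open>\<delta>\<close> and take a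
window lying between them. There the radius belonging to \<open>\<delta>\<close> is negligible and the one belonging to
\<open>\<delta>'\<close> is almost \<open>1 / sqrt p\<close>, so the two sums formed from the same \<open>z\<close> differ by about the weighted sum
of \<open>1 / p\<close>, which is \<open>2^i log 2\<close> by the Euler product. They cannot both be small. The second order term
of the change of coordinates contributes the sum of \<open>z\<^sub>p\<^sup>2 / p\<close>, of the same size in the worst case; a
second law of large numbers, for the squares, is imposed to exclude it (\<open>window_sum_le\<close>,
\<open>typical_separation\<close>). Chebyshev's inequality and the choice of a dyadic family of windows
near the scale \<open>k\<close> give the measure bound (\<open>typical_prob\<close>).

All of this is done with finitely many primes and with Riemann sums in \<open>\<delta>\<close>. It produces uniformly
bounded functions whose coefficients converge to the required ones (\<open>approximate_symbol\<close>), and a weak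
limit of them is the symbol (\<open>bounded_weak_limit\<close>).\<close>

section \<open>Square integrable functions and weak limits\<close>

lemma norm_add_square_le:
  fixes a b :: complex
  shows "(cmod (a + b))\<^sup>2 \<le> 2 * (cmod a)\<^sup>2 + 2 * (cmod b)\<^sup>2"
    and "(cmod (a - b))\<^sup>2 \<le> 2 * (cmod a)\<^sup>2 + 2 * (cmod b)\<^sup>2"
proof -
  have "(cmod (a + b))\<^sup>2 + (cmod (a - b))\<^sup>2 = 2 * (cmod a)\<^sup>2 + 2 * (cmod b)\<^sup>2"
    unfolding cmod_power2 by (simp add: power2_eq_square algebra_simps)
  then show "(cmod (a + b))\<^sup>2 \<le> 2 * (cmod a)\<^sup>2 + 2 * (cmod b)\<^sup>2"
    "(cmod (a - b))\<^sup>2 \<le> 2 * (cmod a)\<^sup>2 + 2 * (cmod b)\<^sup>2"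
    by (smt (verit) zero_le_power2)+
qed

lemma L2_measurable: "f \<in> L2 M \<Longrightarrow> f \<in> borel_measurable M"
  and L2_integrable_square: "f \<in> L2 M \<Longrightarrow> integrable M (\<lambda>x. (cmod (f x))\<^sup>2)"
  by (auto simp: L2_def)

lemma L2_mono:
  assumes "f \<in> L2 M" "g \<in> L2 M" "h \<in> borel_measurable M"
    and "\<And>x. x \<in> space M \<Longrightarrow> (cmod (h x))\<^sup>2 \<le> 2 * (cmod (f x))\<^sup>2 + 2 * (cmod (g x))\<^sup>2"
  shows "h \<in> L2 M"
proof -
  have "integrable M (\<lambda>x. 2 * (cmod (f x))\<^sup>2 + 2 * (cmod (g x))\<^sup>2)"
    using assms by (intro Bochner_Integration.integrable_add integrable_mult_right) (auto simp: L2_def)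
  from Bochner_Integration.integrable_bound[OF this, of "\<lambda>x. (cmod (h x))\<^sup>2"] show ?thesis
    using assms(3,4) by (auto simp: L2_def)
qed

lemma L2_add:
  assumes "f \<in> L2 M" "g \<in> L2 M"
  shows "(\<lambda>x. f x + g x) \<in> L2 M"
  by (rule L2_mono[OF assms borel_measurable_add[OF assms[THEN L2_measurable]] norm_add_square_le(1)])

lemma L2_diff:
  assumes "f \<in> L2 M" "g \<in> L2 M"
  shows "(\<lambda>x. f x - g x) \<in> L2 M"
  by (rule L2_mono[OF assms borel_measurable_diff[OF assms[THEN L2_measurable]] norm_add_square_le(2)])

lemma L2_mult: "f \<in> L2 M \<Longrightarrow> (\<lambda>x. c * f x) \<in> L2 M"
  by (auto simp: L2_def norm_mult power_mult_distrib)

lemma L2_zero: "(\<lambda>x. 0) \<in> L2 M"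
  by (auto simp: L2_def)

lemma L2_sum: "(\<And>n. n \<in> S \<Longrightarrow> f n \<in> L2 M) \<Longrightarrow> (\<lambda>x. \<Sum>n\<in>S. f n x) \<in> L2 M"
  by (induction S rule: infinite_finite_induct) (auto intro: L2_add simp: L2_zero)

lemma L2_bounded:
  assumes "finite_measure M" "f \<in> borel_measurable M" "AE x in M. cmod (f x) \<le> C"
  shows "f \<in> L2 M"
proof -
  have "AE x in M. norm ((cmod (f x))\<^sup>2) \<le> C\<^sup>2"
    using assms(3) by eventually_elim (simp add: power_mono)
  from finite_measure.integrable_const_bound[OF assms(1) this] show ?thesis
    using assms(2) by (simp add: L2_def)
qed

lemma L2_inner_integrable:
  assumes "f \<in> L2 M" "g \<in> L2 M"
  shows "integrable M (\<lambda>x. f x * cnj (g x))"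
proof -
  have "integrable M (\<lambda>x. (cmod (f x))\<^sup>2 + (cmod (g x))\<^sup>2)"
    using assms by (auto simp: L2_def)
  moreover have "cmod (a * cnj b) \<le> (cmod a)\<^sup>2 + (cmod b)\<^sup>2" for a b
  proof -
    have "2 * (cmod a * cmod b) \<le> (cmod a)\<^sup>2 + (cmod b)\<^sup>2"
      using sum_squares_bound[of "cmod a" "cmod b"] by simp
    moreover have "cmod a * cmod b \<ge> 0" by simp
    moreover have "cmod (a * cnj b) = cmod a * cmod b" by (simp add: norm_mult)
    ultimately show ?thesis by linarith
  qed
  moreover have "(\<lambda>x. f x * cnj (g x)) \<in> borel_measurable M"
    using assms[THEN L2_measurable] borel_measurable_continuous_onI[OF continuous_on_cnj[OF continuous_on_id]]
    by (intro borel_measurable_times measurable_compose[of g M borel cnj]) auto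
  ultimately show ?thesis
    by (rule_tac Bochner_Integration.integrable_bound[where f = "\<lambda>x. (cmod (f x))\<^sup>2 + (cmod (g x))\<^sup>2"])
      (auto intro: order_trans[OF _ abs_ge_self])
qed

lemma L2_inner_diff_left:
  assumes "f \<in> L2 M" "g \<in> L2 M" "h \<in> L2 M"
  shows "L2_inner M (\<lambda>x. f x - g x) h = L2_inner M f h - L2_inner M g h"
  unfolding L2_inner_def left_diff_distrib
  by (rule Bochner_Integration.integral_diff) (intro L2_inner_integrable assms)+

lemma L2_inner_sum_left:
  assumes "\<And>n. n \<in> S \<Longrightarrow> f n \<in> L2 M" "h \<in> L2 M"
  shows "L2_inner M (\<lambda>x. \<Sum>n\<in>S. c n * f n x) h = (\<Sum>n\<in>S. c n * L2_inner M (f n) h)"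
proof -
  have "L2_inner M (\<lambda>x. \<Sum>n\<in>S. c n * f n x) h = (\<integral>x. (\<Sum>n\<in>S. c n * (f n x * cnj (h x))) \<partial>M)"
    by (simp add: L2_inner_def sum_distrib_right mult.assoc)
  also have "\<dots> = (\<Sum>n\<in>S. c n * L2_inner M (f n) h)"
    using assms
    by (subst Bochner_Integration.integral_sum) (auto simp: L2_inner_def intro!: L2_inner_integrable)
  finally show ?thesis .
qed

lemma L2_inner_cnj: "L2_inner M f g = cnj (L2_inner M g f)"
proof -
  have "cnj (L2_inner M g f) = (\<integral>x. cnj (g x * cnj (f x)) \<partial>M)"
    unfolding L2_inner_def by (rule Bochner_Integration.integral_cnj[symmetric])
  then show ?thesis by (simp add: L2_inner_def mult.commute)
qed

lemma L2_norm_power2: "(L2_norm M f)\<^sup>2 = (\<integral>x. (cmod (f x))\<^sup>2 \<partial>M)"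
  by (simp add: L2_norm_def)

lemma L2_norm_nonneg: "L2_norm M f \<ge> 0"
  by (simp add: L2_norm_def)

lemma L2_Cauchy_Schwarz:
  assumes f: "f \<in> L2 M" and g: "g \<in> L2 M"
  shows "cmod (L2_inner M f g) \<le> L2_norm M f * L2_norm M g"
proof -
  let ?a = "L2_norm M f" and ?b = "L2_norm M g"
  have le: "2 * cmod (L2_inner M f g) \<le> t * ?a\<^sup>2 + ?b\<^sup>2 / t" if "t > 0" for t
  proof -
    have pt: "2 * cmod (f x * cnj (g x)) \<le> t * (cmod (f x))\<^sup>2 + (cmod (g x))\<^sup>2 / t" for x
    proof -
      have "0 \<le> (t * cmod (f x) - cmod (g x))\<^sup>2 / t" using that by simp
      also have "\<dots> = t * (cmod (f x))\<^sup>2 + (cmod (g x))\<^sup>2 / t - 2 * (cmod (f x) * cmod (g x))"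
        using that by (simp add: field_simps power2_eq_square)
      finally show ?thesis by (simp add: norm_mult)
    qed
    have "2 * cmod (L2_inner M f g) \<le> (\<integral>x. 2 * cmod (f x * cnj (g x)) \<partial>M)"
      unfolding L2_inner_def by simp
    also have "\<dots> \<le> (\<integral>x. t * (cmod (f x))\<^sup>2 + (cmod (g x))\<^sup>2 / t \<partial>M)"
      using f g L2_inner_integrable[OF f g] by (intro integral_mono pt) (auto simp: L2_def)
    also have "\<dots> = t * ?a\<^sup>2 + ?b\<^sup>2 / t"
      using f g by (simp add: L2_norm_power2 L2_def)
    finally show ?thesis .
  qed
  have nn: "?a \<ge> 0" "?b \<ge> 0" by (simp_all add: L2_norm_nonneg)
  show ?thesis
  proof (cases "?a = 0 \<or> ?b = 0")
    case False
    then have "?a > 0" "?b > 0" using nn by auto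
    then have "?b / ?a > 0" "?b / ?a * ?a\<^sup>2 = ?a * ?b" "?b\<^sup>2 / (?b / ?a) = ?a * ?b"
      by (simp_all add: power2_eq_square)
    with le[of "?b / ?a"] show ?thesis by linarith
  next
    case True
    have "cmod (L2_inner M f g) \<le> e" if e: "e > 0" for e
    proof -
      define K where "K = ?a\<^sup>2 + ?b\<^sup>2 + 1"
      have K: "K > 0" by (simp add: K_def add_nonneg_pos)
      from True show ?thesis
      proof
        assume a0: "?a = 0"
        have "K / e > 0" using K e by simp
        from le[OF this] have "2 * cmod (L2_inner M f g) \<le> ?b\<^sup>2 * e / K" by (simp add: a0)
        also have "\<dots> \<le> K * e / K"
          using K e by (intro divide_right_mono mult_right_mono) (auto simp: K_def)
        finally show ?thesis using K e by simp
      next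
        assume b0: "?b = 0"
        have "e / K > 0" using K e by simp
        from le[OF this] have "2 * cmod (L2_inner M f g) \<le> ?a\<^sup>2 * e / K" by (simp add: b0 mult.commute)
        also have "\<dots> \<le> K * e / K"
          using K e by (intro divide_right_mono mult_right_mono) (auto simp: K_def)
        finally show ?thesis using K e by simp
      qed
    qed
    then have "cmod (L2_inner M f g) \<le> 0" by (rule_tac field_le_epsilon) simp
    with mult_nonneg_nonneg[OF nn] show ?thesis by linarith
  qed
qed

lemma L2_norm_eq_sqrt_limit:
  "(\<lambda>N. \<integral>x. (cmod (f N x))\<^sup>2 \<partial>M) \<longlonglongrightarrow> 0 \<Longrightarrow> (\<lambda>N. L2_norm M (f N)) \<longlonglongrightarrow> 0"
  unfolding L2_norm_def by (drule tendsto_real_sqrt) simp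

text \<open>The Riesz--Fischer theorem for functions rather than classes. The subsequence is part of the
conclusion because pointwise bounds survive almost everywhere convergence but are not visible in the
norm.\<close>

lemma L2_complete:
  assumes M: "prob_space M" and f: "\<And>N. f N \<in> L2 M"
    and cauchy: "\<And>e. e > 0 \<Longrightarrow> \<exists>N. \<forall>i\<ge>N. \<forall>j\<ge>N. (\<integral>x. (cmod (f i x - f j x))\<^sup>2 \<partial>M) < e"
  obtains g r where "g \<in> L2 M" "strict_mono (r :: nat \<Rightarrow> nat)" "AE x in M. (\<lambda>i. f (r i) x) \<longlonglongrightarrow> g x"
    "(\<lambda>N. L2_norm M (\<lambda>x. f N x - g x)) \<longlonglongrightarrow> 0"
proof -
  interpret prob_space M by fact
  have fm[measurable]: "f N \<in> borel_measurable M" for N using f L2_measurable by blast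
  have fi: "integrable M (f N)" for N
  proof -
    have "(\<lambda>x. 1) \<in> L2 M" by (auto simp: L2_def)
    from L2_inner_integrable[OF f this] show ?thesis by simp
  qed
  have L1: "(\<integral>x. norm (f i x - f j x) \<partial>M) \<le> sqrt (\<integral>x. (cmod (f i x - f j x))\<^sup>2 \<partial>M)" for i j
  proof -
    have "variance (\<lambda>x. norm (f i x - f j x)) =
        (\<integral>x. (norm (f i x - f j x))\<^sup>2 \<partial>M) - (\<integral>x. norm (f i x - f j x) \<partial>M)\<^sup>2"
      using fi L2_integrable_square[OF L2_diff[OF f f]] by (intro variance_eq) auto
    moreover have "variance (\<lambda>x. norm (f i x - f j x)) \<ge> 0" by simp
    ultimately have "(\<integral>x. norm (f i x - f j x) \<partial>M)\<^sup>2 \<le> (\<integral>x. (norm (f i x - f j x))\<^sup>2 \<partial>M)" by linarith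
    then show ?thesis by (rule real_le_rsqrt)
  qed
  have "\<exists>N. \<forall>i\<ge>N. \<forall>j\<ge>N. (\<integral>x. norm (f i x - f j x) \<partial>M) < e" if "e > 0" for e
  proof -
    from cauchy[of "e\<^sup>2"] that obtain N where
      N: "\<And>i j. i \<ge> N \<Longrightarrow> j \<ge> N \<Longrightarrow> (\<integral>x. (cmod (f i x - f j x))\<^sup>2 \<partial>M) < e\<^sup>2" by auto
    have "\<forall>i\<ge>N. \<forall>j\<ge>N. (\<integral>x. norm (f i x - f j x) \<partial>M) < e"
    proof (intro allI impI)
      fix i j assume "N \<le> i" "N \<le> j"
      with N have "sqrt (\<integral>x. (cmod (f i x - f j x))\<^sup>2 \<partial>M) < e"
        using that by (intro real_less_lsqrt) auto
      with L1[of i j] show "(\<integral>x. norm (f i x - f j x) \<partial>M) < e" by linarith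
    qed
    then show ?thesis by blast
  qed
  from cauchy_L1_AE_cauchy_subseq[OF fi this] obtain r where
    r: "strict_mono r" "AE x in M. Cauchy (\<lambda>i. f (r i) x)" by blast
  define g where "g x = lim (\<lambda>i. f (r i) x)" for x
  have gm[measurable]: "g \<in> borel_measurable M" unfolding g_def by measurable
  have lim: "AE x in M. (\<lambda>i. f (r i) x) \<longlonglongrightarrow> g x"
    using r(2) by eventually_elim (auto simp: g_def Cauchy_convergent_iff convergent_LIMSEQ_iff)
  have close: "\<exists>N. \<forall>i\<ge>N. (\<lambda>x. f i x - g x) \<in> L2 M \<and> (\<integral>x. (cmod (f i x - g x))\<^sup>2 \<partial>M) \<le> e" if "e > 0" for e
  proof -
    from cauchy[OF that] obtain N where
      N: "\<And>i j. i \<ge> N \<Longrightarrow> j \<ge> N \<Longrightarrow> (\<integral>x. (cmod (f i x - f j x))\<^sup>2 \<partial>M) < e" by blast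
    have "(\<lambda>x. f i x - g x) \<in> L2 M \<and> (\<integral>x. (cmod (f i x - g x))\<^sup>2 \<partial>M) \<le> e" if i: "i \<ge> N" for i
    proof -
      have lm: "ennreal ((cmod (f i x - g x))\<^sup>2) = liminf (\<lambda>k. ennreal ((cmod (f i x - f (r k) x))\<^sup>2))"
        if "(\<lambda>k. f (r k) x) \<longlonglongrightarrow> g x" for x
      proof -
        have "(\<lambda>k. ennreal ((cmod (f i x - f (r k) x))\<^sup>2)) \<longlonglongrightarrow> ennreal ((cmod (f i x - g x))\<^sup>2)"
          by (intro tendsto_intros that)
        from lim_imp_Liminf[OF sequentially_bot this] show ?thesis by (rule sym)
      qed
      have "(\<integral>\<^sup>+x. ennreal ((cmod (f i x - g x))\<^sup>2) \<partial>M)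
          = (\<integral>\<^sup>+x. liminf (\<lambda>k. ennreal ((cmod (f i x - f (r k) x))\<^sup>2)) \<partial>M)"
        by (rule nn_integral_cong_AE, rule AE_mp[OF lim], rule AE_I2, rule impI, rule lm)
      also have "\<dots> \<le> liminf (\<lambda>k. (\<integral>\<^sup>+x. ennreal ((cmod (f i x - f (r k) x))\<^sup>2) \<partial>M))"
        by (rule nn_integral_liminf) measurable
      also have "\<dots> \<le> ennreal e"
      proof (rule Liminf_le)
        show "\<forall>\<^sub>F k in sequentially. (\<integral>\<^sup>+x. ennreal ((cmod (f i x - f (r k) x))\<^sup>2) \<partial>M) \<le> ennreal e"
          using eventually_ge_at_top[of N]
        proof eventually_elim
          case (elim k)
          have "r k \<ge> N" using seq_suble[OF r(1), of k] elim by linarith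
          then have "(\<integral>x. (cmod (f i x - f (r k) x))\<^sup>2 \<partial>M) < e" using N i by blast
          moreover have "(\<integral>\<^sup>+x. ennreal ((cmod (f i x - f (r k) x))\<^sup>2) \<partial>M)
            = ennreal (\<integral>x. (cmod (f i x - f (r k) x))\<^sup>2 \<partial>M)"
            by (rule nn_integral_eq_integral[OF L2_integrable_square[OF L2_diff[OF f f]]]) simp
          ultimately show ?case by (simp add: ennreal_leI)
        qed
      qed simp
      finally have le: "(\<integral>\<^sup>+x. ennreal ((cmod (f i x - g x))\<^sup>2) \<partial>M) \<le> ennreal e" .
      have int: "integrable M (\<lambda>x. (cmod (f i x - g x))\<^sup>2)"
      proof (rule integrableI_bounded)
        show "(\<integral>\<^sup>+x. ennreal (norm ((cmod (f i x - g x))\<^sup>2)) \<partial>M) < \<infinity>"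
          using le le_less_trans[OF le, of \<infinity>] by simp
      qed measurable
      have "(\<integral>x. (cmod (f i x - g x))\<^sup>2 \<partial>M) \<le> e"
        using le \<open>e > 0\<close> nn_integral_eq_integral[OF int] by (simp add: ennreal_le_iff)
      with int show ?thesis by (simp add: L2_def)
    qed
    then show ?thesis by blast
  qed
  from close[of 1] obtain N where "(\<lambda>x. f N x - g x) \<in> L2 M" by auto
  from L2_diff[OF f[of N] this] have g: "g \<in> L2 M" by simp
  have "(\<lambda>N. \<integral>x. (cmod (f N x - g x))\<^sup>2 \<partial>M) \<longlonglongrightarrow> 0"
  proof (rule LIMSEQ_I)
    fix e :: real assume "e > 0"
    with close[of "e / 2"] obtain N where "\<And>i. i \<ge> N \<Longrightarrow> (\<integral>x. (cmod (f i x - g x))\<^sup>2 \<partial>M) \<le> e / 2" by auto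
    then have half: "norm ((\<integral>x. (cmod (f i x - g x))\<^sup>2 \<partial>M) - 0) \<le> e / 2" if "i \<ge> N" for i
      using that by (simp add: abs_of_nonneg)
    have "norm ((\<integral>x. (cmod (f i x - g x))\<^sup>2 \<partial>M) - 0) < e" if "i \<ge> N" for i
      using half[OF that] \<open>e > 0\<close> by linarith
    then show "\<exists>N. \<forall>n\<ge>N. norm ((\<integral>x. (cmod (f n x - g x))\<^sup>2 \<partial>M) - 0) < e"
      by blast
  qed
  from that[OF g r(1) lim L2_norm_eq_sqrt_limit[OF this]] show ?thesis .
qed

lemma L2_inner_tendsto:
  assumes f: "\<And>N. f N \<in> L2 M" and g: "g \<in> L2 M" and h: "h \<in> L2 M"
    and lim: "(\<lambda>N. L2_norm M (\<lambda>x. f N x - g x)) \<longlonglongrightarrow> 0"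
  shows "(\<lambda>N. L2_inner M (f N) h) \<longlonglongrightarrow> L2_inner M g h"
proof (rule Lim_null_comparison[THEN LIM_zero_cancel])
  show "(\<lambda>N. L2_norm M (\<lambda>x. f N x - g x) * L2_norm M h) \<longlonglongrightarrow> 0"
    using tendsto_mult_left_zero[OF lim] .
  have "norm (L2_inner M (f N) h - L2_inner M g h) \<le> L2_norm M (\<lambda>x. f N x - g x) * L2_norm M h" for N
    using L2_Cauchy_Schwarz[OF L2_diff[OF f[of N] g] h] by (simp add: L2_inner_diff_left[OF f g h])
  then show "\<forall>\<^sub>F N in sequentially. norm (L2_inner M (f N) h - L2_inner M g h)
      \<le> L2_norm M (\<lambda>x. f N x - g x) * L2_norm M h"
    by (intro always_eventually allI)
qed

text \<open>A substitute for weak compactness of balls of \<open>L\<^sup>\<infinity>\<close>. The functions bounded by \<open>C\<close> whose first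
\<open>K\<close> coefficients are within \<open>1 / (K + 1)\<close> of the prescribed ones form a decreasing sequence of
nonempty convex sets. Elements of almost minimal \<open>L\<^sup>2\<close> norm in these sets form a Cauchy sequence, by
the parallelogram identity and since midpoints stay in the larger set.\<close>

lemma bounded_weak_limit:
  fixes e :: "nat \<Rightarrow> 'a \<Rightarrow> complex"
  assumes M: "prob_space M" and e: "\<And>n. n \<ge> 1 \<Longrightarrow> e n \<in> L2 M"
    and approx: "\<And>K. \<exists>f\<in>borel_measurable M. (\<forall>x\<in>space M. cmod (f x) \<le> C) \<and>
      (\<forall>n\<in>{1..K}. cmod (L2_inner M f (e n) - b n) \<le> 1 / real (Suc K))"
  shows "\<exists>B\<in>borel_measurable M. (AE x in M. cmod (B x) \<le> C) \<and> (\<forall>n\<ge>1. L2_inner M B (e n) = b n)"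
proof -
  interpret prob_space M by fact
  define S where "S K = {f \<in> borel_measurable M. (\<forall>x\<in>space M. cmod (f x) \<le> C) \<and>
      (\<forall>n\<in>{1..K}. cmod (L2_inner M f (e n) - b n) \<le> 1 / real (Suc K))}" for K
  define q where "q f = (\<integral>x. (cmod (f x))\<^sup>2 \<partial>M)" for f :: "'a \<Rightarrow> complex"
  define m where "m K = (INF f\<in>S K. q f)" for K
  have S_L2: "f \<in> L2 M" if "f \<in> S K" for f K
    using that by (intro L2_bounded[of M f C]) (auto simp: S_def finite_measure_axioms)
  have bdd: "bdd_below (q ` S K)" for K
    by (rule bdd_belowI[of _ 0]) (auto simp: q_def)
  have ne: "S K \<noteq> {}" for K using approx[of K] by (auto simp: S_def)
  have anti: "S L \<subseteq> S K" if "K \<le> L" for K L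
  proof
    fix f assume f: "f \<in> S L"
    have "1 / real (Suc L) \<le> 1 / real (Suc K)" using that by (simp add: field_simps)
    then show "f \<in> S K" using f that by (force simp: S_def)
  qed
  have q_le: "q f \<le> C\<^sup>2" if f: "f \<in> S K" for f K
  proof -
    have "q f \<le> (\<integral>x. C\<^sup>2 \<partial>M)"
      unfolding q_def using L2_integrable_square[OF S_L2[OF f]] f
      by (intro integral_mono) (auto simp: S_def intro!: power_mono)
    then show ?thesis by (simp add: prob_space)
  qed
  have m_le: "m K \<le> q f" if "f \<in> S K" for f K
    unfolding m_def by (rule cINF_lower[OF bdd that])
  have m_bound: "m K \<le> C\<^sup>2" for K using ne[of K] m_le q_le by (meson all_not_in_conv order_trans)
  have m_mono: "m K \<le> m L" if "K \<le> L" for K L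
    unfolding m_def by (rule cINF_superset_mono[OF ne bdd anti[OF that]]) simp
  have "\<exists>f\<in>S K. q f < m K + 1 / real (Suc K)" for K
    using cINF_less_iff[OF ne bdd, of K "m K + 1 / real (Suc K)"] by (simp add: m_def)
  then obtain f where f: "\<And>K. f K \<in> S K" "\<And>K. q (f K) < m K + 1 / real (Suc K)" by metis
  have m_conv: "convergent m"
  proof -
    have "incseq m" using m_mono by (simp add: incseq_def)
    moreover have "\<forall>i. m i \<le> C\<^sup>2" using m_bound by simp
    ultimately obtain l where "m \<longlonglongrightarrow> l" by (rule incseq_convergent)
    then show ?thesis by (rule convergentI)
  qed
  \<comment> \<open>Convexity of the sets, together with their monotonicity.\<close>
  have mid: "(\<lambda>x. (f K x + f L x) / 2) \<in> S K" if "K \<le> L" for K L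
  proof -
    have fK: "f K \<in> S K" and fL: "f L \<in> S K" using f(1) anti[OF that] by auto
    have "cmod ((f K x + f L x) / 2) \<le> C" if "x \<in> space M" for x
    proof -
      have "cmod (f K x + f L x) \<le> C + C"
        using fK fL that by (intro order_trans[OF norm_triangle_ineq] add_mono) (auto simp: S_def)
      then show ?thesis by (simp add: norm_divide)
    qed
    moreover have "cmod (L2_inner M (\<lambda>x. (f K x + f L x) / 2) (e n) - b n) \<le> 1 / real (Suc K)"
      if n: "n \<in> {1..K}" for n
    proof -
      have en: "e n \<in> L2 M" using e n by simp
      have "L2_inner M (\<lambda>x. (f K x + f L x) / 2) (e n)
          = L2_inner M (\<lambda>x. \<Sum>i\<in>{False, True}. 1 / 2 * (if i then f K else f L) x) (e n)"
        by (simp add: add.commute add_divide_distrib)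
      also have "\<dots> = (L2_inner M (f K) (e n) + L2_inner M (f L) (e n)) / 2"
        using S_L2[OF fK] S_L2[OF fL] en
        by (subst L2_inner_sum_left) (auto simp: field_simps)
      finally have eq: "L2_inner M (\<lambda>x. (f K x + f L x) / 2) (e n) - b n
          = ((L2_inner M (f K) (e n) - b n) + (L2_inner M (f L) (e n) - b n)) / 2"
        by (simp add: field_simps)
      have le: "cmod ((L2_inner M (f K) (e n) - b n) + (L2_inner M (f L) (e n) - b n))
          \<le> 1 / real (Suc K) + 1 / real (Suc K)"
        using fK fL n by (intro order_trans[OF norm_triangle_ineq] add_mono) (auto simp: S_def)
      show ?thesis unfolding eq norm_divide using le by simp
    qed
    ultimately show ?thesis
      using fK fL by (auto simp: S_def)
  qed
  have par: "q (\<lambda>x. f K x - f L x) \<le> 2 * (m L - m K) + 4 / real (Suc K)" if "K \<le> L" for K L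
  proof -
    have pt: "(cmod (a - b))\<^sup>2 = 2 * (cmod a)\<^sup>2 + 2 * (cmod b)\<^sup>2 - 4 * (cmod ((a + b) / 2))\<^sup>2" for a b :: complex
      unfolding cmod_power2 by (simp add: power2_eq_square field_simps)
    have int: "integrable M (\<lambda>x. (cmod (f N x))\<^sup>2)" for N
      using L2_integrable_square[OF S_L2[OF f(1)]] .
    have "q (\<lambda>x. f K x - f L x) = 2 * q (f K) + 2 * q (f L) - 4 * q (\<lambda>x. (f K x + f L x) / 2)"
      using int L2_integrable_square[OF S_L2[OF mid[OF that]]] unfolding q_def pt by simp
    moreover have "1 / real (Suc L) \<le> 1 / real (Suc K)" using that by (simp add: field_simps)
    moreover note m_le[OF mid[OF that]] f(2)[of K] f(2)[of L]
    ultimately show ?thesis by (simp add: algebra_simps)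
  qed
  have f_L2: "f N \<in> L2 M" for N using S_L2[OF f(1)] .
  have "\<exists>N. \<forall>i\<ge>N. \<forall>j\<ge>N. (\<integral>x. (cmod (f i x - f j x))\<^sup>2 \<partial>M) < \<epsilon>" if eps: "\<epsilon> > 0" for \<epsilon>
  proof -
    have "Cauchy m" using m_conv by (simp add: Cauchy_convergent_iff)
    then obtain N1 where N1: "\<And>i j. i \<ge> N1 \<Longrightarrow> j \<ge> N1 \<Longrightarrow> dist (m i) (m j) < \<epsilon> / 4"
      using metric_CauchyD[of m "\<epsilon> / 4"] eps by auto
    obtain N2 :: nat where N2: "8 / \<epsilon> < real N2" using reals_Archimedean2 by blast
    have ord: "q (\<lambda>x. f i x - f j x) < \<epsilon>" if "i \<ge> max N1 N2" "i \<le> j" for i j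
    proof -
      have "8 / \<epsilon> < real (Suc i)" using N2 that by simp
      then have "4 / real (Suc i) < \<epsilon> / 2" using eps by (simp add: field_simps)
      moreover have "2 * (m j - m i) < \<epsilon> / 2"
      proof -
        have "dist (m i) (m j) < \<epsilon> / 4" using N1[of i j] that by simp
        then show ?thesis unfolding dist_real_def abs_less_iff by (auto simp: field_simps)
      qed
      ultimately have "2 * (m j - m i) + 4 / real (Suc i) < \<epsilon> / 2 + \<epsilon> / 2" by (intro add_strict_mono)
      with par[OF that(2)] show ?thesis by (simp only: field_sum_of_halves order.strict_trans1)
    qed
    have "q (\<lambda>x. f i x - f j x) < \<epsilon>" if "i \<ge> max N1 N2" "j \<ge> max N1 N2" for i j
      using ord[of i j] ord[of j i] that by (cases "i \<le> j") (simp_all add: q_def norm_minus_commute)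
    then show ?thesis unfolding q_def by blast
  qed
  then obtain g r where g: "g \<in> L2 M" "strict_mono r"
    and AE: "AE x in M. (\<lambda>i. f (r i) x) \<longlonglongrightarrow> g x"
    and lim: "(\<lambda>N. L2_norm M (\<lambda>x. f N x - g x)) \<longlonglongrightarrow> 0" by (rule L2_complete[OF M f_L2])
  have "AE x in M. cmod (g x) \<le> C"
    using AE AE_space
  proof eventually_elim
    case (elim x)
    have "(\<lambda>i. cmod (f (r i) x)) \<longlonglongrightarrow> cmod (g x)" by (intro tendsto_norm elim)
    moreover have "cmod (f (r i) x) \<le> C" for i using f(1)[of "r i"] elim by (auto simp: S_def)
    ultimately show ?case by (intro LIMSEQ_le_const2) auto
  qed
  moreover have "L2_inner M g (e n) = b n" if n: "n \<ge> 1" for n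
  proof (rule LIMSEQ_unique)
    show "(\<lambda>N. L2_inner M (f N) (e n)) \<longlonglongrightarrow> L2_inner M g (e n)"
      using L2_inner_tendsto[OF f_L2 g(1) e[OF n] lim] .
    show "(\<lambda>N. L2_inner M (f N) (e n)) \<longlonglongrightarrow> b n"
    proof (rule Lim_null_comparison[THEN LIM_zero_cancel])
      show "(\<lambda>N. 1 / real (Suc N)) \<longlonglongrightarrow> 0" using LIMSEQ_inverse_real_of_nat by (simp add: inverse_eq_divide)
      show "\<forall>\<^sub>F N in sequentially. norm (L2_inner M (f N) (e n) - b n) \<le> 1 / real (Suc N)"
        using eventually_ge_at_top[of n]
      proof eventually_elim
        case (elim N)
        then show ?case using f(1)[of N] n by (simp add: S_def)
      qed
    qed
  qed
  ultimately show ?thesis using L2_measurable[OF g(1)] by blast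
qed

section \<open>Fourier analysis on the infinite torus\<close>

lemma norm_torus_coord: "z \<in> space torus \<Longrightarrow> cmod (z j) = 1"
  by (auto simp: torus_def space_PiM space_circle PiE_iff)

lemma measurable_torus_coord: "(\<lambda>z. z j) \<in> measurable torus circle_measure"
  unfolding torus_def by (rule measurable_component_singleton) simp

lemma borel_measurable_circle_id: "(\<lambda>x. x) \<in> borel_measurable circle_measure"
  unfolding measurable_cong_sets[OF sets_circle refl] by (rule measurable_restrict_space1) simp

lemma borel_measurable_torus_coord [measurable]: "(\<lambda>z. z j) \<in> borel_measurable torus"
  by (rule measurable_compose[OF measurable_torus_coord borel_measurable_circle_id])

lemma borel_measurable_cnj [measurable (raw)]:
  "f \<in> borel_measurable M \<Longrightarrow> (\<lambda>x. cnj (f x)) \<in> borel_measurable M"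
  by (rule borel_measurable_continuous_on[of cnj]) (intro continuous_intros)

lemma borel_measurable_bohr_char [measurable]: "bohr_char n \<in> borel_measurable torus"
  unfolding bohr_char_def by (intro borel_measurable_prod borel_measurable_power) measurable

lemma norm_bohr_char: "z \<in> space torus \<Longrightarrow> cmod (bohr_char n z) = 1"
  by (simp add: bohr_char_def prod_norm[symmetric] norm_power norm_torus_coord)

lemma finite_measure_torus: "finite_measure torus"
  using prob_space_torus prob_space.finite_measure by blast

lemma bohr_char_L2: "bohr_char n \<in> L2 torus"
  by (rule L2_bounded[OF finite_measure_torus, of _ 1]) (auto simp: norm_bohr_char intro!: AE_I2)

lemma measurable_torus_mult:
  assumes w: "\<And>j. cmod (w j) = 1"
  shows "(\<lambda>z j. w j * z j) \<in> measurable torus torus"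
  unfolding torus_def
proof (rule measurable_PiM_single')
  fix j :: nat
  have "(\<lambda>z. z j) \<in> measurable (PiM UNIV (\<lambda>_::nat. circle_measure)) circle_measure"
    by (rule measurable_component_singleton) simp
  from measurable_compose[OF this measurable_circle_mult[OF w[of j]]]
  show "(\<lambda>z. w j * z j) \<in> measurable (PiM UNIV (\<lambda>_::nat. circle_measure)) circle_measure" .
qed (auto simp: space_PiM space_circle norm_mult w PiE_iff)

lemma integral_torus_mult:
  fixes f :: "(nat \<Rightarrow> complex) \<Rightarrow> complex"
  assumes w: "\<And>j. cmod (w j) = 1" and f: "f \<in> borel_measurable torus"
  shows "(\<integral>z. f (\<lambda>j. w j * z j) \<partial>torus) = (\<integral>z. f z \<partial>torus)"
  using integral_distr[OF measurable_torus_mult[OF w] f, symmetric] by (simp add: distr_torus_mult[OF w])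

lemma bohr_char_times: "bohr_char n (\<lambda>j. w j * z j) = bohr_char n w * bohr_char n z"
  by (simp add: bohr_char_def power_mult_distrib prod.distrib)

lemma prime_eq_nth_prime:
  assumes "prime p" obtains j where "p = nth_prime j"
  using range_enumerate[OF primes_infinite] assms unfolding nth_prime_def by (metis (mono_tags) mem_Collect_eq rangeE)

lemma bohr_char_single:
  assumes "n \<noteq> 0"
  shows "bohr_char n (\<lambda>i. if i = j then c else 1) = c ^ multiplicity (nth_prime j) n"
proof -
  let ?J = "insert j {i. nth_prime i dvd n}"
  have "bohr_char n (\<lambda>i. if i = j then c else 1)
      = (\<Prod>i\<in>?J. (if i = j then c else 1) ^ multiplicity (nth_prime i) n)"
    using finite_nth_prime_dvd[OF assms] by (intro bohr_char_superset[OF assms]) auto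
  also have "\<dots> = (\<Prod>i\<in>{j}. (if i = j then c else 1) ^ multiplicity (nth_prime i) n)"
    using finite_nth_prime_dvd[OF assms] by (intro prod.mono_neutral_right) auto
  finally show ?thesis by simp
qed

text \<open>If \<open>m \<noteq> n\<close>, some prime has different multiplicities \<open>a\<close> and \<open>b\<close> in them; rotating its
coordinate by \<open>cis (pi / (a - b))\<close> preserves the measure and changes the sign of the integrand.\<close>

lemma bohr_char_orthonormal:
  assumes "m \<noteq> 0" "n \<noteq> 0"
  shows "L2_inner torus (bohr_char m) (bohr_char n) = (if m = n then 1 else 0)"
proof (cases "m = n")
  case True
  have "L2_inner torus (bohr_char n) (bohr_char n) = (\<integral>z. 1 \<partial>torus)"
    unfolding L2_inner_def
    by (rule Bochner_Integration.integral_cong) (auto simp: complex_norm_square[symmetric] norm_bohr_char)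
  then show ?thesis using True prob_space.prob_space[OF prob_space_torus] by simp
next
  case False
  then obtain p where p: "prime p" "multiplicity p m \<noteq> multiplicity p n"
    using multiplicity_eq_nat[of m n] assms by auto
  obtain j where j: "p = nth_prime j" using prime_eq_nth_prime[OF p(1)] .
  define a b where "a = multiplicity p m" and "b = multiplicity p n"
  \<comment> \<open>The rotation by this angle multiplies the integrand by \<open>cis pi = -1\<close>.\<close>
  define t where "t = pi / (real a - real b)"
  define w where "w i = (if i = j then cis t else 1)" for i
  have w: "cmod (w i) = 1" for i by (simp add: w_def)
  have ab: "real a - real b \<noteq> 0" using p by (simp add: a_def b_def)
  have "bohr_char m w = cis (real a * t)" "bohr_char n w = cis (real b * t)"
    using assms unfolding w_def by (simp_all add: bohr_char_single j a_def b_def Complex.DeMoivre)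
  then have "bohr_char m w * cnj (bohr_char n w) = cis (real a * t) * cnj (cis (real b * t))" by simp
  also have "\<dots> = cis ((real a - real b) * t)" by (simp add: cis_cnj cis_mult algebra_simps)
  also have "(real a - real b) * t = pi" using ab by (simp add: t_def)
  finally have neg: "bohr_char m w * cnj (bohr_char n w) = -1" by simp
  have "L2_inner torus (bohr_char m) (bohr_char n)
      = (\<integral>z. bohr_char m (\<lambda>j. w j * z j) * cnj (bohr_char n (\<lambda>j. w j * z j)) \<partial>torus)"
    unfolding L2_inner_def
    by (rule integral_torus_mult[OF w, of "\<lambda>z. bohr_char m z * cnj (bohr_char n z)", symmetric]) measurable
  also have "\<dots> = (\<integral>z. (bohr_char m w * cnj (bohr_char n w)) * (bohr_char m z * cnj (bohr_char n z)) \<partial>torus)"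
    by (simp add: bohr_char_times mult_ac)
  also have "\<dots> = - L2_inner torus (bohr_char m) (bohr_char n)"
    unfolding neg L2_inner_def by simp
  finally have "L2_inner torus (bohr_char m) (bohr_char n) = 0" by (simp add: eq_neg_iff_add_eq_0)
  with False show ?thesis by simp
qed

lemma L2_inner_bohr_sum:
  assumes "finite S" "0 \<notin> S" "n \<noteq> 0"
  shows "L2_inner torus (\<lambda>z. \<Sum>m\<in>S. c m * bohr_char m z) (bohr_char n) = (if n \<in> S then c n else 0)"
proof -
  have "L2_inner torus (\<lambda>z. \<Sum>m\<in>S. c m * bohr_char m z) (bohr_char n) =
      (\<Sum>m\<in>S. c m * L2_inner torus (bohr_char m) (bohr_char n))"
    by (intro L2_inner_sum_left bohr_char_L2)
  also have "\<dots> = (\<Sum>m\<in>S. if m = n then c m else 0)"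
  proof (intro sum.cong refl)
    fix m assume "m \<in> S"
    then have "m \<noteq> 0" using assms(2) by metis
    then show "c m * L2_inner torus (bohr_char m) (bohr_char n) = (if m = n then c m else 0)"
      using assms(3) by (simp add: bohr_char_orthonormal)
  qed
  finally show ?thesis using assms(1) by (simp add: sum.delta)
qed

lemma L2_sum_bohr: "(\<lambda>z. \<Sum>m\<in>S. c m * bohr_char m z) \<in> L2 torus"
  by (intro L2_sum L2_mult bohr_char_L2)

lemma L2_norm_bohr_sum:
  assumes "finite S" "0 \<notin> S"
  shows "(\<integral>z. (cmod (\<Sum>m\<in>S. c m * bohr_char m z))\<^sup>2 \<partial>torus) = (\<Sum>m\<in>S. (cmod (c m))\<^sup>2)"
proof -
  let ?s = "\<lambda>z. \<Sum>m\<in>S. c m * bohr_char m z"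
  have "complex_of_real (\<integral>z. (cmod (?s z))\<^sup>2 \<partial>torus) = L2_inner torus ?s ?s"
    unfolding L2_inner_def by (subst integral_complex_of_real[symmetric]) (simp only: complex_norm_square)
  also have "\<dots> = (\<Sum>m\<in>S. c m * L2_inner torus (bohr_char m) ?s)"
    by (intro L2_inner_sum_left bohr_char_L2 L2_sum_bohr)
  also have "\<dots> = (\<Sum>m\<in>S. c m * cnj (c m))"
  proof (intro sum.cong refl)
    fix m assume m: "m \<in> S"
    then have "m \<noteq> 0" using assms(2) by metis
    from L2_inner_bohr_sum[OF assms this, of c] m have "L2_inner torus ?s (bohr_char m) = c m" by simp
    then show "c m * L2_inner torus (bohr_char m) ?s = c m * cnj (c m)" by (subst L2_inner_cnj) simp
  qed
  also have "\<dots> = complex_of_real (\<Sum>m\<in>S. (cmod (c m))\<^sup>2)"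
    by (simp only: of_real_sum complex_norm_square)
  finally show ?thesis by (simp only: of_real_eq_iff)
qed

lemma bessel_bohr:
  assumes B: "B \<in> L2 torus" and "finite S" "0 \<notin> S" and b: "\<And>n. n \<in> S \<Longrightarrow> L2_inner torus B (bohr_char n) = b n"
  shows "(\<Sum>n\<in>S. (cmod (b n))\<^sup>2) \<le> (L2_norm torus B)\<^sup>2"
proof -
  let ?s = "\<lambda>z. \<Sum>m\<in>S. b m * bohr_char m z" and ?c = "\<Sum>n\<in>S. (cmod (b n))\<^sup>2"
  have "L2_inner torus ?s B = (\<Sum>n\<in>S. b n * L2_inner torus (bohr_char n) B)"
    by (intro L2_inner_sum_left bohr_char_L2 B)
  also have "\<dots> = (\<Sum>n\<in>S. b n * cnj (b n))"
  proof (intro sum.cong refl)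
    fix n assume "n \<in> S"
    then show "b n * L2_inner torus (bohr_char n) B = b n * cnj (b n)" by (subst L2_inner_cnj) (simp add: b)
  qed
  also have "\<dots> = complex_of_real ?c" by (simp only: of_real_sum complex_norm_square)
  finally have eq: "L2_inner torus ?s B = complex_of_real ?c" .
  have c0: "?c \<ge> 0" by (intro sum_nonneg) simp
  have "?c = cmod (L2_inner torus ?s B)" unfolding eq norm_of_real using c0 by (rule abs_of_nonneg[symmetric])
  also have "\<dots> \<le> L2_norm torus ?s * L2_norm torus B" by (rule L2_Cauchy_Schwarz[OF L2_sum_bohr B])
  also have "L2_norm torus ?s = sqrt ?c" unfolding L2_norm_def using assms by (simp add: L2_norm_bohr_sum)
  finally have le: "?c \<le> sqrt ?c * L2_norm torus B" .
  show ?thesis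
  proof (cases "?c = 0")
    case False
    then have "sqrt ?c > 0" using c0 by simp
    moreover have "sqrt ?c * sqrt ?c \<le> sqrt ?c * L2_norm torus B" using le c0 by simp
    ultimately have "sqrt ?c \<le> L2_norm torus B" by (metis mult_left_le_imp_le)
    then show ?thesis using sqrt_le_D by blast
  qed simp
qed

text \<open>The series converges by Bessel's inequality, so no estimate of the coefficients is
required; its sum is the projection because it has the same inner products as \<open>B\<close> with the dense
span of the characters.\<close>

lemma P_plus_fourier_series:
  assumes B: "B \<in> L2 torus" and b: "\<And>n. n \<ge> 1 \<Longrightarrow> L2_inner torus B (bohr_char n) = b n"
  shows "\<exists>G. is_P_plus B G \<and> L2_tendsto torus (\<lambda>N z. \<Sum>n=1..N. b n * bohr_char n z) G"
proof -
  define s where "s N = (\<lambda>z. \<Sum>n=1..N. b n * bohr_char n z)" for N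
  have sL2: "s N \<in> L2 torus" for N unfolding s_def by (rule L2_sum_bohr)
  define a where "a N = (\<Sum>n=1..N. (cmod (b n))\<^sup>2)" for N
  have "incseq a" unfolding a_def by (intro incseq_SucI) simp
  moreover have "\<forall>N. a N \<le> (L2_norm torus B)\<^sup>2"
    unfolding a_def by (intro allI bessel_bohr[OF B] b) auto
  ultimately obtain l where "a \<longlonglongrightarrow> l" by (rule incseq_convergent)
  then have "Cauchy a" using LIMSEQ_imp_Cauchy by blast
  have diff: "(\<integral>z. (cmod (s i z - s j z))\<^sup>2 \<partial>torus) = dist (a i) (a j)" if "i \<le> j" for i j
  proof -
    have *: "(\<Sum>n=1..j. f n) = (\<Sum>n=1..i. f n) + (\<Sum>n\<in>{Suc i..j}. f n)" for f :: "nat \<Rightarrow> 'c::comm_monoid_add"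
      using that by (subst sum.union_disjoint[symmetric]) (auto intro!: sum.cong)
    have "s j z - s i z = (\<Sum>n\<in>{Suc i..j}. b n * bohr_char n z)" for z
      unfolding s_def by (subst *) simp
    then have "(\<integral>z. (cmod (s i z - s j z))\<^sup>2 \<partial>torus) = (\<Sum>n\<in>{Suc i..j}. (cmod (b n))\<^sup>2)"
      by (subst norm_minus_commute) (simp add: L2_norm_bohr_sum)
    also have "\<dots> = dist (a i) (a j)"
    proof -
      have "a j = a i + (\<Sum>n\<in>{Suc i..j}. (cmod (b n))\<^sup>2)" unfolding a_def by (rule *)
      then show ?thesis by (simp add: dist_real_def sum_nonneg)
    qed
    finally show ?thesis .
  qed
  have "\<exists>N. \<forall>i\<ge>N. \<forall>j\<ge>N. (\<integral>z. (cmod (s i z - s j z))\<^sup>2 \<partial>torus) < e" if "e > 0" for e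
  proof -
    obtain N where N: "\<And>i j. i \<ge> N \<Longrightarrow> j \<ge> N \<Longrightarrow> dist (a i) (a j) < e"
      using metric_CauchyD[OF \<open>Cauchy a\<close> \<open>e > 0\<close>] by auto
    have "(\<integral>z. (cmod (s i z - s j z))\<^sup>2 \<partial>torus) < e" if "i \<ge> N" "j \<ge> N" for i j
    proof (cases "i \<le> j")
      case True
      then show ?thesis using diff N that by simp
    next
      case False
      then have "(\<integral>z. (cmod (s j z - s i z))\<^sup>2 \<partial>torus) < e" using diff[of j i] N[of j i] that by simp
      then show ?thesis by (simp add: norm_minus_commute)
    qed
    then show ?thesis by blast
  qed
  then obtain G r where G: "G \<in> L2 torus" and lim: "(\<lambda>N. L2_norm torus (\<lambda>z. s N z - G z)) \<longlonglongrightarrow> 0"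
    by (rule L2_complete[OF prob_space_torus sL2])
  have conv: "L2_tendsto torus s G" using sL2 G lim by (simp add: L2_tendsto_def)
  have "G \<in> H2"
    unfolding H2_def
  proof (intro CollectI conjI G allI impI)
    fix \<epsilon> :: real assume "\<epsilon> > 0"
    with lim have "\<forall>\<^sub>F N in sequentially. L2_norm torus (\<lambda>z. s N z - G z) < \<epsilon>" by (rule order_tendstoD)
    then obtain N where "L2_norm torus (\<lambda>z. s N z - G z) < \<epsilon>"
      by (meson eventually_happens trivial_limit_sequentially)
    then have "L2_norm torus (\<lambda>z. G z - (\<Sum>n\<in>{1..N}. b n * bohr_char n z)) < \<epsilon>"
      by (simp add: L2_norm_def s_def norm_minus_commute)
    then show "\<exists>S a. finite S \<and> S \<subseteq> {1..} \<and> L2_norm torus (\<lambda>z. G z - (\<Sum>n\<in>S. a n * bohr_char n z)) < \<epsilon>"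
      by (intro exI[of _ "{1..N}"] exI[of _ b]) auto
  qed
  have coeff: "L2_inner torus G (bohr_char n) = b n" if n: "n \<ge> 1" for n
  proof (rule LIMSEQ_unique)
    show "(\<lambda>N. L2_inner torus (s N) (bohr_char n)) \<longlonglongrightarrow> L2_inner torus G (bohr_char n)"
      by (rule L2_inner_tendsto[OF sL2 G bohr_char_L2 lim])
    have "\<forall>\<^sub>F N in sequentially. L2_inner torus (s N) (bohr_char n) = b n"
      using eventually_ge_at_top[of n]
    proof eventually_elim
      case (elim N)
      then show ?case unfolding s_def using n by (subst L2_inner_bohr_sum) auto
    qed
    then show "(\<lambda>N. L2_inner torus (s N) (bohr_char n)) \<longlonglongrightarrow> b n" by (rule tendsto_eventually)
  qed
  let ?D = "\<lambda>z. B z - G z"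
  have D: "?D \<in> L2 torus" by (rule L2_diff[OF B G])
  have D0: "L2_inner torus ?D (bohr_char n) = 0" if "n \<ge> 1" for n
    using that by (simp add: L2_inner_diff_left[OF B G bohr_char_L2] b coeff)
  have "L2_inner torus ?D h = 0" if h: "h \<in> H2" for h
  proof -
    have hL2: "h \<in> L2 torus" using h by (simp add: H2_def)
    have small: "cmod (L2_inner torus ?D h) \<le> L2_norm torus ?D * \<epsilon>" if "\<epsilon> > 0" for \<epsilon>
    proof -
      have "\<exists>S a. finite S \<and> S \<subseteq> {1..} \<and>
          L2_norm torus (\<lambda>z. h z - (\<Sum>n\<in>S. a n * bohr_char n z)) < \<epsilon>"
        using h that by (simp add: H2_def)
      then obtain S c where S: "finite S" "S \<subseteq> {1..}"
        and less: "L2_norm torus (\<lambda>z. h z - (\<Sum>n\<in>S. c n * bohr_char n z)) < \<epsilon>"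
        by (elim exE conjE)
      let ?p = "\<lambda>z. \<Sum>n\<in>S. c n * bohr_char n z"
      have "L2_inner torus ?p ?D = (\<Sum>n\<in>S. c n * L2_inner torus (bohr_char n) ?D)"
        by (intro L2_inner_sum_left bohr_char_L2 D)
      also have "\<dots> = 0"
      proof (intro sum.neutral ballI)
        fix n assume "n \<in> S"
        then have "L2_inner torus ?D (bohr_char n) = 0" using S by (intro D0) auto
        then show "c n * L2_inner torus (bohr_char n) ?D = 0" by (subst L2_inner_cnj) simp
      qed
      finally have "L2_inner torus h ?D = L2_inner torus (\<lambda>z. h z - ?p z) ?D"
        by (simp add: L2_inner_diff_left[OF hL2 L2_sum_bohr D])
      then have "cmod (L2_inner torus ?D h) = cmod (L2_inner torus (\<lambda>z. h z - ?p z) ?D)"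
        by (subst L2_inner_cnj) simp
      also have "\<dots> \<le> L2_norm torus (\<lambda>z. h z - ?p z) * L2_norm torus ?D"
        by (rule L2_Cauchy_Schwarz[OF L2_diff[OF hL2 L2_sum_bohr] D])
      also have "\<dots> \<le> \<epsilon> * L2_norm torus ?D"
        using less by (intro mult_right_mono L2_norm_nonneg) simp
      finally show ?thesis by (simp add: mult.commute)
    qed
    have "cmod (L2_inner torus ?D h) \<le> 0"
    proof (rule tendsto_lowerbound)
      show "(\<lambda>n. L2_norm torus ?D * inverse (real (Suc n))) \<longlonglongrightarrow> 0"
        using tendsto_mult_right_zero[OF LIMSEQ_inverse_real_of_nat] .
      show "\<forall>\<^sub>F n in sequentially. cmod (L2_inner torus ?D h) \<le> L2_norm torus ?D * inverse (real (Suc n))"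
        by (intro always_eventually allI small) simp
    qed simp
    then show ?thesis by simp
  qed
  then have "is_P_plus B G" using B \<open>G \<in> H2\<close> by (simp add: is_P_plus_def)
  then show ?thesis using conv unfolding s_def[abs_def] by (intro exI[of _ G] conjI)
qed

section \<open>Blaschke factors as changes of variable\<close>

definition blaschke :: "real \<Rightarrow> complex \<Rightarrow> complex" where
  "blaschke r z = (z - of_real r) / (1 - of_real r * z)"

definition poisson :: "real \<Rightarrow> complex \<Rightarrow> real" where
  "poisson r z = (1 - r\<^sup>2) / (cmod (1 - of_real r * z))\<^sup>2"

lemma one_minus_mult_nonzero:
  assumes "0 \<le> r" "r < 1" "cmod z \<le> 1"
  shows "1 - of_real r * z \<noteq> 0"
proof
  assume "1 - of_real r * z = 0"
  then have "cmod (of_real r * z) = 1" by (metis eq_iff_diff_eq_0 norm_one)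
  then have "r * cmod z = 1" using assms by (simp add: norm_mult)
  moreover have "r * cmod z \<le> r * 1" using assms by (intro mult_left_mono) auto
  ultimately show False using assms by simp
qed

lemma one_minus_mult_Re_pos:
  assumes "0 \<le> r" "r < 1" "cmod z \<le> 1"
  shows "Re (1 - of_real r * z) > 0"
proof -
  have "Re (of_real r * z) \<le> r * cmod z" using assms complex_Re_le_cmod[of z] by (simp add: mult_left_mono)
  also have "\<dots> \<le> r * 1" using assms by (intro mult_left_mono) auto
  finally show ?thesis using assms by simp
qed

lemma norm_blaschke:
  assumes "0 \<le> r" "r < 1" "cmod z = 1"
  shows "cmod (blaschke r z) = 1"
proof -
  have "z - of_real r = z * cnj (1 - of_real r * z)"
    using complex_norm_square[of z] assms by (simp add: algebra_simps)
  then have "cmod (z - of_real r) = cmod (1 - of_real r * z)"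
    using assms by (simp add: norm_mult del: complex_cnj_diff complex_cnj_mult)
  then show ?thesis using one_minus_mult_nonzero[of r z] assms by (simp add: blaschke_def norm_divide)
qed

text \<open>A lift to the real line of the map that the Blaschke factor induces on the circle; its
derivative is the Poisson kernel.\<close>

definition blaschke_angle :: "real \<Rightarrow> real \<Rightarrow> real" where
  "blaschke_angle r t = t - Im (Ln (1 - of_real r * exp (\<i> * of_real (2 * pi * t)))) / pi"

text \<open>On the circle the factor is \<open>z\<close> times \<open>cnj u / u\<close> with \<open>u = 1 - r z\<close> in the right half-plane, so
its argument is that of \<open>z\<close> minus twice that of \<open>u\<close>, with no jump of the logarithm.\<close>

lemma cis_blaschke_angle:
  assumes "0 \<le> r" "r < 1"
  shows "blaschke r (cis (2 * pi * t)) = cis (2 * pi * blaschke_angle r t)"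
proof -
  define z where "z = cis (2 * pi * t)"
  define u where "u = 1 - of_real r * z"
  have z: "cmod z = 1" by (simp add: z_def)
  have u0: "u \<noteq> 0" using one_minus_mult_nonzero[of r z] assms z by (simp add: u_def)
  have angle: "2 * pi * blaschke_angle r t = 2 * pi * t + (- 2 * Im (Ln u))"
    by (simp add: blaschke_angle_def u_def z_def cis_conv_exp right_diff_distrib)
  have "cis (2 * pi * blaschke_angle r t) = z * exp (\<i> * of_real (- 2 * Im (Ln u)))"
    unfolding angle by (simp only: z_def cis_mult[symmetric]) (simp add: cis_conv_exp)
  also have "\<i> * of_real (- 2 * Im (Ln u)) = cnj (Ln u) - Ln u"
    by (simp add: complex_eq_iff)
  also have "exp (cnj (Ln u) - Ln u) = cnj u / u"
    using u0 exp_cnj[of "Ln u"] by (simp add: exp_diff)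
  also have "z * (cnj u / u) = blaschke r z"
    using complex_norm_square[of z] z by (simp add: u_def blaschke_def algebra_simps)
  finally show ?thesis by (simp add: z_def)
qed

lemma blaschke_angle_deriv:
  assumes "0 \<le> r" "r < 1"
  shows "(blaschke_angle r has_real_derivative poisson r (cis (2 * pi * t))) (at t)"
proof -
  define g where "g w = Ln (1 - of_real r * exp (\<i> * (2 * of_real pi * w)))" for w
  define z where "z = cis (2 * pi * t)"
  have z: "cmod z = 1" "exp (\<i> * (2 * of_real pi * of_real t)) = z"
    by (simp_all add: z_def cis_conv_exp)
  have Re: "Re (1 - of_real r * z) > 0" using assms z by (intro one_minus_mult_Re_pos) auto
  then have nz: "1 - of_real r * z \<notin> \<real>\<^sub>\<le>\<^sub>0" by (auto simp: complex_nonpos_Reals_iff)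
  have u0: "1 - of_real r * z \<noteq> 0" using Re by (metis less_irrefl zero_complex.simps(1))
  define g' where "g' = - (of_real r * (z * (\<i> * (2 * of_real pi)))) / (1 - of_real r * z)"
  have "(g has_field_derivative g') (at (of_real t))"
    unfolding g_def g'_def
    by (rule derivative_eq_intros refl | (use nz in \<open>simp add: z\<close>; fail))+
       (simp only: z, simp add: divide_inverse mult_ac)
  then have "((\<lambda>x. g (of_real x)) has_vector_derivative g') (at t)"
    by (rule has_vector_derivative_real_field)
  then have "((\<lambda>x. Im (g (of_real x))) has_vector_derivative Im g') (at t)"
    by (rule bounded_linear.has_vector_derivative[OF bounded_linear_Im])
  then have "((\<lambda>x. Im (g (of_real x))) has_real_derivative Im g') (at t)"
    by (simp only: has_real_derivative_iff_has_vector_derivative)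
  from DERIV_diff[OF DERIV_ident DERIV_cdivide[OF this, of pi]]
  have "((\<lambda>x. x - Im (g (of_real x)) / pi) has_real_derivative 1 - Im g' / pi) (at t)" .
  moreover have "(\<lambda>x. x - Im (g (of_real x)) / pi) = blaschke_angle r"
    by (simp add: fun_eq_iff blaschke_angle_def g_def)
  moreover have "1 - Im g' / pi = poisson r z"
  proof -
    have Im: "Im (2 * of_real pi * (- \<i> * w)) = - (2 * pi) * Re w" for w by simp
    define a where "a = of_real r * z"
    have a1: "1 - a \<noteq> 0" using u0 by (simp add: a_def)
    have g': "g' = (2 * of_real pi) * (- \<i> * (a / (1 - a)))" by (simp add: g'_def a_def)
    have "Im g' = - (2 * pi) * Re (a / (1 - a))" unfolding g' by (rule Im)
    then have "1 - Im g' / pi = 1 + 2 * Re (a / (1 - a))" by simp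
    also have "a / (1 - a) = a * cnj (1 - a) / of_real ((cmod (1 - a))\<^sup>2)"
      by (subst complex_div_cnj) simp
    also have "Re \<dots> = Re (a * cnj (1 - a)) / (cmod (1 - a))\<^sup>2" by (rule Re_divide_of_real)
    also have "1 + 2 * \<dots> = ((cmod (1 - a))\<^sup>2 + 2 * Re (a * cnj (1 - a))) / (cmod (1 - a))\<^sup>2"
      using a1 by (simp add: add_divide_distrib)
    \<comment> \<open>The derivative is \<open>Re ((1 + a) / (1 - a))\<close>, which is the Poisson kernel.\<close>
    also have "(cmod (1 - a))\<^sup>2 + 2 * Re (a * cnj (1 - a)) = 1 - (cmod a)\<^sup>2"
      unfolding cmod_power2 by (simp add: power2_eq_square algebra_simps)
    also have "cmod a = r" using assms z by (simp add: a_def norm_mult)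
    finally show ?thesis by (simp add: poisson_def a_def)
  qed
  ultimately show ?thesis by (simp add: z_def)
qed

lemma borel_measurable_cis: "(\<lambda>t::real. cis (2 * pi * t)) \<in> borel_measurable borel"
  by (intro borel_measurable_continuous_onI continuous_intros)

lemma nn_integral_circle:
  assumes [measurable]: "h \<in> borel_measurable borel"
  shows "(\<integral>\<^sup>+z. h z \<partial>circle_measure) = (\<integral>\<^sup>+t. h (cis (2 * pi * t)) * indicator {0..1} t \<partial>lborel)"
proof -
  note borel_measurable_cis[measurable]
  have "(\<integral>\<^sup>+z. h z \<partial>circle_measure)
      = (\<integral>\<^sup>+t. h (cis (2 * pi * t)) \<partial>uniform_measure lborel {0..<1::real})"
    unfolding circle_measure_def
    by (rule nn_integral_distr[OF measurable_cis_circle]) (simp add: measurable_restrict_space1)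
  also have "\<dots> = (\<integral>\<^sup>+t. h (cis (2 * pi * t)) * indicator {0..<1} t \<partial>lborel) / 1"
    by (subst nn_integral_uniform_measure) auto
  also have "\<dots> = (\<integral>\<^sup>+t. h (cis (2 * pi * t)) * indicator {0..<1} t \<partial>lborel)"
    by (simp add: divide_ennreal_def)
  also have "\<dots> = (\<integral>\<^sup>+t. h (cis (2 * pi * t)) * indicator {0..1} t \<partial>lborel)"
  proof (rule nn_integral_cong_AE)
    show "AE t in lborel. h (cis (2 * pi * t)) * indicator {0..<1} t = h (cis (2 * pi * t)) * indicator {0..1} t"
      using AE_lborel_singleton[of 1] by eventually_elim (auto simp: indicator_def)
  qed
  finally show ?thesis .
qed

lemma nn_integral_circle_blaschke:
  assumes r: "0 \<le> r" "r < 1" and h[measurable]: "h \<in> borel_measurable borel"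
  shows "(\<integral>\<^sup>+z. h (blaschke r z) * ennreal (poisson r z) \<partial>circle_measure) = (\<integral>\<^sup>+z. h z \<partial>circle_measure)"
proof -
  note borel_measurable_cis[measurable]
  have m[measurable]: "blaschke r \<in> borel_measurable borel" "poisson r \<in> borel_measurable borel"
    unfolding blaschke_def poisson_def by measurable
  have p: "poisson r z \<ge> 0" for z
    using r power_le_one[of r 2] by (simp add: poisson_def)
  \<comment> \<open>The lifted map fixes both ends of the fundamental interval, so the substitution covers the circle once.\<close>
  have ends: "blaschke_angle r 0 = 0" "blaschke_angle r 1 = 1"
  proof -
    have "Im (Ln (complex_of_real (1 - r))) = 0" using r by (subst Ln_of_real) auto
    then have L: "Im (Ln (1 - complex_of_real r)) = 0" by simp
    then show "blaschke_angle r 0 = 0" by (simp add: blaschke_angle_def)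
    have "exp (\<i> * (2 * complex_of_real pi)) = 1" using exp_two_pi_i by (simp add: mult_ac)
    then show "blaschke_angle r 1 = 1" using L by (simp add: blaschke_angle_def)
  qed
  have "continuous_on {0..1} (\<lambda>t. poisson r (cis (2 * pi * t)))"
    unfolding poisson_def using r
  proof (intro continuous_intros ballI)
    fix t
    show "(cmod (1 - complex_of_real r * cis (2 * pi * t)))\<^sup>2 \<noteq> 0"
      using one_minus_mult_nonzero[OF r, of "cis (2 * pi * t)"] by simp
  qed
  then have "(\<integral>\<^sup>+t. h (cis (2 * pi * t)) * indicator {blaschke_angle r 0..blaschke_angle r 1} t \<partial>lborel)
      = (\<integral>\<^sup>+t. h (cis (2 * pi * blaschke_angle r t)) * poisson r (cis (2 * pi * t)) * indicator {0..1} t \<partial>lborel)"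
    using r p by (intro nn_integral_substitution_aux blaschke_angle_deriv) auto
  also have "\<dots> = (\<integral>\<^sup>+z. h (blaschke r z) * ennreal (poisson r z) \<partial>circle_measure)"
    by (subst nn_integral_circle) (auto simp: cis_blaschke_angle[OF r])
  finally show ?thesis by (simp add: nn_integral_circle[OF h] ends)
qed

lemma nn_integral_torus_prod:
  assumes J: "finite J" and g: "\<And>j. j \<in> J \<Longrightarrow> g j \<in> borel_measurable circle_measure"
  shows "(\<integral>\<^sup>+z. (\<Prod>j\<in>J. g j (z j)) \<partial>torus) = (\<Prod>j\<in>J. \<integral>\<^sup>+x. g j x \<partial>circle_measure)"
proof -
  interpret P: product_prob_space "\<lambda>_::nat. circle_measure" UNIV
    by (intro product_prob_spaceI prob_space_circle)
  let ?R = "\<lambda>z. restrict z J" and ?P = "PiM J (\<lambda>_. circle_measure)"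
  have R: "?R \<in> measurable torus ?P" unfolding torus_def by (rule measurable_restrict_subset) simp
  have m: "(\<lambda>z. \<Prod>j\<in>J. g j (z j)) \<in> borel_measurable ?P"
    using g by (intro borel_measurable_prod_ennreal measurable_compose[OF measurable_component_singleton]) auto
  have "(\<Prod>j\<in>J. \<integral>\<^sup>+x. g j x \<partial>circle_measure) = (\<integral>\<^sup>+z. (\<Prod>j\<in>J. g j (z j)) \<partial>?P)"
    using P.product_nn_integral_prod[OF J, of g] g by simp
  also have "?P = distr torus ?P ?R"
    unfolding torus_def using P.distr_PiM_restrict_finite[OF J] by simp
  also have "(\<integral>\<^sup>+z. (\<Prod>j\<in>J. g j (z j)) \<partial>distr torus ?P ?R) = (\<integral>\<^sup>+z. (\<Prod>j\<in>J. g j (?R z j)) \<partial>torus)"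
    using m by (intro nn_integral_distr[OF R]) simp
  finally show ?thesis by simp
qed

definition blaschke_map :: "nat \<Rightarrow> (nat \<Rightarrow> real) \<Rightarrow> (nat \<Rightarrow> complex) \<Rightarrow> (nat \<Rightarrow> complex)" where
  "blaschke_map N r z = (\<lambda>l. if l < N then blaschke (r l) (z l) else z l)"

lemma borel_measurable_blaschke: "blaschke r \<in> borel_measurable borel"
  unfolding blaschke_def[abs_def] by measurable

lemma measurable_blaschke_circle:
  assumes "0 \<le> r" "r < 1"
  shows "blaschke r \<in> measurable circle_measure circle_measure"
  unfolding measurable_cong_sets[OF sets_circle sets_circle]
  by (intro measurable_restrict_space2 measurable_restrict_space1)
    (use assms in \<open>auto simp: space_restrict_space norm_blaschke borel_measurable_blaschke\<close>)

lemma measurable_blaschke_map: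
  assumes r: "\<And>l. 0 \<le> r l" "\<And>l. r l < 1"
  shows "blaschke_map N r \<in> measurable torus torus"
  unfolding torus_def
proof (rule measurable_PiM_single')
  fix j :: nat
  have c: "(\<lambda>z. z j) \<in> measurable (PiM UNIV (\<lambda>_::nat. circle_measure)) circle_measure"
    by (rule measurable_component_singleton) simp
  from measurable_compose[OF this measurable_blaschke_circle[OF r(1)[of j] r(2)[of j]]] c
  show "(\<lambda>z. blaschke_map N r z j) \<in> measurable (PiM UNIV (\<lambda>_::nat. circle_measure)) circle_measure"
    by (cases "j < N") (auto simp: blaschke_map_def)
qed (auto simp: space_PiM space_circle PiE_iff blaschke_map_def norm_blaschke r)

lemma borel_measurable_poisson_circle: "poisson r \<in> borel_measurable circle_measure"
  unfolding measurable_cong_sets[OF sets_circle refl] poisson_def[abs_def]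
  by (rule measurable_restrict_space1) measurable

lemma poisson_nonneg: "0 \<le> r \<Longrightarrow> r < 1 \<Longrightarrow> poisson r z \<ge> 0"
  using power_le_one[of r 2] by (simp add: poisson_def)

text \<open>The Poisson kernel is the Jacobian of the Blaschke factor. Hence the measure with the product
of the Poisson kernels as its density, which represents evaluation at \<open>r\<close>, becomes Haar measure in the
new coordinates, where it represents evaluation at the origin.\<close>

lemma distr_blaschke_map:
  assumes r: "\<And>l. 0 \<le> r l" "\<And>l. r l < 1"
  shows "distr (density torus (\<lambda>z. ennreal (\<Prod>l<N. poisson (r l) (z l)))) torus (blaschke_map N r) = torus"
    (is "distr ?D torus ?\<Phi> = torus")
proof -
  interpret P: product_prob_space "\<lambda>_::nat. circle_measure" UNIV
    by (intro product_prob_spaceI prob_space_circle)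
  have pm: "(\<lambda>z. ennreal (\<Prod>l<N. poisson (r l) (z l))) \<in> borel_measurable torus"
    by (intro measurable_compose[OF _ measurable_ennreal] borel_measurable_prod
        measurable_compose[OF measurable_torus_coord borel_measurable_poisson_circle])
  have \<Phi>: "?\<Phi> \<in> measurable torus torus" by (rule measurable_blaschke_map[OF r])
  show ?thesis
    unfolding torus_def
  proof (rule P.PiM_eq)
    fix J :: "nat set" and F
    assume J: "finite J" "J \<subseteq> UNIV" and F: "\<And>j. j \<in> J \<Longrightarrow> F j \<in> sets circle_measure"
    let ?E = "prod_emb UNIV (\<lambda>_. circle_measure) J (Pi\<^sub>E J F)"
    let ?J = "J \<union> {..<N}"
    have E: "?E \<in> sets torus" unfolding torus_def using J F by (auto intro!: sets_PiM_I)
    have Fb: "F j \<in> sets borel" if "j \<in> J" for j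
      using F[OF that] by (auto simp: sets_circle sets_restrict_space)
    define h where "h j x = (if j \<in> J then indicator (F j) x else 1 :: ennreal)" for j x
    have hb: "h j \<in> borel_measurable borel" for j
      using Fb[of j] by (cases "j \<in> J") (auto simp: h_def[abs_def])
    define g where "g j x = (if j < N then h j (blaschke (r j) x) * ennreal (poisson (r j) x) else h j x)" for j x
    have hc: "h j \<in> borel_measurable circle_measure" for j
      unfolding measurable_cong_sets[OF sets_circle refl] by (rule measurable_restrict_space1[OF hb])
    have gm: "g j \<in> borel_measurable circle_measure" for j
      using hc borel_measurable_poisson_circle measurable_compose[OF measurable_blaschke_circle[OF r] hc]
      by (cases "j < N") (auto simp: g_def[abs_def])
    have "emeasure (distr ?D torus ?\<Phi>) ?E = emeasure ?D (?\<Phi> -` ?E \<inter> space torus)"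
      using \<Phi> E by (subst emeasure_distr) auto
    also have "\<dots> = (\<integral>\<^sup>+z. ennreal (\<Prod>l<N. poisson (r l) (z l)) * indicator (?\<Phi> -` ?E \<inter> space torus) z \<partial>torus)"
      using pm measurable_sets[OF \<Phi> E] by (subst emeasure_density) auto
    also have "\<dots> = (\<integral>\<^sup>+z. (\<Prod>j\<in>?J. g j (z j)) \<partial>torus)"
    proof (rule nn_integral_cong)
      fix z assume z: "z \<in> space torus"
      have "?\<Phi> z \<in> space torus" using measurable_space[OF \<Phi> z] .
      then have "indicator (?\<Phi> -` ?E \<inter> space torus) z = (\<Prod>j\<in>J. indicator (F j) (?\<Phi> z j) :: ennreal)"
        using z J by (auto simp: indicator_def prod_emb_def torus_def space_PiM PiE_iff)
      also have "\<dots> = (\<Prod>j\<in>?J. h j (?\<Phi> z j))"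
        using J by (intro prod.mono_neutral_cong_left) (auto simp: h_def)
      finally have 1: "indicator (?\<Phi> -` ?E \<inter> space torus) z = (\<Prod>j\<in>?J. h j (?\<Phi> z j))" .
      have "ennreal (\<Prod>l<N. poisson (r l) (z l)) = (\<Prod>l<N. ennreal (poisson (r l) (z l)))"
        by (subst prod_ennreal) (auto simp: poisson_nonneg r)
      also have "\<dots> = (\<Prod>j\<in>?J. if j < N then ennreal (poisson (r j) (z j)) else 1)"
        using J by (intro prod.mono_neutral_cong_left) auto
      finally have 2: "ennreal (\<Prod>l<N. poisson (r l) (z l))
        = (\<Prod>j\<in>?J. if j < N then ennreal (poisson (r j) (z j)) else 1)" .
      show "ennreal (\<Prod>l<N. poisson (r l) (z l)) * indicator (?\<Phi> -` ?E \<inter> space torus) z = (\<Prod>j\<in>?J. g j (z j))"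
        unfolding 1 2 prod.distrib[symmetric]
        by (intro prod.cong refl) (simp add: g_def blaschke_map_def mult.commute)
    qed
    also have "\<dots> = (\<Prod>j\<in>?J. \<integral>\<^sup>+x. g j x \<partial>circle_measure)"
      using J gm by (intro nn_integral_torus_prod) auto
    also have "\<dots> = (\<Prod>j\<in>?J. \<integral>\<^sup>+x. h j x \<partial>circle_measure)"
    proof (rule prod.cong[OF refl])
      fix j
      show "(\<integral>\<^sup>+x. g j x \<partial>circle_measure) = (\<integral>\<^sup>+x. h j x \<partial>circle_measure)"
        using nn_integral_circle_blaschke[OF r hb[of j], of j] by (cases "j < N") (simp_all add: g_def[abs_def])
    qed
    also have "\<dots> = (\<Prod>j\<in>J. emeasure circle_measure (F j))"
      using J F prob_space.emeasure_space_1[OF prob_space_circle]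
      by (intro prod.mono_neutral_cong_right) (auto simp: h_def[abs_def])
    finally show "emeasure (distr (density (PiM UNIV (\<lambda>_. circle_measure)) (\<lambda>z. ennreal (\<Prod>l<N. poisson (r l) (z l))))
        (PiM UNIV (\<lambda>_. circle_measure)) ?\<Phi>) ?E = (\<Prod>j\<in>J. emeasure circle_measure (F j))"
      unfolding torus_def .
  qed simp
qed

lemma integral_blaschke_map:
  fixes f :: "(nat \<Rightarrow> complex) \<Rightarrow> complex"
  assumes r: "\<And>l. 0 \<le> r l" "\<And>l. r l < 1" and f: "f \<in> borel_measurable torus"
  shows "(\<integral>z. of_real (\<Prod>l<N. poisson (r l) (z l)) * f (blaschke_map N r z) \<partial>torus) = (\<integral>z. f z \<partial>torus)"
proof -
  let ?p = "\<lambda>z. \<Prod>l<N. poisson (r l) (z l)" and ?\<Phi> = "blaschke_map N r"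
  have \<Phi>: "?\<Phi> \<in> measurable torus torus" by (rule measurable_blaschke_map[OF r])
  have pm: "?p \<in> borel_measurable torus"
    by (intro borel_measurable_prod measurable_compose[OF measurable_torus_coord borel_measurable_poisson_circle])
  have p0: "?p z \<ge> 0" for z by (intro prod_nonneg) (auto simp: poisson_nonneg r)
  have "(\<integral>z. f z \<partial>torus) = (\<integral>z. f z \<partial>distr (density torus (\<lambda>z. ennreal (?p z))) torus ?\<Phi>)"
    by (simp only: distr_blaschke_map[OF r])
  also have "\<dots> = (\<integral>z. f (?\<Phi> z) \<partial>density torus (\<lambda>z. ennreal (?p z)))"
    using \<Phi> f by (intro integral_distr) auto
  also have "\<dots> = (\<integral>z. ?p z *\<^sub>R f (?\<Phi> z) \<partial>torus)"
    using pm p0 measurable_compose[OF \<Phi> f] by (intro integral_density) auto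
  finally show ?thesis by (simp add: scaleR_conv_of_real)
qed

section \<open>Localized kernels for point evaluation\<close>

lemma circle_mean_value:
  assumes hol: "g holomorphic_on ball 0 R" and R: "R > 1"
  shows "(\<integral>x. g x \<partial>circle_measure) = g 0"
proof -
  have cont: "continuous_on (ball 0 R) g" using hol by (rule holomorphic_on_imp_continuous_on)
  have sub: "sphere 0 1 \<subseteq> ball (0::complex) R" using R by auto
  have gm: "g \<in> borel_measurable (restrict_space borel (sphere 0 1))"
    by (rule borel_measurable_continuous_on_restrict[OF continuous_on_subset[OF cont sub]])
  let ?f = "\<lambda>t::real. g (cis (2 * pi * t))"
  have cf: "continuous_on UNIV ?f"
  proof (rule continuous_on_compose2[OF cont])
    show "continuous_on UNIV (\<lambda>t::real. cis (2 * pi * t))" by (intro continuous_intros)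
    show "(\<lambda>t::real. cis (2 * pi * t)) ` UNIV \<subseteq> ball 0 R" using R by auto
  qed
  have fm: "?f \<in> borel_measurable lborel"
    using borel_measurable_continuous_onI[OF cf] by simp
  have "(\<integral>x. g x \<partial>circle_measure) = (\<integral>t. ?f t \<partial>uniform_measure lborel {0..<1::real})"
    unfolding circle_measure_def by (rule integral_distr[OF measurable_cis_circle gm])
  also have "uniform_measure lborel {0..<1::real} = density lborel (\<lambda>t. ennreal (indicator {0..<1} t))"
    by (simp add: uniform_measure_def divide_ennreal_def ennreal_indicator)
  also have "(\<integral>t. ?f t \<partial>density lborel (\<lambda>t. ennreal (indicator {0..<1::real} t))) = (\<integral>t. indicator {0..<1} t *\<^sub>R ?f t \<partial>lborel)"
    using fm by (intro integral_density) auto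
  also have "\<dots> = (\<integral>t. indicator {0..1} t *\<^sub>R ?f t \<partial>lborel)"
  proof (rule integral_cong_AE)
    show "AE t in lborel. indicator {0..<1} t *\<^sub>R ?f t = indicator {0..1} t *\<^sub>R ?f t"
      using AE_lborel_singleton[of 1] by eventually_elim (auto simp: indicator_def)
  qed (use fm in measurable)
  also have "\<dots> = integral {0..1} ?f"
  proof -
    have "set_integrable lborel {0..1} ?f"
      unfolding set_integrable_def
      by (rule borel_integrable_compact) (auto intro: continuous_on_subset[OF cf])
    from set_borel_integral_eq_integral(2)[OF this] show ?thesis by (simp add: set_lebesgue_integral_def)
  qed
  also have "\<dots> = g 0"
  proof -
    have "cball 0 1 \<subseteq> ball (0::complex) R" using R by auto
    then have "g holomorphic_on cball 0 1" by (rule holomorphic_on_subset[OF hol])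
    then have "((\<lambda>u. g u / (u - 0)) has_contour_integral (2 * of_real pi * \<i> * g 0)) (circlepath 0 1)"
      by (rule Cauchy_integral_circlepath_simple) simp
    then have "((\<lambda>t. g (circlepath 0 1 t) / circlepath 0 1 t * vector_derivative (circlepath 0 1) (at t)) has_integral
        (2 * of_real pi * \<i> * g 0)) {0..1}"
      unfolding has_contour_integral by simp
    moreover have "g (circlepath 0 1 t) / circlepath 0 1 t * vector_derivative (circlepath 0 1) (at t)
        = (2 * of_real pi * \<i>) * ?f t" for t
    proof -
      have e: "circlepath 0 1 t = cis (2 * pi * t)"
        by (simp add: circlepath cis_conv_exp mult_ac)
      have d: "vector_derivative (circlepath 0 1) (at t) = 2 * of_real pi * \<i> * cis (2 * pi * t)"
        by (simp add: vector_derivative_circlepath cis_conv_exp mult_ac)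
      show ?thesis unfolding d e by simp
    qed
    ultimately have "((\<lambda>t. (2 * of_real pi * \<i>) * ?f t) has_integral (2 * of_real pi * \<i>) * g 0) {0..1}"
      by simp
    from has_integral_mult_right[OF this, of "1 / (2 * of_real pi * \<i>)"]
    have "(?f has_integral g 0) {0..1}" by simp
    then show ?thesis by (rule integral_unique)
  qed
  finally show ?thesis .
qed

lemma measurable_rotation_pair:
  "(\<lambda>p j. fst p * snd p j) \<in> measurable (circle_measure \<Otimes>\<^sub>M torus) torus"
proof -
  have b1: "(\<lambda>p. fst p) \<in> borel_measurable (circle_measure \<Otimes>\<^sub>M torus)"
    by (rule measurable_compose[OF measurable_fst borel_measurable_circle_id])
  have b2: "(\<lambda>p. snd p j) \<in> borel_measurable (circle_measure \<Otimes>\<^sub>M torus)" for j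
    by (rule measurable_compose[OF measurable_snd borel_measurable_torus_coord])
  have norm: "cmod (fst p) = 1" "cmod (snd p j) = 1" if "p \<in> space (circle_measure \<Otimes>\<^sub>M torus)" for p j
    using that by (auto simp: space_pair_measure space_circle norm_torus_coord)
  have c: "(\<lambda>p. fst p * snd p j) \<in> measurable (circle_measure \<Otimes>\<^sub>M torus) circle_measure" for j
    unfolding measurable_cong_sets[OF refl sets_circle]
    using b1 b2[of j] by (intro measurable_restrict_space2 borel_measurable_times) (auto simp: norm_mult norm)
  show ?thesis
    unfolding torus_def
    by (rule measurable_PiM_single') (use c in \<open>auto simp: torus_def space_circle norm_mult norm PiE_iff\<close>)
qed

text \<open>Invariance under the diagonal circle only. This leaves room for sets that tie together many
coordinates, which invariance under independent rotations of the coordinates would exclude.\<close>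

definition rotation_invariant :: "(nat \<Rightarrow> complex) set \<Rightarrow> bool" where
  "rotation_invariant A \<longleftrightarrow> (\<forall>u z. cmod u = 1 \<longrightarrow> z \<in> space torus \<longrightarrow> ((\<lambda>j. u * z j) \<in> A \<longleftrightarrow> z \<in> A))"

text \<open>Averaging over the diagonal circle replaces \<open>g(w)\<close> by the mean of \<open>u \<mapsto> g(u w)\<close>, which is
\<open>g(0)\<close>, and does not see the indicator of \<open>A\<close>.\<close>

lemma integral_rotation_invariant:
  assumes A: "A \<in> sets torus" "rotation_invariant A"
    and g: "g \<in> borel_measurable torus" and bd: "\<And>z. z \<in> space torus \<Longrightarrow> cmod (g z) \<le> D"
    and hol: "\<And>z. z \<in> space torus \<Longrightarrow> (\<lambda>u. g (\<lambda>j. u * z j)) holomorphic_on ball 0 R" and R: "R > 1"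
  shows "(\<integral>z. g z * indicator A z \<partial>torus) = g (\<lambda>_. 0) * of_real (measure torus A)"
proof -
  interpret T: prob_space torus by (rule prob_space_torus)
  interpret C: prob_space circle_measure by (rule prob_space_circle)
  interpret P: pair_prob_space circle_measure torus ..
  let ?h = "\<lambda>p. g (\<lambda>j. fst p * snd p j) * indicator A (snd p) :: complex"
  have m1: "(\<lambda>p. g (\<lambda>j. fst p * snd p j)) \<in> borel_measurable (circle_measure \<Otimes>\<^sub>M torus)"
    by (rule measurable_compose[OF measurable_rotation_pair g])
  have m2: "(\<lambda>p. indicator A (snd p) :: complex) \<in> borel_measurable (circle_measure \<Otimes>\<^sub>M torus)"
    by (rule measurable_compose[OF measurable_snd borel_measurable_indicator[OF A(1)]])
  have hm: "?h \<in> borel_measurable (circle_measure \<Otimes>\<^sub>M torus)"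
    by (rule borel_measurable_times[OF m1 m2])
  have D0: "D \<ge> 0" using bd T.not_empty norm_ge_zero order_trans by (metis ex_in_conv)
  have rot: "(\<lambda>j. u * z j) \<in> space torus" if "cmod u = 1" "z \<in> space torus" for u z
    using measurable_space[OF measurable_torus_mult[of "\<lambda>_. u"] that(2)] that(1) by simp
  have int: "integrable (circle_measure \<Otimes>\<^sub>M torus) ?h"
  proof (rule P.integrable_const_bound[OF AE_I2 hm, of D])
    fix p assume "p \<in> space (circle_measure \<Otimes>\<^sub>M torus)"
    then have "cmod (fst p) = 1" "snd p \<in> space torus" by (auto simp: space_pair_measure space_circle)
    then have "cmod (g (\<lambda>j. fst p * snd p j)) \<le> D" by (intro bd rot)
    then show "cmod (?h p) \<le> D" using D0 by (auto simp: norm_mult indicator_def)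
  qed
  have int': "integrable (circle_measure \<Otimes>\<^sub>M torus) (\<lambda>(u, z). g (\<lambda>j. u * z j) * indicator A z :: complex)"
    using int by (simp add: case_prod_unfold)
  have "(\<integral>z. g z * indicator A z \<partial>torus) = (\<integral>u. (\<integral>z. g z * indicator A z \<partial>torus) \<partial>circle_measure)"
    by (simp add: C.prob_space)
  also have "\<dots> = (\<integral>u. (\<integral>z. g (\<lambda>j. u * z j) * indicator A z \<partial>torus) \<partial>circle_measure)"
  proof (rule Bochner_Integration.integral_cong[OF refl])
    fix u assume "u \<in> space circle_measure"
    then have u: "cmod u = 1" by (simp add: space_circle)
    have "(\<integral>z. g z * indicator A z \<partial>torus) = (\<integral>z. g (\<lambda>j. u * z j) * indicator A (\<lambda>j. u * z j) \<partial>torus)"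
      using u g A(1) by (intro integral_torus_mult[of "\<lambda>_. u", symmetric]) auto
    also have "\<dots> = (\<integral>z. g (\<lambda>j. u * z j) * indicator A z \<partial>torus)"
      using A(2) u by (intro Bochner_Integration.integral_cong refl) (auto simp: rotation_invariant_def indicator_def)
    finally show "(\<integral>z. g z * indicator A z \<partial>torus) = (\<integral>z. g (\<lambda>j. u * z j) * indicator A z \<partial>torus)" .
  qed
  also have "\<dots> = (\<integral>z. (\<integral>u. g (\<lambda>j. u * z j) * indicator A z \<partial>circle_measure) \<partial>torus)"
    by (rule P.Fubini_integral[OF int', symmetric])
  also have "\<dots> = (\<integral>z. g (\<lambda>_. 0) * indicator A z \<partial>torus)"
  proof (rule Bochner_Integration.integral_cong[OF refl])
    fix z assume z: "z \<in> space torus"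
    show "(\<integral>u. g (\<lambda>j. u * z j) * indicator A z \<partial>circle_measure) = g (\<lambda>_. 0) * indicator A z"
      using circle_mean_value[OF hol[OF z] R] by simp
  qed
  also have "\<dots> = g (\<lambda>_. 0) * of_real (measure torus A)"
  proof -
    have "(\<lambda>z. indicator A z :: complex) = (\<lambda>z. of_real (indicator A z))" by (auto simp: indicator_def)
    then have "(\<integral>z. indicator A z \<partial>torus) = complex_of_real (measure torus A)" using A(1) by simp
    then show ?thesis by simp
  qed
  finally show ?thesis .
qed

lemma blaschke_inverse:
  assumes "0 \<le> r" "r < 1" "cmod z = 1"
  shows "1 + of_real r * blaschke r z = of_real (1 - r\<^sup>2) / (1 - of_real r * z)"
    and "(blaschke r z + of_real r) / (1 + of_real r * blaschke r z) = z"
proof -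
  have nz: "1 - of_real r * z \<noteq> 0" using one_minus_mult_nonzero[of r z] assms by simp
  have r2: "1 - r\<^sup>2 \<noteq> 0" using assms power_strict_mono[of r 1 2] by simp
  show 1: "1 + of_real r * blaschke r z = of_real (1 - r\<^sup>2) / (1 - of_real r * z)"
    using nz by (simp add: blaschke_def field_simps power2_eq_square)
  have 2: "blaschke r z + of_real r = z * of_real (1 - r\<^sup>2) / (1 - of_real r * z)"
    using nz by (simp add: blaschke_def field_simps power2_eq_square)
  have "complex_of_real (1 - r\<^sup>2) \<noteq> 0" using r2 by (simp only: of_real_eq_0_iff not_False_eq_True)
  then show "(blaschke r z + of_real r) / (1 + of_real r * blaschke r z) = z"
    unfolding 1 2 using nz by (simp del: of_real_diff)
qed

text \<open>One coordinate of the function of least norm in \<open>L\<^sup>\<infinity>\<close> of the circle that represents evaluation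
at \<open>r\<close>. Its modulus is constant on the circle.\<close>

definition extremal_factor :: "real \<Rightarrow> complex \<Rightarrow> complex" where
  "extremal_factor r z = (1 - of_real r * cnj z) / (of_real (1 - r\<^sup>2) * (1 - of_real r * z))"

text \<open>The extremal function is the Poisson kernel times an analytic function of the image point that
equals one at the origin. This is why the unimodular form and the probabilistic form represent the same
evaluation.\<close>

lemma cnj_extremal_factor:
  assumes "0 \<le> r" "r < 1" "cmod z = 1"
  shows "cnj (extremal_factor r z) = of_real (poisson r z) * (1 / (1 + of_real r * blaschke r z))\<^sup>2"
proof -
  define a where "a = 1 - of_real r * z"
  have nz: "a \<noteq> 0" using one_minus_mult_nonzero[of r z] assms by (simp add: a_def)
  have r2: "complex_of_real (1 - r\<^sup>2) \<noteq> 0"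
    using assms power_strict_mono[of r 1 2] by (simp only: of_real_eq_0_iff) simp
  have c: "cnj (extremal_factor r z) = a / (of_real (1 - r\<^sup>2) * cnj a)"
    by (simp add: extremal_factor_def a_def)
  have p: "complex_of_real (poisson r z) = of_real (1 - r\<^sup>2) / (a * cnj a)"
    unfolding poisson_def a_def[symmetric] by (simp add: complex_norm_square[symmetric])
  show ?thesis
    unfolding c p blaschke_inverse(1)[OF assms] a_def[symmetric]
    using nz r2 by (simp add: power2_eq_square del: of_real_diff)
qed

lemma norm_extremal_factor:
  assumes "0 \<le> r" "r < 1" "cmod z = 1"
  shows "cmod (extremal_factor r z) = 1 / (1 - r\<^sup>2)"
proof -
  have "1 - of_real r * cnj z = cnj (1 - of_real r * z)" by simp
  then have "cmod (1 - of_real r * cnj z) = cmod (1 - of_real r * z)" by (metis complex_mod_cnj)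
  moreover have "1 - of_real r * z \<noteq> 0" using one_minus_mult_nonzero[of r z] assms by simp
  moreover have "1 - r\<^sup>2 > 0" using assms power_strict_mono[of r 1 2] by simp
  ultimately show ?thesis
    by (simp add: extremal_factor_def norm_divide norm_mult del: of_real_diff)
qed

definition localized_kernel :: "nat \<Rightarrow> (nat \<Rightarrow> real) \<Rightarrow> (nat \<Rightarrow> complex) set \<Rightarrow> (nat \<Rightarrow> complex) \<Rightarrow> complex" where
  "localized_kernel N r A z =
     (\<Prod>l<N. extremal_factor (r l) (z l)) * indicator A (blaschke_map N r z) / of_real (measure torus A)"

lemma borel_measurable_localized_kernel:
  assumes "\<And>l. 0 \<le> r l" "\<And>l. r l < 1" "A \<in> sets torus"
  shows "localized_kernel N r A \<in> borel_measurable torus"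
proof -
  have "(\<lambda>z. \<Prod>l<N. extremal_factor (r l) (z l)) \<in> borel_measurable torus"
    unfolding extremal_factor_def by measurable
  moreover have "(\<lambda>z. indicator A (blaschke_map N r z) :: complex) \<in> borel_measurable torus"
    by (rule measurable_compose[OF measurable_blaschke_map[OF assms(1,2)] borel_measurable_indicator[OF assms(3)]])
  ultimately show ?thesis unfolding localized_kernel_def[abs_def] by measurable
qed

lemma norm_localized_kernel:
  assumes r: "\<And>l. 0 \<le> r l" "\<And>l. r l < 1" and z: "z \<in> space torus"
  shows "cmod (localized_kernel N r A z)
    = (\<Prod>l<N. 1 / (1 - (r l)\<^sup>2)) * indicator A (blaschke_map N r z) / measure torus A"
proof -
  have "cmod (\<Prod>l<N. extremal_factor (r l) (z l)) = (\<Prod>l<N. 1 / (1 - (r l)\<^sup>2))"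
    unfolding prod_norm[symmetric] by (intro prod.cong refl norm_extremal_factor r norm_torus_coord[OF z])
  then show ?thesis
    by (simp add: localized_kernel_def norm_mult norm_divide indicator_def)
qed

text \<open>In the coordinates \<open>w\<close> the integrand is the Jacobian times an analytic function times the
indicator of \<open>A\<close>, so integration gives \<open>measure torus A\<close> times the value of the analytic function at
\<open>w = 0\<close>, that is, at \<open>z = r\<close>.\<close>

lemma localized_kernel_coefficient:
  assumes r: "\<And>l. 0 \<le> r l" "\<And>l. r l \<le> \<rho>" "\<rho> < 1"
    and A: "A \<in> sets torus" "rotation_invariant A" "measure torus A > 0"
    and n: "n \<noteq> 0" "{j. nth_prime j dvd n} \<subseteq> {..<N}"
  shows "L2_inner torus (localized_kernel N r A) (bohr_char n)
    = of_real (\<Prod>l<N. r l ^ multiplicity (nth_prime l) n)"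
proof -
  have r1: "r l < 1" for l using r(2)[of l] r(3) by simp
  have \<rho>0: "\<rho> \<ge> 0" using r(1,2) order_trans by blast
  \<comment> \<open>A radius larger than one on which the denominators \<open>1 + r u z\<close> do not vanish.\<close>
  define R where "R = 2 / (1 + \<rho>)"
  have R: "R > 1" using r(3) \<rho>0 by (simp add: R_def)
  have R\<rho>: "\<rho> * R < 1" using r(3) \<rho>0 by (simp add: R_def field_simps)
  \<comment> \<open>The character times the analytic factor, as a function of the image point.\<close>
  define g where "g w = (\<Prod>l<N. ((w l + of_real (r l)) / (1 + of_real (r l) * w l)) ^ multiplicity (nth_prime l) n
      * (1 / (1 + of_real (r l) * w l))\<^sup>2)" for w :: "nat \<Rightarrow> complex"
  have gm: "g \<in> borel_measurable torus" unfolding g_def[abs_def] by measurable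
  have nz: "1 + of_real (r l) * w \<noteq> 0" if "cmod w < R" for w l
  proof
    assume "1 + of_real (r l) * w = 0"
    then have "cmod (of_real (r l) * w) = 1" by (metis add_eq_0_iff norm_minus_cancel norm_one)
    then have "r l * cmod w = 1" using r(1)[of l] by (simp add: norm_mult)
    moreover have "r l * cmod w \<le> \<rho> * R" using r that \<rho>0 by (intro mult_mono) auto
    ultimately show False using R\<rho> by simp
  qed
  have hol: "(\<lambda>u. g (\<lambda>j. u * z j)) holomorphic_on ball 0 R" if "z \<in> space torus" for z
    unfolding g_def using nz norm_torus_coord[OF that]
    by (intro holomorphic_intros) (auto simp: norm_mult)
  have bd: "cmod (g z) \<le> (\<Prod>l<N. (1 / (1 - r l))\<^sup>2)" if z: "z \<in> space torus" for z
    unfolding g_def prod_norm[symmetric]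
  proof (intro prod_mono conjI norm_ge_zero)
    fix l
    have z1: "cmod (z l) = 1" using norm_torus_coord[OF z] .
    have zR: "cmod (z l) < R" using z1 R by simp
    have "cmod (z l + of_real (r l)) = cmod (1 + of_real (r l) * z l)"
    proof -
      have "z l + of_real (r l) = z l * cnj (1 + of_real (r l) * z l)"
        using complex_norm_square[of "z l"] z1 by (simp add: algebra_simps)
      then show ?thesis using z1 by (simp add: norm_mult del: complex_cnj_add complex_cnj_mult)
    qed
    then have one: "cmod ((z l + of_real (r l)) / (1 + of_real (r l) * z l)) = 1"
      using nz[OF zR, of l] by (simp add: norm_divide)
    have "1 - r l \<le> cmod (1 + of_real (r l) * z l)"
      using norm_triangle_ineq2[of 1 "- (of_real (r l) * z l)"] r(1)[of l] z1 by (simp add: norm_mult)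
    then have "cmod (1 / (1 + of_real (r l) * z l)) \<le> 1 / (1 - r l)"
      using r1[of l] by (simp add: norm_divide frac_le)
    then show "cmod (((z l + of_real (r l)) / (1 + of_real (r l) * z l)) ^ multiplicity (nth_prime l) n
      * (1 / (1 + of_real (r l) * z l))\<^sup>2) \<le> (1 / (1 - r l))\<^sup>2"
      unfolding norm_mult norm_power one by (simp add: power_mono del: power_one_right)
  qed
  have "(\<integral>z. bohr_char n z * cnj (localized_kernel N r A z) \<partial>torus)
      = (\<integral>z. of_real (\<Prod>l<N. poisson (r l) (z l)) *
          (g (blaschke_map N r z) * indicator A (blaschke_map N r z) / of_real (measure torus A)) \<partial>torus)"
  proof (rule Bochner_Integration.integral_cong[OF refl])
    fix z assume z: "z \<in> space torus"
    have b: "bohr_char n z = (\<Prod>l<N. z l ^ multiplicity (nth_prime l) n)"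
      by (rule bohr_char_superset[OF n(1) finite_lessThan n(2)])
    have k: "cnj (localized_kernel N r A z) = (\<Prod>l<N. cnj (extremal_factor (r l) (z l)))
        * indicator A (blaschke_map N r z) / of_real (measure torus A)"
      by (simp add: localized_kernel_def indicator_def)
    have "bohr_char n z * (\<Prod>l<N. cnj (extremal_factor (r l) (z l)))
        = (\<Prod>l<N. z l ^ multiplicity (nth_prime l) n * cnj (extremal_factor (r l) (z l)))"
      unfolding b prod.distrib ..
    also have "\<dots> = (\<Prod>l<N. of_real (poisson (r l) (z l)) *
        (((blaschke_map N r z l + of_real (r l)) / (1 + of_real (r l) * blaschke_map N r z l)) ^ multiplicity (nth_prime l) n
        * (1 / (1 + of_real (r l) * blaschke_map N r z l))\<^sup>2))"
    proof (rule prod.cong[OF refl])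
      fix l assume l: "l \<in> {..<N}"
      then have w: "blaschke_map N r z l = blaschke (r l) (z l)" by (simp add: blaschke_map_def)
      show "z l ^ multiplicity (nth_prime l) n * cnj (extremal_factor (r l) (z l)) = of_real (poisson (r l) (z l)) *
        (((blaschke_map N r z l + of_real (r l)) / (1 + of_real (r l) * blaschke_map N r z l)) ^ multiplicity (nth_prime l) n
        * (1 / (1 + of_real (r l) * blaschke_map N r z l))\<^sup>2)"
        unfolding w cnj_extremal_factor[OF r(1) r1 norm_torus_coord[OF z]]
          blaschke_inverse(2)[OF r(1) r1 norm_torus_coord[OF z]] by (simp only: mult_ac)
    qed
    also have "\<dots> = of_real (\<Prod>l<N. poisson (r l) (z l)) * g (blaschke_map N r z)"
      unfolding g_def of_real_prod prod.distrib ..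
    finally have "bohr_char n z * (\<Prod>l<N. cnj (extremal_factor (r l) (z l)))
      = of_real (\<Prod>l<N. poisson (r l) (z l)) * g (blaschke_map N r z)" .
    then show "bohr_char n z * cnj (localized_kernel N r A z) = of_real (\<Prod>l<N. poisson (r l) (z l)) *
          (g (blaschke_map N r z) * indicator A (blaschke_map N r z) / of_real (measure torus A))"
      unfolding k by (simp only: times_divide_eq_right mult.assoc[symmetric])
  qed
  also have "\<dots> = (\<integral>w. g w * indicator A w / of_real (measure torus A) \<partial>torus)"
    by (intro integral_blaschke_map[OF r(1) r1] borel_measurable_divide borel_measurable_times gm
        borel_measurable_indicator A(1) borel_measurable_const)
  also have "\<dots> = (\<integral>w. g w * indicator A w \<partial>torus) / of_real (measure torus A)" by simp
  also have "\<dots> = g (\<lambda>_. 0)"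
    using integral_rotation_invariant[OF A(1,2) gm bd hol R] A(3) by simp
  also have "\<dots> = of_real (\<Prod>l<N. r l ^ multiplicity (nth_prime l) n)"
    by (simp add: g_def)
  finally have "L2_inner torus (bohr_char n) (localized_kernel N r A)
      = of_real (\<Prod>l<N. r l ^ multiplicity (nth_prime l) n)" by (simp only: L2_inner_def)
  then show ?thesis by (subst L2_inner_cnj) (simp del: of_real_prod)
qed

section \<open>The prime zeta function near its singularity\<close>

abbreviation pr :: "nat \<Rightarrow> real" where "pr l \<equiv> real (nth_prime l)"

lemma pr_ge_2: "pr l \<ge> 2"
  using prime_ge_2_nat[OF prime_nth_prime[of l]] by linarith

lemma nth_prime_pos: "nth_prime l > 0"
  using prime_gt_0_nat[OF prime_nth_prime] .

lemma nth_prime_dvd_iff: "nth_prime j dvd nth_prime l \<longleftrightarrow> j = l"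
proof
  assume "nth_prime j dvd nth_prime l"
  then have "nth_prime j = nth_prime l" by (rule primes_dvd_imp_eq[OF prime_nth_prime prime_nth_prime])
  then show "j = l" by (rule injD[OF inj_nth_prime])
qed simp

definition smooth_numbers :: "nat \<Rightarrow> nat set" where
  "smooth_numbers N = {n. n \<noteq> 0 \<and> {j. nth_prime j dvd n} \<subseteq> {..<N}}"

lemma atMost_subset_smooth: "{1..N} \<subseteq> smooth_numbers N"
proof
  fix n assume n: "n \<in> {1..N}"
  have "j < N" if "nth_prime j dvd n" for j
  proof -
    have "strict_mono nth_prime" unfolding nth_prime_def by (rule strict_mono_enumerate[OF primes_infinite])
    have "j < nth_prime j"
    proof (induction j)
      case 0 then show ?case by (rule nth_prime_pos)
    next
      case (Suc j)
      then show ?case using strict_monoD[OF \<open>strict_mono nth_prime\<close>, of j "Suc j"] by simp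
    qed
    also have "nth_prime j \<le> n" using that n by (intro dvd_imp_le) auto
    finally show ?thesis using n by simp
  qed
  then show "n \<in> smooth_numbers N" using n by (auto simp: smooth_numbers_def)
qed

text \<open>A smooth number is split into its power of the new prime and the rest; this is the inductive
step of the Euler product.\<close>

lemma bij_betw_smooth_Suc:
  "bij_betw (\<lambda>(m, a). m * nth_prime N ^ a) (smooth_numbers N \<times> (UNIV :: nat set)) (smooth_numbers (Suc N))"
proof -
  let ?p = "nth_prime N"
  have p: "prime ?p" by (rule prime_nth_prime)
  have nd: "\<not> ?p dvd m" if "m \<in> smooth_numbers N" for m using that by (auto simp: smooth_numbers_def)
  have mult: "multiplicity ?p (m * ?p ^ a) = a" if "m \<in> smooth_numbers N" for m a
  proof -
    have "m \<noteq> 0" using that by (simp add: smooth_numbers_def)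
    then show ?thesis
      using p nd[OF that] by (simp add: prime_elem_multiplicity_mult_distrib not_dvd_imp_multiplicity_0 nth_prime_pos)
  qed
  show ?thesis
    unfolding bij_betw_def
  proof (intro conjI set_eqI iffI)
    show "inj_on (\<lambda>(m, a). m * ?p ^ a) (smooth_numbers N \<times> UNIV)"
    proof (rule inj_onI, clarify)
      fix m a m' a' assume *: "m \<in> smooth_numbers N" "m' \<in> smooth_numbers N" "m * ?p ^ a = m' * ?p ^ a'"
      then have "a = a'" using mult by metis
      with * show "m = m' \<and> a = a'" using nth_prime_pos[of N] by simp
    qed
  next
    fix n assume "n \<in> (\<lambda>(m, a). m * ?p ^ a) ` (smooth_numbers N \<times> UNIV)"
    then obtain m a where n: "n = m * ?p ^ a" "m \<in> smooth_numbers N" by auto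
    have "j < Suc N" if "nth_prime j dvd n" for j
    proof -
      have "nth_prime j dvd m \<or> nth_prime j dvd ?p ^ a"
        using that n prime_dvd_mult_iff[OF prime_nth_prime] by simp
      then have "nth_prime j dvd m \<or> j = N"
        using prime_dvd_power[OF prime_nth_prime] nth_prime_dvd_iff by blast
      then show ?thesis using n(2) by (auto simp: smooth_numbers_def)
    qed
    then show "n \<in> smooth_numbers (Suc N)" using n nth_prime_pos[of N] by (auto simp: smooth_numbers_def)
  next
    fix n assume n: "n \<in> smooth_numbers (Suc N)"
    obtain m where m: "n = ?p ^ multiplicity ?p n * m" "\<not> ?p dvd m"
      by (rule multiplicity_decompose'[of n ?p]) (use n p in \<open>auto simp: smooth_numbers_def\<close>)
    have "j < N" if "nth_prime j dvd m" for j
    proof -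
      have "nth_prime j dvd n" using that m(1) by (metis dvd_mult)
      then have "j < Suc N" using n by (auto simp: smooth_numbers_def)
      moreover have "j \<noteq> N" using that m(2) by blast
      ultimately show ?thesis by simp
    qed
    moreover have "m \<noteq> 0" using m(2) by (metis dvd_0_right)
    ultimately have "m \<in> smooth_numbers N" by (auto simp: smooth_numbers_def)
    then have "(m, multiplicity ?p n) \<in> smooth_numbers N \<times> UNIV" by simp
    moreover have "n = (\<lambda>(m, a). m * ?p ^ a) (m, multiplicity ?p n)" using m(1) by (simp add: mult.commute)
    ultimately show "n \<in> (\<lambda>(m, a). m * ?p ^ a) ` (smooth_numbers N \<times> UNIV)" by (rule rev_image_eqI)
  qed
qed

lemma pr_powr_less_1: "s > 0 \<Longrightarrow> pr l powr (-s) < 1"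
  using pr_ge_2[of l] by (simp add: powr_less_one)

lemma euler_product_smooth:
  assumes s: "s > 0"
  shows "((\<lambda>n. real n powr (-s)) has_sum (\<Prod>l<N. 1 / (1 - pr l powr (-s)))) (smooth_numbers N)"
proof (induction N)
  case 0
  have "smooth_numbers 0 = {1}"
  proof (intro set_eqI iffI)
    fix n assume n: "n \<in> smooth_numbers 0"
    show "n \<in> {1}"
    proof (rule ccontr)
      assume "n \<notin> {1}"
      then obtain p where "prime p" "p dvd n" using prime_factor_nat[of n] by auto
      then show False using n by (auto simp: smooth_numbers_def elim: prime_eq_nth_prime)
    qed
  next
    fix n assume "n \<in> {1::nat}"
    moreover have "\<not> nth_prime j dvd 1" for j using pr_ge_2[of j] by auto
    ultimately show "n \<in> smooth_numbers 0" by (simp add: smooth_numbers_def)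
  qed
  then show ?case by (simp add: has_sum_finite_iff)
next
  case (Suc N)
  let ?q = "pr N powr (-s)" and ?P = "\<Prod>l<N. 1 / (1 - pr l powr (-s))"
  let ?f = "\<lambda>(m::nat, a::nat). real m powr (-s) * ?q ^ a"
  have q: "0 \<le> ?q" "?q < 1" using pr_powr_less_1[OF s] by simp_all
  have geo: "((\<lambda>a. ?q ^ a) has_sum 1 / (1 - ?q)) UNIV"
    using q by (intro sums_nonneg_imp_has_sum geometric_sums) auto
  have f1: "((\<lambda>a. ?f (m, a)) has_sum real m powr (-s) * (1 / (1 - ?q))) UNIV" for m
    using has_sum_cmult_right[OF geo, of "real m powr (-s)"] by simp
  have f2: "((\<lambda>m. real m powr (-s) * (1 / (1 - ?q))) has_sum ?P * (1 / (1 - ?q))) (smooth_numbers N)"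
    by (rule has_sum_cmult_left[OF Suc.IH])
  have "(?f has_sum ?P * (1 / (1 - ?q))) (smooth_numbers N \<times> UNIV)"
  proof (rule has_sum_SigmaI[OF f1 f2])
    show "?f summable_on smooth_numbers N \<times> UNIV"
      by (rule summable_on_SigmaI[OF f1]) (use f2 q in \<open>auto simp: summable_on_def\<close>)
  qed
  also have "?f = (\<lambda>x. real ((\<lambda>(m, a). m * nth_prime N ^ a) x) powr (-s))"
  proof (rule ext, clarify)
    fix m a :: nat
    have "pr N ^ a = pr N powr real a" using pr_ge_2[of N] by (simp add: powr_realpow)
    then have "(pr N ^ a) powr (-s) = ?q ^ a"
      using pr_ge_2[of N] by (simp add: powr_powr powr_realpow[symmetric] mult.commute)
    then show "real m powr (-s) * ?q ^ a = real (m * nth_prime N ^ a) powr (-s)" by (simp add: powr_mult)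
  qed
  finally have "((\<lambda>n. real n powr (-s)) has_sum ?P * (1 / (1 - ?q))) (smooth_numbers (Suc N))"
    by (subst (asm) has_sum_reindex_bij_betw[OF bij_betw_smooth_Suc])
  then show ?case by simp
qed

text \<open>Both sides of the telescoping comparison of \<open>\<zeta>(1 + x)\<close> with \<open>1 / x\<close>.\<close>

lemma powr_diff_bounds:
  assumes x: "x > 0" and n: "n \<ge> (1::nat)"
  shows "real (Suc n) powr (-1-x) \<le> (real n powr (-x) - real (Suc n) powr (-x)) / x"
    and "(real n powr (-x) - real (Suc n) powr (-x)) / x \<le> real n powr (-1-x)"
proof -
  have n0: "real n > 0" using n by simp
  have "((\<lambda>t. t powr (-x)) has_real_derivative (-x) * t powr (-x-1)) (at t)" if "real n \<le> t" for t
    using that n0 by (auto intro!: derivative_eq_intros simp: powr_diff)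
  then obtain t where t: "real n < t" "t < real (Suc n)"
    and eq: "real (Suc n) powr (-x) - real n powr (-x) = (real (Suc n) - real n) * ((-x) * t powr (-x-1))"
    using MVT2[of "real n" "real (Suc n)" "\<lambda>t. t powr (-x)" "\<lambda>t. (-x) * t powr (-x-1)"] by auto
  have eq': "(real n powr (-x) - real (Suc n) powr (-x)) / x = t powr (-1-x)"
  proof -
    have e: "-x-1 = -1-x" by simp
    have "real n powr (-x) - real (Suc n) powr (-x) = t powr (-1-x) * x" using eq unfolding e by (simp add: algebra_simps)
    then show ?thesis using x by (simp del: of_nat_Suc)
  qed
  show "real (Suc n) powr (-1-x) \<le> (real n powr (-x) - real (Suc n) powr (-x)) / x"
    unfolding eq' using t n0 x by (intro powr_mono2') auto
  show "(real n powr (-x) - real (Suc n) powr (-x)) / x \<le> real n powr (-1-x)"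
    unfolding eq' using t n0 x by (intro powr_mono2') auto
qed

lemma zeta_sum_upper:
  assumes x: "x > 0"
  shows "(\<Sum>n=1..M. real n powr (-1-x)) \<le> 1 + 1 / x"
proof -
  have "(\<Sum>n=1..Suc M. real n powr (-1-x)) \<le> 1 + (1 - real (Suc M) powr (-x)) / x" for M
  proof (induction M)
    case (Suc M)
    have "(\<Sum>n=1..Suc (Suc M). real n powr (-1-x)) \<le> 1 + (1 - real (Suc M) powr (-x)) / x
        + (real (Suc M) powr (-x) - real (Suc (Suc M)) powr (-x)) / x"
      using Suc powr_diff_bounds(1)[OF x, of "Suc M"] by simp
    also have "\<dots> = 1 + (1 - real (Suc (Suc M)) powr (-x)) / x" by (simp add: diff_divide_distrib)
    finally show ?case .
  qed simp
  also have "1 + (1 - real (Suc M) powr (-x)) / x \<le> 1 + 1 / x" for M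
    using x by (simp add: divide_right_mono)
  finally have *: "(\<Sum>n=1..Suc M. real n powr (-1-x)) \<le> 1 + 1 / x" for M .
  show ?thesis using *[of "M - 1"] x by (cases M) auto
qed

lemma zeta_sum_lower:
  assumes x: "x > 0"
  shows "(\<Sum>n=1..M. real n powr (-1-x)) \<ge> (1 - real (Suc M) powr (-x)) / x"
proof (induction M)
  case (Suc M)
  have "(1 - real (Suc (Suc M)) powr (-x)) / x
      = (1 - real (Suc M) powr (-x)) / x + (real (Suc M) powr (-x) - real (Suc (Suc M)) powr (-x)) / x"
    by (simp add: diff_divide_distrib)
  also have "\<dots> \<le> (\<Sum>n=1..Suc M. real n powr (-1-x))"
    using Suc powr_diff_bounds(2)[OF x, of "Suc M"] by simp
  finally show ?case .
qed simp

lemma euler_product_upper: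
  assumes x: "x > 0"
  shows "(\<Prod>l<N. 1 / (1 - pr l powr (-1-x))) \<le> 1 + 1 / x"
proof -
  have "-(1 + x) = -1 - x" by simp
  have "((\<lambda>n. real n powr (-1-x)) has_sum (\<Prod>l<N. 1 / (1 - pr l powr (-1-x)))) (smooth_numbers N)"
    using euler_product_smooth[of "1 + x" N] x unfolding \<open>-(1 + x) = -1 - x\<close> by simp
  then show ?thesis
  proof (rule has_sum_le_finite_sums)
    fix F assume F: "finite F" "F \<subseteq> smooth_numbers N"
    obtain M where "F \<subseteq> {..M}" using F(1) finite_nat_iff_bounded_le by blast
    moreover have "0 \<notin> F" using F by (auto simp: smooth_numbers_def)
    ultimately have "F \<subseteq> {1..M}" by (auto simp: Suc_le_eq intro: gr0I)
    then have "(\<Sum>n\<in>F. real n powr (-1-x)) \<le> (\<Sum>n=1..M. real n powr (-1-x))"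
      by (intro sum_mono2) auto
    also have "\<dots> \<le> 1 + 1 / x" by (rule zeta_sum_upper[OF x])
    finally show "(\<Sum>n\<in>F. real n powr (-1-x)) \<le> 1 + 1 / x" .
  qed
qed

lemma euler_product_lower:
  assumes x: "x > 0"
  shows "(1 - real (Suc N) powr (-x)) / x \<le> (\<Prod>l<N. 1 / (1 - pr l powr (-1-x)))"
proof -
  have "-(1 + x) = -1 - x" by simp
  have "((\<lambda>n. real n powr (-1-x)) has_sum (\<Prod>l<N. 1 / (1 - pr l powr (-1-x)))) (smooth_numbers N)"
    using euler_product_smooth[of "1 + x" N] x unfolding \<open>-(1 + x) = -1 - x\<close> by simp
  then have "(\<Sum>n=1..N. real n powr (-1-x)) \<le> (\<Prod>l<N. 1 / (1 - pr l powr (-1-x)))"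
    by (rule finite_sum_le_has_sum) (use atMost_subset_smooth in auto)
  with zeta_sum_lower[OF x, of N] show ?thesis by linarith
qed

lemma pr_powr_half: "x \<ge> 0 \<Longrightarrow> pr l powr (-1-x) \<le> 1 / 2"
proof -
  assume "x \<ge> 0"
  then have "pr l powr (-1-x) \<le> pr l powr (-1)" using pr_ge_2[of l] by (intro powr_mono) auto
  also have "\<dots> = 1 / pr l" using pr_ge_2[of l] by (simp add: powr_minus_divide)
  also have "\<dots> \<le> 1 / 2" using pr_ge_2[of l] by (simp add: field_simps)
  finally show ?thesis .
qed

lemma ln_euler_product:
  assumes x: "x \<ge> 0"
  shows "ln (\<Prod>l<N. 1 / (1 - pr l powr (-1-x))) = (\<Sum>l<N. - ln (1 - pr l powr (-1-x)))"
proof -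
  have pos: "1 - pr l powr (-1-x) > 0" for l using pr_powr_half[OF x, of l] by linarith
  have ne: "pr l powr (-1-x) \<noteq> 1" "pr l powr (-1-x) < 1" for l using pos[of l] by linarith+
  have "ln (\<Prod>l<N. 1 / (1 - pr l powr (-1-x))) = (\<Sum>l<N. ln (1 / (1 - pr l powr (-1-x))))"
    using ne by (subst ln_prod) (auto intro: pos simp: less_imp_neq)
  also have "\<dots> = (\<Sum>l<N. - ln (1 - pr l powr (-1-x)))"
    using pos by (intro sum.cong refl) (simp add: ln_div)
  finally show ?thesis .
qed

lemma prime_sum_upper:
  assumes x: "x > 0"
  shows "(\<Sum>l<N. pr l powr (-1-x)) \<le> ln (1 + 1 / x)"
proof -
  have pos: "1 - pr l powr (-1-x) > 0" for l using pr_powr_half[of x l] x by linarith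
  have "(\<Sum>l<N. pr l powr (-1-x)) \<le> (\<Sum>l<N. - ln (1 - pr l powr (-1-x)))"
  proof (rule sum_mono)
    fix l
    show "pr l powr (-1-x) \<le> - ln (1 - pr l powr (-1-x))"
      using ln_le_minus_one[OF pos[of l]] by simp
  qed
  also have "\<dots> = ln (\<Prod>l<N. 1 / (1 - pr l powr (-1-x)))" using x by (simp add: ln_euler_product)
  also have "\<dots> \<le> ln (1 + 1 / x)"
  proof -
    have "(\<Prod>l<N. 1 / (1 - pr l powr (-1-x))) > 0" using pos by (intro prod_pos) simp
    then show ?thesis using euler_product_upper[OF x, of N] by simp
  qed
  finally show ?thesis .
qed

definition prime_zeta :: "real \<Rightarrow> real" where
  "prime_zeta x = (\<Sum>l. pr l powr (-1-x))"

lemma summable_prime_zeta: "x > 0 \<Longrightarrow> summable (\<lambda>l. pr l powr (-1-x))"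
  by (rule summableI_nonneg_bounded[of _ "ln (1 + 1 / x)"]) (auto intro: prime_sum_upper)

lemma prime_zeta_upper: "x > 0 \<Longrightarrow> prime_zeta x \<le> ln (1 + 1 / x)"
  unfolding prime_zeta_def by (rule suminf_le_const[OF summable_prime_zeta prime_sum_upper])

text \<open>The logarithm of the Euler product is at least \<open>ln (1 / (2 x))\<close> once enough integers are covered,
and it exceeds the sum over primes by a convergent sum of squares.\<close>

lemma prime_zeta_lower:
  assumes x: "x > 0"
  shows "prime_zeta x \<ge> ln (1 / x) - 5"
proof -
  have "((\<lambda>N. real (Suc N) powr (-x)) \<longlongrightarrow> 0) sequentially"
    using x filterlim_compose[OF filterlim_real_sequentially filterlim_Suc]
    by (intro tendsto_neg_powr) auto
  then have "\<forall>\<^sub>F N in sequentially. real (Suc N) powr (-x) < 1 / 2" by (rule order_tendstoD) simp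
  then obtain N where N: "real (Suc N) powr (-x) < 1 / 2" by (meson eventually_happens trivial_limit_sequentially)
  have pos: "1 - pr l powr (-1-x) > 0" for l using pr_powr_half[of x l] x by linarith
  have "ln (1 / x) - ln 2 = ln ((1 / 2) / x)" using x by (simp add: ln_div ln_mult)
  also have "\<dots> \<le> ln (\<Prod>l<N. 1 / (1 - pr l powr (-1-x)))"
  proof -
    have "(1 / 2) / x \<le> (1 - real (Suc N) powr (-x)) / x" using N x by (intro divide_right_mono) auto
    also have "\<dots> \<le> (\<Prod>l<N. 1 / (1 - pr l powr (-1-x)))" by (rule euler_product_lower[OF x])
    finally have le: "(1 / 2) / x \<le> (\<Prod>l<N. 1 / (1 - pr l powr (-1-x)))" .
    have "0 < (1 / 2) / x" using x by simp
    moreover from this le have "0 < (\<Prod>l<N. 1 / (1 - pr l powr (-1-x)))" by (rule less_le_trans)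
    ultimately show ?thesis using le by (simp only: ln_le_cancel_iff)
  qed
  also have "\<dots> = (\<Sum>l<N. - ln (1 - pr l powr (-1-x)))" using x by (simp add: ln_euler_product)
  also have "\<dots> \<le> (\<Sum>l<N. pr l powr (-1-x) + 2 * pr l powr (-1-1))"
  proof (rule sum_mono)
    fix l
    have "pr l powr (-1-x) \<le> pr l powr (-1)" using pr_ge_2[of l] x by (intro powr_mono) auto
    then have "(pr l powr (-1-x))\<^sup>2 \<le> (pr l powr (-1))\<^sup>2" by (intro power_mono) auto
    also have "\<dots> = pr l powr (-1-1)"
      unfolding power2_eq_square powr_add[symmetric] by simp
    finally show "- ln (1 - pr l powr (-1-x)) \<le> pr l powr (-1-x) + 2 * pr l powr (-1-1)"
      using ln_one_minus_pos_lower_bound[of "pr l powr (-1-x)"] pr_powr_half[of x l] x by simp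
  qed
  also have "\<dots> = (\<Sum>l<N. pr l powr (-1-x)) + 2 * (\<Sum>l<N. pr l powr (-1-1))"
    by (simp add: sum.distrib sum_distrib_left)
  also have "\<dots> \<le> prime_zeta x + 2 * ln (1 + 1 / 1)"
    unfolding prime_zeta_def using prime_sum_upper[of 1 N] sum_le_suminf[OF summable_prime_zeta[OF x], of "{..<N}"] by simp
  also have "\<dots> = prime_zeta x + 2 * ln 2" by simp
  finally show ?thesis using ln_le_minus_one[of 2] by simp
qed

text \<open>The only information on the distribution of primes that is required:
\<open>prime_zeta x = ln (1 / x) + O(1)\<close>. The constants are not optimized.\<close>

lemma prime_zeta_bounds:
  assumes "0 < x" "x \<le> 2"
  shows "ln (1 / x) - 5 \<le> prime_zeta x" "prime_zeta x \<le> ln (1 / x) + 2"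
proof -
  show "ln (1 / x) - 5 \<le> prime_zeta x" by (rule prime_zeta_lower[OF assms(1)])
  have "prime_zeta x \<le> ln (1 + 1 / x)" by (rule prime_zeta_upper[OF assms(1)])
  also have "\<dots> \<le> ln (3 * (1 / x))" using assms by (subst ln_le_cancel_iff) (auto simp: field_simps)
  also have "\<dots> = ln 3 + ln (1 / x)" using assms by (subst ln_mult) auto
  also have "ln 3 \<le> (2::real)" using ln_le_minus_one[of 3] by simp
  finally show "prime_zeta x \<le> ln (1 / x) + 2" by simp
qed

section \<open>Separating two points of evaluation\<close>

text \<open>The coordinates of the point of the polydisc that corresponds to \<open>s = 1/2 + \<delta>\<close>.\<close>

definition radius :: "real \<Rightarrow> nat \<Rightarrow> real" where
  "radius \<delta> l = pr l powr (-1/2-\<delta>)"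

lemma radius_pos: "radius \<delta> l > 0"
  using pr_ge_2[of l] by (simp add: radius_def)

lemma radius_square_le: "\<delta> \<ge> 0 \<Longrightarrow> (radius \<delta> l)\<^sup>2 \<le> 1 / pr l"
proof -
  assume "\<delta> \<ge> 0"
  then have "pr l powr (-1-2*\<delta>) \<le> pr l powr (-1)" using pr_ge_2[of l] by (intro powr_mono) auto
  moreover have "(radius \<delta> l)\<^sup>2 = pr l powr (-1-2*\<delta>)"
    by (simp add: radius_def power2_eq_square powr_add[symmetric])
  ultimately show ?thesis using pr_ge_2[of l] by (simp add: powr_minus_divide)
qed

lemma radius_le: "\<delta> \<ge> 0 \<Longrightarrow> radius \<delta> l \<le> 3 / 4"
proof -
  assume d: "\<delta> \<ge> 0"
  have "1 / pr l \<le> 1 / 2" using pr_ge_2[of l] by (simp add: field_simps)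
  then have "(radius \<delta> l)\<^sup>2 \<le> (3 / 4)\<^sup>2" using radius_square_le[OF d, of l] by (simp add: power2_eq_square)
  then show ?thesis by (rule power2_le_imp_le) simp
qed

text \<open>The quadratic term \<open>r z\<^sup>2\<close> has to be kept. Multiplied by \<open>1 / sqrt p\<close> with \<open>r\<close> close to
\<open>1 / sqrt p\<close> and summed over the primes, it is as large as the main term, while the error \<open>O(r\<^sup>2)\<close>
gives a convergent sum.\<close>

lemma blaschke_expansion:
  assumes r: "0 \<le> r" "r \<le> 3 / 4" and z: "cmod z = 1"
  shows "cmod (blaschke r z - (z - of_real r + of_real r * z\<^sup>2)) \<le> 8 * r\<^sup>2"
    and "cmod (z - blaschke r z) \<le> 8 * r"
proof -
  have nz: "1 - of_real r * z \<noteq> 0" using one_minus_mult_nonzero[of r z] r z by simp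
  have den: "cmod (1 - of_real r * z) \<ge> 1 / 4"
    using norm_triangle_ineq2[of 1 "of_real r * z"] r z by (simp add: norm_mult)
  have *: "cmod (a / (1 - of_real r * z)) \<le> 4 * cmod a" for a
  proof -
    have "cmod (a / (1 - of_real r * z)) \<le> cmod a / (1 / 4)"
      unfolding norm_divide using den by (intro divide_left_mono) auto
    then show ?thesis by simp
  qed
  have "blaschke r z - (z - of_real r + of_real r * z\<^sup>2) = (of_real (r\<^sup>2) * (z ^ 3 - z)) / (1 - of_real r * z)"
    unfolding blaschke_def using nz by (simp add: field_simps power2_eq_square power3_eq_cube)
  then have "cmod (blaschke r z - (z - of_real r + of_real r * z\<^sup>2)) \<le> 4 * cmod (of_real (r\<^sup>2) * (z ^ 3 - z))"
    by (metis *)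
  also have "\<dots> = 4 * (r\<^sup>2 * cmod (z ^ 3 - z))" by (simp add: norm_mult norm_power)
  also have "cmod (z ^ 3 - z) \<le> 2"
    using norm_triangle_ineq4[of "z ^ 3" z] z by (simp add: norm_power)
  finally show "cmod (blaschke r z - (z - of_real r + of_real r * z\<^sup>2)) \<le> 8 * r\<^sup>2"
    by (simp add: mult_left_mono)
  have "z - blaschke r z = (of_real r * (1 - z\<^sup>2)) / (1 - of_real r * z)"
    unfolding blaschke_def using nz by (simp add: field_simps power2_eq_square)
  then have "cmod (z - blaschke r z) \<le> 4 * cmod (of_real r * (1 - z\<^sup>2))" by (metis *)
  also have "\<dots> = 4 * (r * cmod (1 - z\<^sup>2))" using r by (simp add: norm_mult)
  also have "cmod (1 - z\<^sup>2) \<le> 2"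
    using norm_triangle_ineq4[of 1 "z\<^sup>2"] z by (simp add: norm_power)
  finally show "cmod (z - blaschke r z) \<le> 8 * r" using r by (simp add: mult_left_mono)
qed

text \<open>A smooth cutoff of \<open>1 / p\<close> to the primes with \<open>d1 ln p\<close> small and \<open>d2 ln p\<close> large. Smooth
cutoffs turn all sums over windows into values of the prime zeta function.\<close>

definition window_weight :: "real \<Rightarrow> real \<Rightarrow> nat \<Rightarrow> real" where
  "window_weight d1 d2 l = pr l powr (-1-d1) - pr l powr (-1-d2)"

text \<open>The same cutoff of \<open>1 / sqrt p\<close>.\<close>

definition window_coeff :: "real \<Rightarrow> real \<Rightarrow> nat \<Rightarrow> real" where
  "window_coeff d1 d2 l = pr l powr (-1/2-d1) - pr l powr (-1/2-d2)"

lemma window_coeff_weight_bounds: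
  assumes "0 \<le> d1" "d1 \<le> d2"
  shows "0 \<le> window_coeff d1 d2 l" "window_coeff d1 d2 l \<le> pr l powr (-1/2)" "0 \<le> window_weight d1 d2 l" "window_weight d1 d2 l \<le> pr l powr (-1)"
    "window_coeff d1 d2 l * pr l powr (-1/2-x) = window_weight d1 d2 l * pr l powr (-x)"
    "(window_coeff d1 d2 l)\<^sup>2 \<le> window_weight d1 d2 l" "(window_weight d1 d2 l)\<^sup>2 \<le> window_weight d1 d2 l"
proof -
  have p: "pr l \<ge> 1" "pr l > 0" using pr_ge_2[of l] by auto
  define a b h where "a = pr l powr (-d1)" and "b = pr l powr (-d2)" and "h = pr l powr (-1/2)"
  have a1: "a \<le> 1" using p assms powr_mono[of "-d1" 0 "pr l"] by (simp add: a_def)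
  have ab: "b \<le> a" using p assms powr_mono[of "-d2" "-d1" "pr l"] by (simp add: a_def b_def)
  have b0: "0 \<le> b" by (simp add: b_def)
  have h0: "0 \<le> h" by (simp add: h_def)
  have hh: "h * h = pr l powr (-1)" by (simp add: h_def powr_add[symmetric])
  have hh1: "h * h \<le> 1" unfolding hh using powr_mono[of "-1" 0 "pr l"] p by simp
  have c: "window_coeff d1 d2 l = h * (a - b)"
    unfolding window_coeff_def h_def a_def b_def right_diff_distrib diff_conv_add_uminus powr_add
    by (simp only: distrib_left mult_minus_right)
  have q: "window_weight d1 d2 l = h * h * (a - b)"
    unfolding hh window_weight_def a_def b_def right_diff_distrib diff_conv_add_uminus powr_add
    by (simp only: distrib_left mult_minus_right)
  have ab1: "0 \<le> a - b" "a - b \<le> 1" using ab a1 b0 by auto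
  show "0 \<le> window_coeff d1 d2 l" "0 \<le> window_weight d1 d2 l" unfolding c q using ab1 h0 by auto
  show "window_coeff d1 d2 l \<le> pr l powr (-1/2)"
    unfolding c h_def[symmetric] using mult_left_mono[OF ab1(2) h0] by simp
  show qle: "window_weight d1 d2 l \<le> pr l powr (-1)"
    unfolding q hh[symmetric] using mult_left_mono[OF ab1(2), of "h * h"] h0 by simp
  have "pr l powr (-1/2-x) = h * pr l powr (-x)"
    by (simp add: h_def powr_add[symmetric])
  then show "window_coeff d1 d2 l * pr l powr (-1/2-x) = window_weight d1 d2 l * pr l powr (-x)"
    unfolding c q by simp
  have "(a - b) * (a - b) \<le> a - b" using mult_left_mono[OF ab1(2) ab1(1)] by simp
  then have "h * h * ((a - b) * (a - b)) \<le> h * h * (a - b)" using h0 by (intro mult_left_mono) auto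
  then show "(window_coeff d1 d2 l)\<^sup>2 \<le> window_weight d1 d2 l" unfolding c q by (simp add: power2_eq_square mult_ac)
  have "window_weight d1 d2 l \<le> 1" using qle hh hh1 by simp
  then have "window_weight d1 d2 l * window_weight d1 d2 l \<le> window_weight d1 d2 l * 1"
    using ab1 h0 by (intro mult_left_mono) (auto simp: q)
  then show "(window_weight d1 d2 l)\<^sup>2 \<le> window_weight d1 d2 l" by (simp add: power2_eq_square)
qed

text \<open>Inside a window between the two scales \<open>p powr (-\<delta>')\<close> is almost \<open>1\<close> and \<open>p powr (-\<delta>)\<close> almost \<open>0\<close>.
The total error is a combination of values of the prime zeta function whose logarithms cancel up to a
bounded amount.\<close>

lemma window_defect:
  assumes d: "0 < \<delta>'" "\<delta>' \<le> d1" "d1 \<le> d2" "d2 \<le> 1" "d2 \<le> 2 * \<delta>" "\<delta> \<le> 1"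
  shows "(\<Sum>l<N. window_weight d1 d2 l * (1 - pr l powr (-\<delta>') + pr l powr (-\<delta>))) \<le> 24"
proof -
  have pos: "0 < d1" "0 < d2" "0 < \<delta>" "\<delta>' \<le> 1" using d by auto
  let ?S = "\<lambda>x l. pr l powr (-1-x)"
  let ?e = "\<lambda>l. window_weight d1 d2 l * (1 - pr l powr (-\<delta>') + pr l powr (-\<delta>))"
  have e: "?e l = (?S d1 l - ?S d2 l) - (?S (d1 + \<delta>') l - ?S (d2 + \<delta>') l) + (?S (d1 + \<delta>) l - ?S (d2 + \<delta>) l)" for l
    using pr_ge_2[of l] by (simp add: window_weight_def algebra_simps powr_add[symmetric])
  have s: "?S x sums prime_zeta x" if "x > 0" for x
    unfolding prime_zeta_def using summable_prime_zeta[OF that] by (rule summable_sums)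
  have sums: "?e sums ((prime_zeta d1 - prime_zeta d2) - (prime_zeta (d1 + \<delta>') - prime_zeta (d2 + \<delta>'))
      + (prime_zeta (d1 + \<delta>) - prime_zeta (d2 + \<delta>)))"
    unfolding e by (intro sums_add sums_diff s) (use pos d in auto)
  have e0: "?e l \<ge> 0" for l
  proof -
    have "pr l powr (-\<delta>') \<le> 1" using powr_mono[of "-\<delta>'" 0 "pr l"] pr_ge_2[of l] d by simp
    then have "0 \<le> 1 - pr l powr (-\<delta>') + pr l powr (-\<delta>)" by (simp add: add_nonneg_nonneg)
    then show ?thesis using window_coeff_weight_bounds(3)[of d1 d2 l] pos d by simp
  qed
  have "(\<Sum>l<N. ?e l) \<le> (prime_zeta d1 - prime_zeta d2) - (prime_zeta (d1 + \<delta>') - prime_zeta (d2 + \<delta>'))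
      + (prime_zeta (d1 + \<delta>) - prime_zeta (d2 + \<delta>))"
    using sum_le_suminf[OF sums_summable[OF sums], of "{..<N}"] e0 sums_unique[OF sums] by simp
  also have "\<dots> = (prime_zeta d1 - prime_zeta (d1 + \<delta>')) + (prime_zeta (d2 + \<delta>') - prime_zeta d2)
      + (prime_zeta (d1 + \<delta>) - prime_zeta (d2 + \<delta>))" by simp
  also have "\<dots> \<le> (ln 2 + 7) + 7 + (ln 3 + 7)"
  proof (intro add_mono)
    have b: "prime_zeta x - prime_zeta y \<le> ln c + 7" if "0 < x" "x \<le> 2" "0 < y" "y \<le> 2" "y \<le> c * x" "0 < c" for x y c
    proof -
      have "ln y \<le> ln (c * x)" using that by (subst ln_le_cancel_iff) auto
      then have "ln (1 / x) - ln (1 / y) \<le> ln c" using that by (simp add: ln_div ln_mult)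
      then show ?thesis using prime_zeta_bounds(2)[of x] prime_zeta_bounds(1)[of y] that by simp
    qed
    show "prime_zeta d1 - prime_zeta (d1 + \<delta>') \<le> ln 2 + 7" using d pos by (intro b) auto
    show "prime_zeta (d2 + \<delta>') - prime_zeta d2 \<le> 7" using b[of "d2 + \<delta>'" d2 1] d pos by simp
    show "prime_zeta (d1 + \<delta>) - prime_zeta (d2 + \<delta>) \<le> ln 3 + 7" using d pos by (intro b) auto
  qed
  also have "\<dots> \<le> 24" using ln_le_minus_one[of 2] ln_le_minus_one[of 3] by simp
  finally show ?thesis .
qed

lemma sum_pr_three_halves: "(\<Sum>l<N. pr l powr (-3/2)) \<le> 2"
proof -
  have "(\<Sum>l<N. pr l powr (-1-1/2)) \<le> ln (1 + 1 / (1 / 2))" by (rule prime_sum_upper) simp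
  also have "\<dots> \<le> 2" using ln_le_minus_one[of 3] by simp
  finally show ?thesis by simp
qed

lemma norm_sum_le_weighted:
  assumes "\<And>l. cmod (f l) \<le> C * pr l powr (-3/2)" "C \<ge> 0"
  shows "cmod (\<Sum>l<N. f l) \<le> 2 * C"
proof -
  have "cmod (\<Sum>l<N. f l) \<le> (\<Sum>l<N. C * pr l powr (-3/2))"
    by (intro order_trans[OF norm_sum] sum_mono assms)
  also have "\<dots> = C * (\<Sum>l<N. pr l powr (-3/2))" by (simp add: sum_distrib_left)
  also have "\<dots> \<le> C * 2" using sum_pr_three_halves assms(2) by (intro mult_left_mono)
  finally show ?thesis by simp
qed

text \<open>The two sums of the \<open>w\<^sub>p / sqrt p\<close>, for \<open>\<delta>\<close> and for \<open>\<delta>'\<close>, come from the same \<open>z\<close>. Their difference is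
the sum of \<open>(r'\<^sub>p - r\<^sub>p) (1 - z\<^sub>p\<^sup>2) / sqrt p\<close> up to \<open>O(1)\<close>, and here \<open>r'\<^sub>p - r\<^sub>p\<close> may be replaced by
\<open>1 / sqrt p\<close>. Therefore the mass of the window is controlled by the two linear sums and
one quadratic sum, where \<open>z\<^sub>p\<^sup>2\<close> may be replaced by the square of the image point.\<close>

lemma window_sum_le:
  assumes d: "0 < \<delta>'" "\<delta>' \<le> d1" "d1 \<le> d2" "d2 \<le> 1" "d2 \<le> 2 * \<delta>" "\<delta> \<le> 1"
    and z: "\<And>l. cmod (z l) = 1"
  shows "(\<Sum>l<N. window_weight d1 d2 l) \<le> cmod (\<Sum>l<N. of_real (window_coeff d1 d2 l) * blaschke (radius \<delta> l) (z l))
    + cmod (\<Sum>l<N. of_real (window_coeff d1 d2 l) * blaschke (radius \<delta>' l) (z l))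
    + cmod (\<Sum>l<N. of_real (window_weight d1 d2 l) * (blaschke (radius \<delta>' l) (z l))\<^sup>2) + 112"
proof -
  let ?c = "window_coeff d1 d2" and ?q = "window_weight d1 d2" and ?r = "radius \<delta>" and ?r' = "radius \<delta>'"
  have pos: "0 \<le> d1" "0 \<le> \<delta>" "0 \<le> \<delta>'" using d by auto
  note cq = window_coeff_weight_bounds[OF pos(1) d(3)]
  define w w' where "w l = blaschke (?r l) (z l)" and "w' l = blaschke (?r' l) (z l)" for l
  define E where "E x l = blaschke (radius x l) (z l) - (z l - of_real (radius x l) + of_real (radius x l) * (z l)\<^sup>2)" for x l
  define D where "D l = ?q l * (1 - pr l powr (-\<delta>') + pr l powr (-\<delta>))" for l
  have h32: "pr l powr (-1/2) * (1 / pr l) = pr l powr (-3/2)" for l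
  proof -
    have "1 / pr l = pr l powr (-1)" using pr_ge_2[of l] by (simp add: powr_minus_divide)
    then have "pr l powr (-1/2) * (1 / pr l) = pr l powr (-1/2 + -1)" unfolding powr_add by (rule arg_cong)
    then show ?thesis by simp
  qed
  have E: "cmod (of_real (?c l) * E x l) \<le> 8 * pr l powr (-3/2)" if "0 \<le> x" for x l
  proof -
    have "cmod (E x l) \<le> 8 * (radius x l)\<^sup>2"
      unfolding E_def using radius_pos[of x l] radius_le[OF that, of l] by (intro blaschke_expansion(1) z) auto
    also have "\<dots> \<le> 8 * (1 / pr l)" using radius_square_le[OF that, of l] by simp
    finally have "?c l * cmod (E x l) \<le> pr l powr (-1/2) * (8 * (1 / pr l))"
      using cq(1,2)[of l] by (intro mult_mono) auto
    also have "\<dots> = 8 * pr l powr (-3/2)" using h32[of l] by (simp only: mult.left_commute)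
    finally show ?thesis using cq(1)[of l] by (simp add: norm_mult)
  qed
  have sq: "cmod (of_real (?q l) * ((z l)\<^sup>2 - (w' l)\<^sup>2)) \<le> 16 * pr l powr (-3/2)" for l
  proof -
    have r'1: "?r' l < 1" using radius_le[OF pos(3), of l] by simp
    have nw: "cmod (w' l) = 1" unfolding w'_def using radius_pos[of \<delta>' l] r'1 by (intro norm_blaschke z) auto
    have "(z l)\<^sup>2 - (w' l)\<^sup>2 = (z l - w' l) * (z l + w' l)" by (simp add: power2_eq_square algebra_simps)
    then have "cmod ((z l)\<^sup>2 - (w' l)\<^sup>2) = cmod (z l - w' l) * cmod (z l + w' l)" by (simp add: norm_mult)
    also have "\<dots> \<le> (8 * ?r' l) * 2"
    proof (intro mult_mono)
      show "cmod (z l - w' l) \<le> 8 * ?r' l"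
        unfolding w'_def using radius_pos[of \<delta>' l] radius_le[OF pos(3), of l] by (intro blaschke_expansion(2) z) auto
      show "cmod (z l + w' l) \<le> 2" using norm_triangle_ineq[of "z l" "w' l"] nw z by simp
    qed (use radius_pos[of \<delta>' l] in auto)
    also have "\<dots> \<le> 16 * pr l powr (-1/2)"
      using d pr_ge_2[of l] unfolding radius_def by (auto intro!: powr_mono)
    finally have "?q l * cmod ((z l)\<^sup>2 - (w' l)\<^sup>2) \<le> pr l powr (-1) * (16 * pr l powr (-1/2))"
      using cq(3,4)[of l] by (intro mult_mono) auto
    also have "\<dots> = 16 * pr l powr (-1 + -1/2)" by (simp only: powr_add mult.left_commute)
    also have "-1 + -1/2 = (-3/2 :: real)" by simp
    finally show ?thesis using cq(3)[of l] by (simp add: norm_mult)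
  qed
  have D0: "D l \<ge> 0" for l
  proof -
    have "pr l powr (-\<delta>') \<le> 1" using powr_mono[of "-\<delta>'" 0 "pr l"] pr_ge_2[of l] d by simp
    then have "0 \<le> 1 - pr l powr (-\<delta>') + pr l powr (-\<delta>)" by (simp add: add_nonneg_nonneg)
    then show ?thesis using cq(3)[of l] by (simp add: D_def)
  qed
  have SD: "cmod (\<Sum>l<N. of_real (D l) * (1 - (z l)\<^sup>2)) \<le> 48"
  proof -
    have "cmod (of_real (D l) * (1 - (z l)\<^sup>2)) \<le> 2 * D l" for l
    proof -
      have "cmod (1 - (z l)\<^sup>2) \<le> 2" using norm_triangle_ineq4[of 1 "(z l)\<^sup>2"] z[of l] by (simp add: norm_power)
      then have "D l * cmod (1 - (z l)\<^sup>2) \<le> D l * 2" using D0[of l] by (intro mult_left_mono)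
      then show ?thesis using D0[of l] by (simp add: norm_mult)
    qed
    then have "cmod (\<Sum>l<N. of_real (D l) * (1 - (z l)\<^sup>2)) \<le> (\<Sum>l<N. 2 * D l)"
      by (intro order_trans[OF norm_sum] sum_mono)
    also have "\<dots> = 2 * (\<Sum>l<N. D l)" by (simp add: sum_distrib_left)
    also have "(\<Sum>l<N. D l) \<le> 24" unfolding D_def by (rule window_defect[OF d])
    finally show ?thesis by simp
  qed
  \<comment> \<open>The window weight, solved for from the difference of the two expansions.\<close>
  have key: "of_real (?q l) = of_real (?c l) * w l - of_real (?c l) * w' l
      - of_real (?c l) * E \<delta> l + of_real (?c l) * E \<delta>' l + of_real (D l) * (1 - (z l)\<^sup>2)
      + of_real (?q l) * (w' l)\<^sup>2 + of_real (?q l) * ((z l)\<^sup>2 - (w' l)\<^sup>2)" for l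
  proof -
    have "?c l * (?r' l - ?r l) = ?q l - D l"
      unfolding radius_def right_diff_distrib cq(5) by (simp add: D_def algebra_simps)
    then have cr: "complex_of_real (?c l) * of_real (?r' l) - of_real (?c l) * of_real (?r l) = of_real (?q l) - of_real (D l)"
      by (metis of_real_diff of_real_mult right_diff_distrib)
    have ww: "of_real (?c l) * w l - of_real (?c l) * w' l - of_real (?c l) * E \<delta> l + of_real (?c l) * E \<delta>' l
      = (of_real (?c l) * of_real (?r' l) - of_real (?c l) * of_real (?r l)) * (1 - (z l)\<^sup>2)"
      by (simp add: E_def w_def w'_def algebra_simps)
    show ?thesis unfolding ww cr by (simp add: algebra_simps)
  qed
  have tri: "cmod (a - b - c + d + e + f + g) \<le> cmod a + cmod b + cmod c + cmod d + cmod e + cmod f + cmod g"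
    for a b c d e f g :: complex
    using norm_triangle_ineq[of "a-b-c+d+e+f" g] norm_triangle_ineq[of "a-b-c+d+e" f] norm_triangle_ineq[of "a-b-c+d" e]
      norm_triangle_ineq[of "a-b-c" d] norm_triangle_ineq4[of "a-b" c] norm_triangle_ineq4[of a b] by linarith
  have "complex_of_real (\<Sum>l<N. ?q l) = (\<Sum>l<N. of_real (?c l) * w l) - (\<Sum>l<N. of_real (?c l) * w' l)
      - (\<Sum>l<N. of_real (?c l) * E \<delta> l) + (\<Sum>l<N. of_real (?c l) * E \<delta>' l) + (\<Sum>l<N. of_real (D l) * (1 - (z l)\<^sup>2))
      + (\<Sum>l<N. of_real (?q l) * (w' l)\<^sup>2) + (\<Sum>l<N. of_real (?q l) * ((z l)\<^sup>2 - (w' l)\<^sup>2))"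
  proof -
    have "(\<Sum>l<N. complex_of_real (?q l)) = (\<Sum>l<N. of_real (?c l) * w l - of_real (?c l) * w' l
      - of_real (?c l) * E \<delta> l + of_real (?c l) * E \<delta>' l + of_real (D l) * (1 - (z l)\<^sup>2)
      + of_real (?q l) * (w' l)\<^sup>2 + of_real (?q l) * ((z l)\<^sup>2 - (w' l)\<^sup>2))"
      by (rule sum.cong[OF refl key])
    then show ?thesis unfolding of_real_sum by (simp only: sum.distrib sum_subtractf)
  qed
  then have "cmod (complex_of_real (\<Sum>l<N. ?q l)) \<le> cmod (\<Sum>l<N. of_real (?c l) * w l) + cmod (\<Sum>l<N. of_real (?c l) * w' l)
      + cmod (\<Sum>l<N. of_real (?c l) * E \<delta> l) + cmod (\<Sum>l<N. of_real (?c l) * E \<delta>' l)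
      + cmod (\<Sum>l<N. of_real (D l) * (1 - (z l)\<^sup>2))
      + cmod (\<Sum>l<N. of_real (?q l) * (w' l)\<^sup>2) + cmod (\<Sum>l<N. of_real (?q l) * ((z l)\<^sup>2 - (w' l)\<^sup>2))"
    by (simp only: tri)
  also have "\<dots> \<le> cmod (\<Sum>l<N. of_real (?c l) * w l) + cmod (\<Sum>l<N. of_real (?c l) * w' l)
      + 2 * 8 + 2 * 8 + 48 + cmod (\<Sum>l<N. of_real (?q l) * (w' l)\<^sup>2) + 2 * 16"
    using norm_sum_le_weighted[where f = "\<lambda>l. of_real (?c l) * E \<delta> l", OF E[OF pos(2)], of N]
      norm_sum_le_weighted[where f = "\<lambda>l. of_real (?c l) * E \<delta>' l", OF E[OF pos(3)], of N]
      norm_sum_le_weighted[where f = "\<lambda>l. of_real (?q l) * ((z l)\<^sup>2 - (w' l)\<^sup>2)", OF sq, of N] SD by linarith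
  finally show ?thesis using sum_nonneg[of "{..<N}" ?q] cq(3) by (simp add: w_def w'_def del: of_real_sum)
qed

section \<open>Typical sets\<close>

lemma second_moment_prime_powers:
  assumes "e \<noteq> 0"
  shows "(\<integral>z. (cmod (\<Sum>l<N. of_real (a l) * z l ^ e))\<^sup>2 \<partial>torus) = (\<Sum>l<N. (a l)\<^sup>2)"
proof -
  define g where "g l = nth_prime l ^ e" for l
  have inj: "inj_on g {..<N}"
  proof (rule inj_onI)
    fix j l assume "g j = g l"
    then have "nth_prime j dvd nth_prime l ^ e" using assms by (metis g_def dvd_power zero_less_iff_neq_zero)
    then have "nth_prime j dvd nth_prime l" by (rule prime_dvd_power[OF prime_nth_prime])
    then show "j = l" by (simp add: nth_prime_dvd_iff)
  qed
  have g0: "g l \<noteq> 0" for l using nth_prime_pos[of l] by (simp add: g_def)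
  have pow: "bohr_char (nth_prime l ^ k) z = z l ^ k" for l k z
  proof (induction k)
    case 0 then show ?case by (simp add: bohr_char_1[simplified])
  next
    case (Suc k)
    then show ?case using nth_prime_pos[of l] by (simp add: bohr_char_mult bohr_char_nth_prime)
  qed
  have bg: "bohr_char (g l) z = z l ^ e" for l z unfolding g_def by (rule pow)
  define c where "c n = complex_of_real (a (inv_into {..<N} g n))" for n
  have cg: "c (g l) = of_real (a l)" if "l < N" for l
    using that inj by (simp add: c_def inv_into_f_f)
  have eq: "(\<Sum>l<N. of_real (a l) * z l ^ e) = (\<Sum>n\<in>g ` {..<N}. c n * bohr_char n z)" for z
    by (subst sum.reindex[OF inj]) (auto intro!: sum.cong simp: cg bg)
  have "(\<integral>z. (cmod (\<Sum>l<N. of_real (a l) * z l ^ e))\<^sup>2 \<partial>torus) = (\<Sum>n\<in>g ` {..<N}. (cmod (c n))\<^sup>2)"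
  proof -
    have "0 \<notin> g ` {..<N}" using g0 by (metis imageE)
    from L2_norm_bohr_sum[OF finite_imageI[OF finite_lessThan] this]
    show ?thesis unfolding eq .
  qed
  also have "\<dots> = (\<Sum>l<N. (a l)\<^sup>2)"
    by (subst sum.reindex[OF inj]) (auto intro!: sum.cong simp: cg)
  finally show ?thesis .
qed

lemma chebyshev_prime_powers:
  assumes "e \<noteq> 0" "t > 0"
  shows "measure torus {z \<in> space torus. cmod (\<Sum>l<N. of_real (a l) * z l ^ e) > t} \<le> (\<Sum>l<N. (a l)\<^sup>2) / t\<^sup>2"
proof -
  interpret prob_space torus by (rule prob_space_torus)
  let ?S = "\<lambda>z :: nat \<Rightarrow> complex. \<Sum>l<N. of_real (a l) * z l ^ e"
  have m[measurable]: "?S \<in> borel_measurable torus" by measurable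
  have L2: "?S \<in> L2 torus"
  proof (rule L2_bounded[OF finite_measure_torus m AE_I2])
    fix z assume z: "z \<in> space torus"
    show "cmod (?S z) \<le> (\<Sum>l<N. \<bar>a l\<bar>)"
      by (rule order_trans[OF norm_sum]) (simp add: norm_mult norm_power norm_torus_coord[OF z])
  qed
  have "measure torus {z \<in> space torus. ?S z \<in> {w. cmod w > t}} \<le> measure torus {z \<in> space torus. (cmod (?S z))\<^sup>2 \<ge> t\<^sup>2}"
    using assms by (intro finite_measure_mono) (auto intro: power_mono)
  also have "\<dots> \<le> (\<integral>z. (cmod (?S z))\<^sup>2 \<partial>torus) / t\<^sup>2"
    using L2_integrable_square[OF L2] assms by (intro integral_Markov_inequality_measure[where A = "{}"]) auto
  finally show ?thesis by (simp add: second_moment_prime_powers[OF assms(1)])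
qed

text \<open>Window \<open>j\<close> at scale \<open>i\<close> is the dyadic interval from \<open>j 2^i\<close> to \<open>(j + 1) 2^i\<close> on the axis
of \<open>log\<^sub>2 (ln p)\<close>; \<open>window_lo\<close> and \<open>window_hi\<close> are the corresponding parameters \<open>d1 \<le> d2\<close>.\<close>

definition window_lo :: "nat \<Rightarrow> nat \<Rightarrow> real" where "window_lo i j = (1 / 2) ^ ((j + 1) * 2 ^ i)"
definition window_hi :: "nat \<Rightarrow> nat \<Rightarrow> real" where "window_hi i j = (1 / 2) ^ (j * 2 ^ i)"

lemma window_lo_hi: "0 < window_lo i j" "window_lo i j \<le> window_hi i j" "window_hi i j \<le> 1" "0 \<le> window_lo i j"
  by (auto simp: window_lo_def window_hi_def power_le_one intro!: power_decreasing)

lemma ln_window_ratio: "ln (1 / window_lo i j) - ln (1 / window_hi i j) = 2 ^ i * ln 2"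
proof -
  have "ln (1 / (1 / 2) ^ n) = real n * ln 2" for n :: nat
    by (simp add: power_divide ln_realpow)
  then show ?thesis unfolding window_lo_def window_hi_def by (simp add: algebra_simps)
qed

lemma window_weight_sums: "window_weight (window_lo i j) (window_hi i j) sums (prime_zeta (window_lo i j) - prime_zeta (window_hi i j))"
  unfolding window_weight_def prime_zeta_def using window_lo_hi[of i j]
  by (intro sums_diff summable_sums summable_prime_zeta) auto

lemma window_weight_sum_upper: "(\<Sum>l<N. window_weight (window_lo i j) (window_hi i j) l) \<le> 8 * 2 ^ i"
proof -
  note b = window_lo_hi[of i j]
  have "(\<Sum>l<N. window_weight (window_lo i j) (window_hi i j) l) \<le> prime_zeta (window_lo i j) - prime_zeta (window_hi i j)"
    using sum_le_suminf[OF sums_summable[OF window_weight_sums], of "{..<N}" i j] window_coeff_weight_bounds(3)[OF b(4,2)] sums_unique[OF window_weight_sums, of i j] by simp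
  also have "\<dots> \<le> (ln (1 / window_lo i j) + 2) - (ln (1 / window_hi i j) - 5)"
    using b by (intro diff_mono prime_zeta_bounds) auto
  also have "\<dots> = 2 ^ i * ln 2 + 7" using ln_window_ratio[of i j] by simp
  also have "\<dots> \<le> 2 ^ i * 1 + 7 * 2 ^ i"
    using ln_le_minus_one[of 2] by (intro add_mono mult_left_mono) auto
  finally show ?thesis by simp
qed

text \<open>The first \<open>N\<close> primes carry almost the full mass \<open>2^i ln 2\<close> of each window up to the
scale \<open>K\<close>. The slack between \<open>ln 2\<close> and \<open>2/3\<close> keeps the statement free of logarithms.\<close>

definition enough_primes :: "nat \<Rightarrow> nat \<Rightarrow> bool" where
  "enough_primes K N \<longleftrightarrow> (\<forall>i j. (j + 1) * 2 ^ i \<le> K \<longrightarrow> 2 / 3 * 2 ^ i - 8 \<le> (\<Sum>l<N. window_weight (window_lo i j) (window_hi i j) l))"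

lemma eventually_enough_primes: "\<forall>\<^sub>F N in sequentially. enough_primes K N"
proof -
  have ev: "\<forall>\<^sub>F N in sequentially. 2 / 3 * 2 ^ i - 8 \<le> (\<Sum>l<N. window_weight (window_lo i j) (window_hi i j) l)" for i j
  proof -
    note b = window_lo_hi[of i j]
    have "2 / 3 * 2 ^ i - 8 < 2 ^ i * ln 2 - (7::real)"
      using ln2_ge_two_thirds by (smt (verit) mult.commute mult_left_mono zero_le_power)
    also have "\<dots> = (ln (1 / window_lo i j) - 5) - (ln (1 / window_hi i j) + 2)" using ln_window_ratio[of i j] by simp
    also have "\<dots> \<le> prime_zeta (window_lo i j) - prime_zeta (window_hi i j)"
      using b by (intro diff_mono prime_zeta_bounds) auto
    finally have "2 / 3 * 2 ^ i - 8 < prime_zeta (window_lo i j) - prime_zeta (window_hi i j)" .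
    with window_weight_sums[of i j] have "\<forall>\<^sub>F N in sequentially. 2 / 3 * 2 ^ i - 8 < (\<Sum>l<N. window_weight (window_lo i j) (window_hi i j) l)"
      unfolding sums_def by (rule order_tendstoD)
    then show ?thesis by eventually_elim simp
  qed
  have "\<forall>\<^sub>F N in sequentially. \<forall>p\<in>{..K} \<times> {..K}. 2 / 3 * 2 ^ fst p - 8 \<le> (\<Sum>l<N. window_weight (window_lo (fst p) (snd p)) (window_hi (fst p) (snd p)) l)"
    by (rule eventually_ball_finite) (use ev in auto)
  then show ?thesis
  proof eventually_elim
    case (elim N)
    show ?case
      unfolding enough_primes_def
    proof (intro allI impI)
      fix i j assume le: "(j + 1) * 2 ^ i \<le> K"
      have "i < 2 ^ i" by (rule less_exp)
      also have "2 ^ i \<le> (j + 1) * 2 ^ i" by simp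
      finally have "i \<le> K" using le by simp
      moreover have "j * 1 \<le> (j + 1) * 2 ^ i" by (intro mult_le_mono) auto
      then have "j \<le> K" using le by simp
      ultimately show "2 / 3 * 2 ^ i - 8 \<le> (\<Sum>l<N. window_weight (window_lo i j) (window_hi i j) l)" using elim by force
    qed
  qed
qed

text \<open>The threshold \<open>2^i / 8\<close> is such that three of these sums cannot reach the mass \<open>2/3 * 2^i\<close> of the
window. The exponent \<open>1\<close> is kept so that both sums have the same form.\<close>

definition window_event :: "nat \<Rightarrow> nat \<Rightarrow> nat \<Rightarrow> (nat \<Rightarrow> complex) set" where
  "window_event N i j = {w \<in> space torus.
     cmod (\<Sum>l<N. of_real (window_coeff (window_lo i j) (window_hi i j) l) * w l ^ 1) \<le> 2 ^ i / 8 \<and>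
     cmod (\<Sum>l<N. of_real (window_weight (window_lo i j) (window_hi i j) l) * w l ^ 2) \<le> 2 ^ i / 8}"

text \<open>The windows of scale \<open>i\<close> at distance at most \<open>4 * 2^i\<close> from \<open>k\<close>. There are at most nine of
them for each \<open>i\<close>, which makes the failure probabilities \<open>O(2^(-i))\<close> summable; starting with
\<open>i = 16\<close> makes their sum less than \<open>1/2\<close> and lets \<open>2^i\<close> dominate all bounded errors.\<close>

definition windows :: "nat \<Rightarrow> nat \<Rightarrow> (nat \<times> nat) set" where
  "windows K k = {(i, j). 16 \<le> i \<and> i \<le> K \<and> k \<le> (j + 4) * 2 ^ i \<and> j * 2 ^ i \<le> k + 4 * 2 ^ i}"

definition typical :: "nat \<Rightarrow> nat \<Rightarrow> nat \<Rightarrow> (nat \<Rightarrow> complex) set" where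
  "typical N K k = {w \<in> space torus. \<forall>(i, j)\<in>windows K k. w \<in> window_event N i j}"

lemma window_event_sets: "window_event N i j \<in> sets torus"
  unfolding window_event_def by measurable

lemma window_event_rotation: "rotation_invariant (window_event N i j)"
  unfolding rotation_invariant_def
proof (intro allI impI)
  fix u :: complex and z assume u: "cmod u = 1" and z: "z \<in> space torus"
  have sp: "(\<lambda>j. u * z j) \<in> space torus"
    using measurable_space[OF measurable_torus_mult[of "\<lambda>_. u"] z] u by simp
  have "cmod (\<Sum>l<N. of_real (a l) * (u * z l) ^ e) = cmod (\<Sum>l<N. of_real (a l) * z l ^ e)" for a :: "nat \<Rightarrow> real" and e
  proof -
    have "(\<Sum>l<N. of_real (a l) * (u * z l) ^ e) = u ^ e * (\<Sum>l<N. of_real (a l) * z l ^ e)"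
      by (simp add: sum_distrib_left power_mult_distrib mult_ac)
    then show ?thesis using u by (simp add: norm_mult norm_power)
  qed
  then show "(\<lambda>j. u * z j) \<in> window_event N i j \<longleftrightarrow> z \<in> window_event N i j"
    unfolding window_event_def using sp z by (simp only: mem_Collect_eq)
qed

lemma window_event_prob: "measure torus (space torus - window_event N i j) \<le> 1024 / 2 ^ i"
proof -
  interpret prob_space torus by (rule prob_space_torus)
  note b = window_lo_hi[of i j]
  let ?c = "window_coeff (window_lo i j) (window_hi i j)" and ?q = "window_weight (window_lo i j) (window_hi i j)"
  let ?B = "\<lambda>a e. {z \<in> space torus. cmod (\<Sum>l<N. of_real (a l) * z l ^ e) > 2 ^ i / 8}"
  have bad: "measure torus (?B a e) \<le> 512 / 2 ^ i" if "\<And>l. (a l)\<^sup>2 \<le> ?q l" "e \<noteq> 0" for a e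
  proof -
    have "measure torus (?B a e) \<le> (\<Sum>l<N. (a l)\<^sup>2) / (2 ^ i / 8)\<^sup>2"
      by (rule chebyshev_prime_powers[OF that(2)]) simp
    also have "(\<Sum>l<N. (a l)\<^sup>2) \<le> 8 * 2 ^ i"
      by (rule order_trans[OF sum_mono[OF that(1)] window_weight_sum_upper])
    also have "8 * 2 ^ i / (2 ^ i / 8)\<^sup>2 = (512 / 2 ^ i :: real)"
      by (simp add: power2_eq_square field_simps)
    finally show ?thesis by (simp add: divide_right_mono)
  qed
  have s: "?B a e \<in> sets torus" for a e by measurable
  have "space torus - window_event N i j = ?B ?c 1 \<union> ?B ?q 2"
    unfolding window_event_def by (auto simp: not_le)
  then have "measure torus (space torus - window_event N i j) \<le> measure torus (?B ?c 1) + measure torus (?B ?q 2)"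
    using measure_Un_le[OF s s] by (simp only:)
  also have "\<dots> \<le> 512 / 2 ^ i + 512 / 2 ^ i"
    using window_coeff_weight_bounds(6,7)[OF b(4,2)] by (intro add_mono bad) auto
  finally show ?thesis by simp
qed

lemma windows_subset:
  "windows K k \<subseteq> (SIGMA i:{16..K}. {k div 2 ^ i - 4..k div 2 ^ i + 4})"
proof
  fix p assume "p \<in> windows K k"
  then obtain i j where p: "p = (i, j)" "16 \<le> i" "i \<le> K" "k \<le> (j + 4) * 2 ^ i" "j * 2 ^ i \<le> k + 4 * 2 ^ i"
    by (auto simp: windows_def)
  have "k div 2 ^ i \<le> ((j + 4) * 2 ^ i) div 2 ^ i" by (rule div_le_mono[OF p(4)])
  then have 1: "k div 2 ^ i \<le> j + 4" by simp
  have "(j * 2 ^ i) div 2 ^ i \<le> (k + 4 * 2 ^ i) div 2 ^ i" by (rule div_le_mono[OF p(5)])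
  then have 2: "j \<le> k div 2 ^ i + 4" by simp
  from p 1 2 show "p \<in> (SIGMA i:{16..K}. {k div 2 ^ i - 4..k div 2 ^ i + 4})" by auto
qed

lemma finite_windows: "finite (windows K k)"
  by (rule finite_subset[OF windows_subset]) auto

lemma sum_geometric_tail: "(\<Sum>i=m..K. (1 / 2 :: real) ^ i) \<le> 2 * (1 / 2) ^ m"
proof -
  have "(\<Sum>i=m..<m + n. (1 / 2 :: real) ^ i) = 2 * (1 / 2) ^ m - 2 * (1 / 2) ^ (m + n)" for n
    by (induction n) auto
  then have *: "(\<Sum>i=m..<m + n. (1 / 2 :: real) ^ i) \<le> 2 * (1 / 2) ^ m" for n by simp
  have "(\<Sum>i=m..K. (1 / 2 :: real) ^ i) \<le> (\<Sum>i=m..<m + Suc K. (1 / 2 :: real) ^ i)"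
    by (intro sum_mono2) auto
  with *[of "Suc K"] show ?thesis by linarith
qed

lemma typical_sets: "typical N K k \<in> sets torus"
proof -
  have "typical N K k = space torus \<inter> (\<Inter>p\<in>insert undefined (windows K k). if p \<in> windows K k then window_event N (fst p) (snd p) else space torus)"
    by (auto simp: typical_def)
  also have "\<dots> \<in> sets torus"
    using finite_windows[of K k] window_event_sets by (intro sets.Int sets.finite_INT) auto
  finally show ?thesis .
qed

lemma typical_rotation: "rotation_invariant (typical N K k)"
proof -
  have sp: "(\<lambda>j. u * z j) \<in> space torus" if "cmod u = 1" "z \<in> space torus" for u z
    using measurable_space[OF measurable_torus_mult[of "\<lambda>_. u"] that(2)] that(1) by simp
  have ev: "(\<lambda>j. u * z j) \<in> window_event N i j' \<longleftrightarrow> z \<in> window_event N i j'"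
    if "cmod u = 1" "z \<in> space torus" for u z i j'
    using window_event_rotation[of N i j'] that unfolding rotation_invariant_def by simp
  show ?thesis
    unfolding rotation_invariant_def typical_def by (simp add: sp ev)
qed

lemma typical_prob: "measure torus (typical N K k) \<ge> 1 / 2"
proof -
  interpret prob_space torus by (rule prob_space_torus)
  let ?W = "SIGMA i:{16..K}. {k div 2 ^ i - 4..k div 2 ^ i + 4}"
  let ?bad = "\<lambda>p. space torus - window_event N (fst p) (snd p)"
  have "space torus - typical N K k = (\<Union>p\<in>windows K k. ?bad p)"
    by (auto simp: typical_def)
  then have "measure torus (space torus - typical N K k) \<le> (\<Sum>p\<in>windows K k. measure torus (?bad p))"
    using finite_windows[of K k] window_event_sets
    by (simp only:, intro measure_UNION_le) auto
  also have "\<dots> \<le> (\<Sum>p\<in>windows K k. 1024 / 2 ^ fst p)" by (intro sum_mono window_event_prob)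
  also have "\<dots> \<le> (\<Sum>p\<in>?W. 1024 / 2 ^ fst p)"
    by (intro sum_mono2 windows_subset) auto
  also have "\<dots> = (\<Sum>i=16..K. \<Sum>j=k div 2 ^ i - 4..k div 2 ^ i + 4. 1024 / 2 ^ i)"
    by (subst sum.Sigma) (auto simp: case_prod_unfold)
  also have "\<dots> \<le> (\<Sum>i=16..K. 9216 * (1 / 2) ^ i)"
  proof (rule sum_mono)
    fix i
    have "real (card {k div 2 ^ i - 4..k div 2 ^ i + 4}) \<le> 9" by simp
    then show "(\<Sum>j=k div 2 ^ i - 4..k div 2 ^ i + 4. 1024 / 2 ^ i) \<le> 9216 * (1 / 2 :: real) ^ i"
      by (simp add: power_divide divide_right_mono)
  qed
  also have "\<dots> = 9216 * (\<Sum>i=16..K. (1 / 2) ^ i)" by (simp add: sum_distrib_left)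
  also have "\<dots> \<le> 9216 * (2 * (1 / 2) ^ 16)" by (intro mult_left_mono sum_geometric_tail) auto
  also have "\<dots> \<le> 1 / 2" by (simp add: power_divide)
  finally show ?thesis using prob_compl[OF typical_sets[of N K k]] by simp
qed

text \<open>A gap between \<open>2 * 2^i\<close> and \<open>4 * 2^i\<close> contains a complete window of scale \<open>i\<close>, and this window is
close enough to both end points to be tested at either of them.\<close>

lemma window_between:
  assumes "k + 2 ^ 17 \<le> k'" "k' \<le> K"
  obtains i j where "(i, j) \<in> windows K k" "(i, j) \<in> windows K k'" "k \<le> j * 2 ^ i" "(j + 1) * 2 ^ i \<le> k'" "16 \<le> i"
proof -
  define D where "D = k' - k"
  have D: "D \<ge> 2 ^ 17" "k' = k + D" using assms by (auto simp: D_def)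
  have "D > 0" using D by (metis less_le_trans zero_less_numeral zero_less_power)
  then obtain n where n: "2 ^ n \<le> D" "D < 2 ^ (n + 1)" using ex_power_ivl1[of 2 D] by auto
  have "n \<ge> 17"
  proof (rule ccontr)
    assume "\<not> n \<ge> 17"
    then have "(2::nat) ^ (n + 1) \<le> 2 ^ 17" by (intro power_increasing) auto
    with n D show False by linarith
  qed
  then obtain i where i: "n = Suc i" "i \<ge> 16" by (cases n) auto
  \<comment> \<open>The window that starts at the first multiple of \<open>2^i\<close> from \<open>k\<close> on.\<close>
  define P :: nat where "P = 2 ^ i"
  have P: "P > 0" "2 * P \<le> D" "D < 4 * P" using n i by (auto simp: P_def)
  define j where "j = (k + P - 1) div P"
  have jl: "k \<le> j * P"
  proof -
    have "k + P - 1 < (j + 1) * P" unfolding j_def using P(1) by (metis add.commute dividend_less_div_times mult.commute mult_Suc plus_1_eq_Suc)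
    then show ?thesis using P(1) by simp
  qed
  have ju: "j * P \<le> k + P - 1" unfolding j_def by simp
  have "i < P" unfolding P_def by (rule less_exp)
  then have iK: "i \<le> K" using P D assms by linarith
  have a: "(j + 1) * P \<le> k'" using ju P D by simp
  have b: "k' \<le> (j + 4) * P" using jl P D unfolding add_mult_distrib by linarith
  show ?thesis
    by (rule that[of i j])
      (use iK i(2) jl ju a b P(1) in \<open>auto simp: windows_def P_def[symmetric] algebra_simps\<close>)
qed

text \<open>Otherwise all three sums of a window between \<open>k\<close> and \<open>k'\<close> are at most an eighth of \<open>2^i\<close>, against
a mass of at least \<open>2/3 * 2^i - 8\<close>.\<close>

lemma typical_separation:
  assumes N: "enough_primes K N" and k: "k + 2 ^ 17 \<le> k'" "k' \<le> K"
    and \<delta>: "(1 / 2) ^ (k + 1) < \<delta>" "\<delta> \<le> 1" and \<delta>': "0 < \<delta>'" "\<delta>' \<le> (1 / 2) ^ k'"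
    and z: "z \<in> space torus"
    and w: "blaschke_map N (radius \<delta>) z \<in> typical N K k" and w': "blaschke_map N (radius \<delta>') z \<in> typical N K k'"
  shows False
proof -
  obtain i j where ij: "(i, j) \<in> windows K k" "(i, j) \<in> windows K k'" "k \<le> j * 2 ^ i" "(j + 1) * 2 ^ i \<le> k'" "16 \<le> i"
    by (rule window_between[OF k])
  note b = window_lo_hi[of i j]
  let ?c = "window_coeff (window_lo i j) (window_hi i j)" and ?q = "window_weight (window_lo i j) (window_hi i j)"
  have e: "blaschke_map N (radius \<delta>) z \<in> window_event N i j" "blaschke_map N (radius \<delta>') z \<in> window_event N i j"
    using w w' ij unfolding typical_def by auto
  have m: "(\<Sum>l<N. of_real (a l) * blaschke_map N r z l ^ n) = (\<Sum>l<N. of_real (a l) * blaschke (r l) (z l) ^ n)" for a r n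
    by (intro sum.cong) (auto simp: blaschke_map_def)
  have "(1 / 2) ^ k' \<le> window_lo i j" unfolding window_lo_def using ij(4) by (intro power_decreasing) auto
  then have 1: "\<delta>' \<le> window_lo i j" using \<delta>' by linarith
  have "window_hi i j \<le> (1 / 2) ^ k" unfolding window_hi_def using ij(3) by (intro power_decreasing) auto
  then have 2: "window_hi i j \<le> 2 * \<delta>" using \<delta> by simp
  have "(\<Sum>l<N. ?q l) \<le> 2 ^ i / 8 + 2 ^ i / 8 + 2 ^ i / 8 + 112"
  proof -
    have "cmod (\<Sum>l<N. of_real (?c l) * blaschke (radius \<delta> l) (z l)) \<le> 2 ^ i / 8"
      "cmod (\<Sum>l<N. of_real (?c l) * blaschke (radius \<delta>' l) (z l)) \<le> 2 ^ i / 8"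
      "cmod (\<Sum>l<N. of_real (?q l) * (blaschke (radius \<delta>' l) (z l))\<^sup>2) \<le> 2 ^ i / 8"
      using e unfolding window_event_def m mem_Collect_eq by simp_all
    with window_sum_le[where z = z and N = N, OF \<delta>'(1) 1 b(2,3) 2 \<delta>(2) norm_torus_coord[OF z]]
    show ?thesis by linarith
  qed
  moreover have "2 / 3 * 2 ^ i - 8 \<le> (\<Sum>l<N. ?q l)"
  proof -
    have "(j + 1) * 2 ^ i \<le> K" using ij(4) k(2) by linarith
    then show ?thesis using N unfolding enough_primes_def by simp
  qed
  moreover have "(2::real) ^ 16 \<le> 2 ^ i" using ij(5) by (intro power_increasing) auto
  ultimately show False by simp
qed

section \<open>Averaging the kernels and passing to the limit\<close>

lemma prod_prime_powers_smooth:
  assumes n: "n \<in> smooth_numbers N"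
  shows "(\<Prod>l<N. pr l ^ multiplicity (nth_prime l) n) = real n"
proof -
  have n0: "n > 0" using n by (simp add: smooth_numbers_def)
  have sub: "prime_factors n \<subseteq> nth_prime ` {..<N}"
  proof
    fix p assume p: "p \<in> prime_factors n"
    then have "prime p" "p dvd n" by auto
    obtain j where j: "p = nth_prime j" using prime_eq_nth_prime[OF \<open>prime p\<close>] .
    then show "p \<in> nth_prime ` {..<N}" using n \<open>p dvd n\<close> by (auto simp: smooth_numbers_def)
  qed
  have "n = (\<Prod>p\<in>prime_factors n. p ^ multiplicity p n)" by (rule prime_factorization_nat[OF n0])
  also have "\<dots> = (\<Prod>p\<in>nth_prime ` {..<N}. p ^ multiplicity p n)"
  proof (rule prod.mono_neutral_left[OF _ sub], simp, rule ballI)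
    fix p assume "p \<in> nth_prime ` {..<N} - prime_factors n"
    then have "\<not> p dvd n" using n0 prime_nth_prime by (auto simp: prime_factors_dvd)
    then show "p ^ multiplicity p n = 1" by (simp add: not_dvd_imp_multiplicity_0)
  qed
  also have "\<dots> = (\<Prod>l<N. nth_prime l ^ multiplicity (nth_prime l) n)"
    by (rule prod.reindex_cong[of nth_prime]) (auto intro: inj_on_subset[OF inj_nth_prime])
  finally show ?thesis by (metis (no_types, lifting) of_nat_power of_nat_prod prod.cong)
qed

lemma prod_radius_smooth:
  assumes n: "n \<in> smooth_numbers N"
  shows "(\<Prod>l<N. radius \<delta> l ^ multiplicity (nth_prime l) n) = real n powr (-1/2-\<delta>)"
proof -
  have "radius \<delta> l ^ m = (pr l ^ m) powr (-1/2-\<delta>)" for l m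
  proof -
    have p: "pr l > 0" using pr_ge_2[of l] by simp
    show ?thesis
      using p by (simp add: radius_def powr_powr powr_realpow[symmetric] mult.commute)
  qed
  then have "(\<Prod>l<N. radius \<delta> l ^ multiplicity (nth_prime l) n) = (\<Prod>l<N. (pr l ^ multiplicity (nth_prime l) n) powr (-1/2-\<delta>))"
    by simp
  also have "\<dots> = (\<Prod>l<N. pr l ^ multiplicity (nth_prime l) n) powr (-1/2-\<delta>)"
    by (rule prod_powr_distrib[symmetric])
  finally show ?thesis by (simp only: prod_prime_powers_smooth[OF n])
qed

definition shell :: "real \<Rightarrow> nat" where
  "shell \<delta> = (LEAST k. (1 / 2) ^ (k + 1) < \<delta>)"

lemma shell_bounds:
  assumes "0 < \<delta>" "\<delta> \<le> 1"
  shows "(1 / 2) ^ (shell \<delta> + 1) < \<delta>" "\<delta> \<le> (1 / 2) ^ shell \<delta>"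
proof -
  obtain n where "(1 / 2) ^ n < \<delta>" using real_arch_pow_inv[of \<delta> "1 / 2"] assms by auto
  moreover have "(1 / 2 :: real) ^ (n + 1) \<le> (1 / 2) ^ n" by (rule power_decreasing) auto
  ultimately have "(1 / 2) ^ (n + 1) < \<delta>" by linarith
  then show "(1 / 2) ^ (shell \<delta> + 1) < \<delta>" unfolding shell_def by (rule LeastI)
  show "\<delta> \<le> (1 / 2) ^ shell \<delta>"
  proof (cases "shell \<delta>")
    case (Suc k)
    then have "k < shell \<delta>" by simp
    from not_less_Least[OF this[unfolded shell_def]] show ?thesis using Suc by simp
  qed (use assms in simp)
qed

lemma shell_le:
  assumes "a \<ge> 1" "a \<le> M"
  shows "shell (real a / real M) \<le> M"
proof -
  have M: "real M > 0" using assms by simp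
  have "real M < 2 ^ M" by (rule of_nat_less_two_power)
  then have "(1 / 2) ^ M < 1 / real M" using M by (simp add: power_divide field_simps)
  also have "\<dots> \<le> real a / real M" using assms by (intro divide_right_mono) auto
  finally have "(1 / 2) ^ M < real a / real M" .
  moreover have "(1 / 2 :: real) ^ (M + 1) \<le> (1 / 2) ^ M" by (rule power_decreasing) auto
  ultimately have "(1 / 2) ^ (M + 1) < real a / real M" by linarith
  then show ?thesis unfolding shell_def by (rule Least_le)
qed

text \<open>At most \<open>M / 2^k\<close> of the points \<open>a / M\<close> are in the shell, and each \<open>1 / a\<close> is at most \<open>2^(k + 1) / M\<close>.\<close>

lemma shell_sum:
  assumes M: "M \<ge> 1"
  shows "(\<Sum>a\<in>{a\<in>{1..M}. shell (real a / real M) = k}. 4 / real a) \<le> 8"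
proof -
  let ?T = "{a\<in>{1..M}. shell (real a / real M) = k}"
  have M0: "real M > 0" using M by simp
  have b: "real M / 2 ^ (k + 1) < real a" "real a \<le> real M / 2 ^ k" if "a \<in> ?T" for a
  proof -
    have d: "0 < real a / real M" "real a / real M \<le> 1" "shell (real a / real M) = k" using that by auto
    show "real M / 2 ^ (k + 1) < real a" "real a \<le> real M / 2 ^ k"
      using shell_bounds[OF d(1,2)] M0 unfolding d(3) by (simp_all add: power_divide field_simps)
  qed
  have "?T \<subseteq> {1..nat \<lfloor>real M / 2 ^ k\<rfloor>}" using b(2) by (auto simp: le_nat_floor)
  then have "card ?T \<le> nat \<lfloor>real M / 2 ^ k\<rfloor>" using card_mono[of "{1..nat \<lfloor>real M / 2 ^ k\<rfloor>}" ?T] by simp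
  then have "real (card ?T) \<le> real (nat \<lfloor>real M / 2 ^ k\<rfloor>)" by (simp only: of_nat_le_iff)
  also have "\<dots> \<le> real M / 2 ^ k" by (rule of_nat_floor) simp
  finally have card: "real (card ?T) \<le> real M / 2 ^ k" .
  have "(\<Sum>a\<in>?T. 4 / real a) \<le> (\<Sum>a\<in>?T. 4 / (real M / 2 ^ (k + 1)))"
    using b(1) M0 by (intro sum_mono divide_left_mono) (auto intro: less_imp_le)
  also have "\<dots> = real (card ?T) * (4 / (real M / 2 ^ (k + 1)))" by simp
  also have "\<dots> \<le> real M / 2 ^ k * (4 / (real M / 2 ^ (k + 1)))" using M0 by (intro mult_right_mono card) auto
  also have "\<dots> = 8" using M0 by simp
  finally show ?thesis .
qed

lemma sum_over_close_shells:
  assumes M: "M \<ge> 1" and S: "S \<subseteq> {1..M}"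
    and close: "\<And>a b. a \<in> S \<Longrightarrow> b \<in> S \<Longrightarrow> shell (real b / real M) < shell (real a / real M) + 2 ^ 17"
  shows "(\<Sum>a\<in>S. 4 / real a) \<le> 2 ^ 20"
proof (cases "S = {}")
  case False
  let ?s = "\<lambda>a. shell (real a / real M)"
  have fin: "finite S" using S finite_subset by blast
  define k0 where "k0 = Min (?s ` S)"
  have "k0 \<in> ?s ` S" unfolding k0_def using fin False by (intro Min_in) auto
  then obtain a0 where a0: "a0 \<in> S" "?s a0 = k0" by auto
  have img: "?s ` S \<subseteq> {k0..<k0 + 2 ^ 17}"
  proof
    fix k assume "k \<in> ?s ` S"
    then obtain a where a: "a \<in> S" "k = ?s a" by auto
    have "k0 \<le> k" unfolding k0_def using fin a by (intro Min_le) auto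
    moreover have "k < k0 + 2 ^ 17" using close[OF a0(1) a(1)] a0 a by simp
    ultimately show "k \<in> {k0..<k0 + 2 ^ 17}" by simp
  qed
  have "(\<Sum>a\<in>S. 4 / real a) = (\<Sum>k\<in>{k0..<k0 + 2 ^ 17}. \<Sum>a\<in>{a\<in>S. ?s a = k}. 4 / real a)"
    by (rule sum.group[OF fin _ img, symmetric]) simp
  also have "\<dots> \<le> (\<Sum>k\<in>{k0..<k0 + 2 ^ 17}. 8)"
  proof (rule sum_mono)
    fix k
    have "(\<Sum>a\<in>{a\<in>S. ?s a = k}. 4 / real a) \<le> (\<Sum>a\<in>{a\<in>{1..M}. ?s a = k}. 4 / real a)"
      using S by (intro sum_mono2) auto
    also have "\<dots> \<le> 8" by (rule shell_sum[OF M])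
    finally show "(\<Sum>a\<in>{a\<in>S. ?s a = k}. 4 / real a) \<le> 8" .
  qed
  also have "\<dots> = 2 ^ 20" by simp
  finally show ?thesis .
qed simp

text \<open>A Riemann sum over \<open>\<delta> = a / M\<close> of the localized kernels.\<close>

definition averaged_kernel :: "nat \<Rightarrow> nat \<Rightarrow> (nat \<Rightarrow> complex) \<Rightarrow> complex" where
  "averaged_kernel M N z = (\<Sum>a=1..M. of_real (1 / real M) *
     localized_kernel N (radius (real a / real M)) (typical N M (shell (real a / real M))) z)"

lemma radius_less_1: "\<delta> \<ge> 0 \<Longrightarrow> radius \<delta> l < 1"
  using radius_le[of \<delta> l] by simp

text \<open>Each kernel is at most \<open>4 / \<delta>\<close> in modulus, hence contributes at most \<open>4 / a\<close>, and by
separation only kernels from \<open>2 ^ 17\<close> consecutive shells are nonzero at a given point.\<close>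

lemma norm_averaged_kernel:
  assumes M: "M \<ge> 1" and N: "enough_primes M N" and z: "z \<in> space torus"
  shows "cmod (averaged_kernel M N z) \<le> 2 ^ 20"
proof -
  let ?d = "\<lambda>a. real a / real M"
  let ?A = "\<lambda>a. typical N M (shell (?d a))"
  let ?S = "{a\<in>{1..M}. blaschke_map N (radius (?d a)) z \<in> ?A a}"
  have M0: "real M > 0" using M by simp
  have d: "0 < ?d a" "?d a \<le> 1" if "a \<in> {1..M}" for a using that by auto
  have each: "cmod (of_real (1 / real M) * localized_kernel N (radius (?d a)) (?A a) z)
      \<le> (if a \<in> ?S then 4 / real a else 0)" if a: "a \<in> {1..M}" for a
  proof -
    let ?P = "\<Prod>l<N. 1 / (1 - (radius (?d a) l)\<^sup>2)" and ?m = "measure torus (?A a)"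
    note da = d[OF a]
    have "?P = (\<Prod>l<N. 1 / (1 - pr l powr (-1-2*?d a)))"
      by (simp add: radius_def power2_eq_square powr_add[symmetric])
    also have "\<dots> \<le> 1 + 1 / (2 * ?d a)" using da by (intro euler_product_upper) simp
    also have "\<dots> \<le> 2 / ?d a"
    proof -
      have "1 + 1 / (2 * x) \<le> 2 / x" if "0 < x" "x \<le> 1" for x :: real using that by (simp add: field_simps)
      then show ?thesis using da by blast
    qed
    finally have P: "?P \<le> 2 / ?d a" .
    have m: "?m \<ge> 1 / 2" by (rule typical_prob)
    have "cmod (localized_kernel N (radius (?d a)) (?A a) z) = ?P * indicator (?A a) (blaschke_map N (radius (?d a)) z) / ?m"
      using radius_pos radius_less_1 da by (intro norm_localized_kernel z) (auto intro: less_imp_le)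
    also have "\<dots> \<le> (2 / ?d a) * indicator (?A a) (blaschke_map N (radius (?d a)) z) / (1 / 2)"
      using P m da by (intro frac_le mult_right_mono mult_nonneg_nonneg) auto
    finally have "cmod (localized_kernel N (radius (?d a)) (?A a) z) \<le> (if a \<in> ?S then 4 / ?d a else 0)"
      using a by (cases "blaschke_map N (radius (?d a)) z \<in> ?A a") auto
    then have "1 / real M * cmod (localized_kernel N (radius (?d a)) (?A a) z) \<le> 1 / real M * (if a \<in> ?S then 4 / ?d a else 0)"
      by (intro mult_left_mono) auto
    then show ?thesis using M0 by (auto simp: norm_mult norm_divide split: if_splits)
  qed
  have "cmod (averaged_kernel M N z) \<le> (\<Sum>a\<in>{1..M}. if a \<in> ?S then 4 / real a else 0)"
    unfolding averaged_kernel_def by (intro order_trans[OF norm_sum] sum_mono each)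
  also have "\<dots> = (\<Sum>a\<in>?S. 4 / real a)"
    by (subst sum.inter_restrict[symmetric]) (auto intro!: sum.cong)
  also have "\<dots> \<le> 2 ^ 20"
  proof (rule sum_over_close_shells[OF M])
    fix a b assume a: "a \<in> ?S" and b: "b \<in> ?S"
    show "shell (?d b) < shell (?d a) + 2 ^ 17"
    proof (rule ccontr)
      assume "\<not> ?thesis"
      then have k: "shell (?d a) + 2 ^ 17 \<le> shell (?d b)" by simp
      have a': "a \<in> {1..M}" and b': "b \<in> {1..M}" using a b by auto
      have "shell (?d b) \<le> M" using b' by (intro shell_le) auto
      from typical_separation[OF N k this shell_bounds(1)[OF d[OF a']] d(2)[OF a'] d(1)[OF b'] shell_bounds(2)[OF d[OF b']] z]
      show False using a b by auto
    qed
  qed auto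
  finally show ?thesis .
qed

lemma localized_kernel_L2:
  assumes "\<delta> \<ge> 0"
  shows "localized_kernel N (radius \<delta>) (typical N K k) \<in> L2 torus"
proof (rule L2_bounded[OF finite_measure_torus _ AE_I2])
  have r: "0 \<le> radius \<delta> l" "radius \<delta> l < 1" for l using radius_pos[of \<delta> l] radius_less_1[OF assms] by auto
  show "localized_kernel N (radius \<delta>) (typical N K k) \<in> borel_measurable torus"
    by (rule borel_measurable_localized_kernel[OF r typical_sets])
  fix z assume z: "z \<in> space torus"
  have P0: "(\<Prod>l<N. 1 / (1 - (radius \<delta> l)\<^sup>2)) \<ge> 0"
  proof (intro prod_nonneg ballI)
    fix l
    have "(radius \<delta> l)\<^sup>2 \<le> 1" using r[of l] by (intro power_le_one) auto
    then show "0 \<le> 1 / (1 - (radius \<delta> l)\<^sup>2)" by simp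
  qed
  show "cmod (localized_kernel N (radius \<delta>) (typical N K k) z) \<le> (\<Prod>l<N. 1 / (1 - (radius \<delta> l)\<^sup>2)) / measure torus (typical N K k)"
    unfolding norm_localized_kernel[OF r z] using P0 by (intro divide_right_mono) (auto simp: indicator_def)
qed

lemma averaged_kernel_coefficient:
  assumes n: "n \<in> smooth_numbers N"
  shows "L2_inner torus (averaged_kernel M N) (bohr_char n)
    = of_real (\<Sum>a=1..M. real n powr (-1/2 - real a / real M) / real M)"
proof -
  let ?d = "\<lambda>a. real a / real M"
  have "L2_inner torus (averaged_kernel M N) (bohr_char n) = (\<Sum>a=1..M. of_real (1 / real M) *
     L2_inner torus (localized_kernel N (radius (?d a)) (typical N M (shell (?d a)))) (bohr_char n))"
    unfolding averaged_kernel_def[abs_def] by (intro L2_inner_sum_left localized_kernel_L2 bohr_char_L2) auto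
  also have "\<dots> = (\<Sum>a=1..M. of_real (1 / real M) * of_real (real n powr (-1/2 - ?d a)))"
  proof (intro sum.cong refl arg_cong2[where f = "(*)"])
    fix a
    have d: "?d a \<ge> 0" by simp
    have "L2_inner torus (localized_kernel N (radius (?d a)) (typical N M (shell (?d a)))) (bohr_char n)
        = of_real (\<Prod>l<N. radius (?d a) l ^ multiplicity (nth_prime l) n)"
    proof (rule localized_kernel_coefficient[where \<rho> = "3/4"])
      show "0 \<le> radius (?d a) l" "radius (?d a) l \<le> 3 / 4" for l using radius_pos[of "?d a" l] radius_le[OF d] by auto
      show "measure torus (typical N M (shell (?d a))) > 0"
        using typical_prob[of N M "shell (?d a)"] by linarith
    qed (use n in \<open>auto simp: smooth_numbers_def typical_sets typical_rotation\<close>)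
    then show "L2_inner torus (localized_kernel N (radius (?d a)) (typical N M (shell (?d a)))) (bohr_char n)
        = of_real (real n powr (-1/2 - ?d a))"
      by (simp only: prod_radius_smooth[OF n])
  qed
  also have "\<dots> = of_real (\<Sum>a=1..M. real n powr (-1/2 - ?d a) / real M)"
    by simp
  finally show ?thesis .
qed

lemma averaged_kernel_L2: "averaged_kernel M N \<in> L2 torus"
  unfolding averaged_kernel_def[abs_def] by (intro L2_sum L2_mult localized_kernel_L2) simp

text \<open>With equidistant points the Riemann sum is a geometric sum.\<close>

lemma geometric_average_limit:
  assumes n: "n \<ge> (2::nat)"
  shows "(\<lambda>M. \<Sum>a=1..M. real n powr (-1/2 - real a / real M) / real M)
    \<longlonglongrightarrow> real n powr (-1/2) * (1 - 1 / real n) / ln (real n)"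
proof -
  define L where "L = ln (real n)"
  have L: "L > 0" using n by (simp add: L_def)
  have n0: "real n > 0" using n by simp
  have eL: "exp (-L) = 1 / real n" using n0 by (simp add: L_def exp_minus inverse_eq_divide)
  define x where "x M = exp (- L / real M)" for M :: nat
  have eq: "(\<Sum>a=1..M. real n powr (-1/2 - real a / real M) / real M)
      = real n powr (-1/2) * (1 - 1 / real n) * (x M / (real M * (1 - x M)))" if M: "M \<ge> 1" for M
  proof -
    have x1: "x M < 1" using L M by (simp add: x_def)
    have xp: "x M ^ a = exp (- (L * real a / real M))" for a
      by (simp add: x_def exp_of_nat_mult[symmetric] mult.commute)
    have xM: "x M ^ M = 1 / real n" using M by (simp add: xp eL)
    have pw: "real n powr (-1/2 - real a / real M) = real n powr (-1/2) * x M ^ a" for a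
    proof -
      have "real n powr (-1/2 - real a / real M) = real n powr (-1/2) * real n powr (- (real a / real M))"
        by (simp only: diff_conv_add_uminus powr_add)
      also have "real n powr (- (real a / real M)) = x M ^ a"
        using n0 unfolding xp by (simp add: powr_def L_def mult.commute)
      finally show ?thesis .
    qed
    have "(\<Sum>a=1..M. real n powr (-1/2 - real a / real M) / real M)
        = real n powr (-1/2) / real M * (\<Sum>a=1..M. x M ^ a)"
      unfolding pw sum_distrib_left by (intro sum.cong refl) simp
    also have "(\<Sum>a=1..M. x M ^ a) = x M * (1 - x M ^ M) / (1 - x M)"
      using x1 M by (subst sum_gp) (auto simp: algebra_simps)
    also have "real n powr (-1/2) / real M * (x M * (1 - x M ^ M) / (1 - x M))
        = real n powr (-1/2) * (1 - 1 / real n) * (x M / (real M * (1 - x M)))"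
      unfolding xM by (simp add: mult_ac)
    finally show ?thesis .
  qed
  have "(\<lambda>M. x M / (real M * (1 - x M))) \<longlonglongrightarrow> inverse L"
    unfolding x_def using L by real_asymp
  then have "(\<lambda>M. x M / (real M * (1 - x M))) \<longlonglongrightarrow> 1 / L" by (simp only: inverse_eq_divide)
  then have "(\<lambda>M. real n powr (-1/2) * (1 - 1 / real n) * (x M / (real M * (1 - x M))))
      \<longlonglongrightarrow> real n powr (-1/2) * (1 - 1 / real n) * (1 / L)"
    by (rule tendsto_mult_left)
  then have "(\<lambda>M. \<Sum>a=1..M. real n powr (-1/2 - real a / real M) / real M)
      \<longlonglongrightarrow> real n powr (-1/2) * (1 - 1 / real n) * (1 / L)"
  proof (rule Lim_transform_eventually)
    show "\<forall>\<^sub>F M in sequentially. real n powr (-1/2) * (1 - 1 / real n) * (x M / (real M * (1 - x M)))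
        = (\<Sum>a=1..M. real n powr (-1/2 - real a / real M) / real M)"
      using eventually_ge_at_top[of 1] by eventually_elim (rule eq[symmetric])
  qed
  then show ?thesis by (simp add: L_def)
qed

definition symbol_coeff :: "nat \<Rightarrow> real" where
  "symbol_coeff n = (if n = 1 then 1 else 1 / (sqrt (real n) * ln (real n)))"

text \<open>The part of the coefficients that comes from \<open>\<delta> > 1\<close>.\<close>

definition tail_coeff :: "nat \<Rightarrow> real" where
  "tail_coeff n = (if n = 1 then 0 else real n powr (-3/2) / ln (real n))"

lemma average_tendsto_symbol_coeff:
  assumes n: "n \<ge> 1"
  shows "(\<lambda>M. (\<Sum>a=1..M. real n powr (-1/2 - real a / real M) / real M) + tail_coeff n) \<longlonglongrightarrow> symbol_coeff n"
proof (cases "n = 1")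
  case True
  have "(\<lambda>M. 1 :: real) \<longlonglongrightarrow> 1" by simp
  then have "(\<lambda>M. \<Sum>a=1..M. real n powr (-1/2 - real a / real M) / real M) \<longlonglongrightarrow> 1"
    by (rule Lim_transform_eventually)
      (use eventually_ge_at_top[of 1] in \<open>eventually_elim, simp add: True\<close>)
  then show ?thesis using True by (simp add: tail_coeff_def symbol_coeff_def)
next
  case False
  then have n2: "n \<ge> 2" using n by simp
  have n0: "real n > 0" using n by simp
  have p1: "real n powr (-1/2) = 1 / sqrt (real n)"
    using n0 by (simp add: powr_minus_divide powr_half_sqrt)
  have p2: "real n powr (-3/2) = real n powr (-1/2) * (1 / real n)"
  proof -
    have "real n powr (-1/2 + -1) = real n powr (-1/2) * real n powr (-1)" by (rule powr_add)
    moreover have "real n powr (-1) = 1 / real n" using n0 by (simp add: powr_minus_divide)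
    ultimately show ?thesis by simp
  qed
  have "real n powr (-1/2) * (1 - 1 / real n) / ln (real n) + tail_coeff n = symbol_coeff n"
  proof -
    have "real n powr (-1/2) * (1 - 1 / real n) / ln (real n) + tail_coeff n
        = real n powr (-1/2) * ((1 - 1 / real n) + 1 / real n) / ln (real n)"
    proof -
      have "A * (1 - B) / C + A * B / C = A * ((1 - B) + B) / C" for A B C :: real
        by (simp only: add_divide_distrib distrib_left)
      then show ?thesis using False unfolding tail_coeff_def p2 by (simp only: if_False)
    qed
    also have "\<dots> = symbol_coeff n" using False unfolding symbol_coeff_def p1 by simp
    finally show ?thesis .
  qed
  with tendsto_add[OF geometric_average_limit[OF n2] tendsto_const[of "tail_coeff n"]] show ?thesis by simp
qed

lemma tail_coeff_sum: "(\<Sum>n=1..M. \<bar>tail_coeff n\<bar>) \<le> 5"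
proof -
  have "\<bar>tail_coeff n\<bar> \<le> 3 / 2 * real n powr (-1-1/2)" if "n \<in> {1..M}" for n
  proof (cases "n = 1")
    case False
    then have n: "real n \<ge> 2" using that by simp
    have "2 / 3 \<le> ln (2::real)" by (rule ln2_ge_two_thirds)
    also have "ln 2 \<le> ln (real n)" using n by simp
    finally have l: "2 / 3 \<le> ln (real n)" .
    have "real n powr (-3/2) / ln (real n) \<le> real n powr (-3/2) / (2 / 3)"
      using l by (intro divide_left_mono) auto
    then show ?thesis using False l by (simp add: tail_coeff_def)
  qed (simp add: tail_coeff_def)
  then have "(\<Sum>n=1..M. \<bar>tail_coeff n\<bar>) \<le> (\<Sum>n=1..M. 3 / 2 * real n powr (-1-1/2))"
    by (rule sum_mono)
  also have "\<dots> = 3 / 2 * (\<Sum>n=1..M. real n powr (-1-1/2))" by (simp only: sum_distrib_left)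
  also have "\<dots> \<le> 3 / 2 * (1 + 1 / (1 / 2))" by (intro mult_left_mono zeta_sum_upper) auto
  finally show ?thesis by simp
qed

lemma approximate_symbol:
  "\<exists>f\<in>borel_measurable torus. (\<forall>z\<in>space torus. cmod (f z) \<le> 2 ^ 20 + 5) \<and>
    (\<forall>n\<in>{1..K}. cmod (L2_inner torus f (bohr_char n) - of_real (symbol_coeff n)) \<le> 1 / real (Suc K))"
proof -
  let ?c = "\<lambda>M n. (\<Sum>a=1..M. real n powr (-1/2 - real a / real M) / real M) + tail_coeff n"
  have "\<forall>\<^sub>F M in sequentially. \<forall>n\<in>{1..K}. dist (?c M n) (symbol_coeff n) < 1 / real (Suc K)"
  proof (rule eventually_ball_finite)
    show "\<forall>n\<in>{1..K}. \<forall>\<^sub>F M in sequentially. dist (?c M n) (symbol_coeff n) < 1 / real (Suc K)"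
    proof
      fix n assume "n \<in> {1..K}"
      then have "n \<ge> 1" by simp
      from tendstoD[OF average_tendsto_symbol_coeff[OF this], of "1 / real (Suc K)"]
      show "\<forall>\<^sub>F M in sequentially. dist (?c M n) (symbol_coeff n) < 1 / real (Suc K)" by (simp del: of_nat_Suc)
    qed
  qed simp
  moreover have "\<forall>\<^sub>F M in sequentially. M \<ge> max 1 K" by (rule eventually_ge_at_top)
  ultimately have "\<forall>\<^sub>F M in sequentially. M \<ge> max 1 K \<and> (\<forall>n\<in>{1..K}. dist (?c M n) (symbol_coeff n) < 1 / real (Suc K))"
    by eventually_elim simp
  then obtain M where M: "M \<ge> 1" "M \<ge> K" "\<And>n. n \<in> {1..K} \<Longrightarrow> dist (?c M n) (symbol_coeff n) < 1 / real (Suc K)"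
    by (auto dest!: eventually_happens)
  have "\<forall>\<^sub>F N in sequentially. enough_primes M N \<and> M \<le> N"
    using eventually_enough_primes[of M] eventually_ge_at_top[of M] by eventually_elim simp
  then obtain N where N: "enough_primes M N" "M \<le> N" by (auto dest!: eventually_happens)
  let ?t = "\<lambda>z. \<Sum>n\<in>{1..M}. of_real (tail_coeff n) * bohr_char n z"
  let ?f = "\<lambda>z. averaged_kernel M N z + ?t z"
  have tL2: "?t \<in> L2 torus" by (rule L2_sum_bohr)
  have fm: "?f \<in> borel_measurable torus" by (rule L2_measurable[OF L2_add[OF averaged_kernel_L2 tL2]])
  have bd: "cmod (?f z) \<le> 2 ^ 20 + 5" if z: "z \<in> space torus" for z
  proof -
    have "cmod (?t z) \<le> (\<Sum>n=1..M. \<bar>tail_coeff n\<bar>)"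
      by (rule order_trans[OF norm_sum]) (simp add: norm_mult norm_bohr_char[OF z])
    then show ?thesis
      using norm_triangle_ineq[of "averaged_kernel M N z" "?t z"] norm_averaged_kernel[OF M(1) N(1) z] tail_coeff_sum[of M]
      by linarith
  qed
  have coeff: "cmod (L2_inner torus ?f (bohr_char n) - of_real (symbol_coeff n)) \<le> 1 / real (Suc K)" if n: "n \<in> {1..K}" for n
  proof -
    have nM: "n \<in> {1..M}" "n \<in> {1..N}" using n M N by auto
    have sm: "n \<in> smooth_numbers N" using nM(2) atMost_subset_smooth by blast
    have "L2_inner torus ?f (bohr_char n) = L2_inner torus (averaged_kernel M N) (bohr_char n) + L2_inner torus ?t (bohr_char n)"
      unfolding L2_inner_def distrib_right
      by (intro Bochner_Integration.integral_add L2_inner_integrable averaged_kernel_L2 tL2 bohr_char_L2)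
    also have "L2_inner torus ?t (bohr_char n) = of_real (tail_coeff n)"
      using nM by (subst L2_inner_bohr_sum) auto
    also have "L2_inner torus (averaged_kernel M N) (bohr_char n) + of_real (tail_coeff n) = of_real (?c M n)"
      unfolding averaged_kernel_coefficient[OF sm] by simp
    finally have "L2_inner torus ?f (bohr_char n) - of_real (symbol_coeff n) = of_real (?c M n - symbol_coeff n)" by simp
    then have "cmod (L2_inner torus ?f (bohr_char n) - of_real (symbol_coeff n)) = \<bar>?c M n - symbol_coeff n\<bar>"
      by (simp only: norm_of_real)
    then show ?thesis using M(3)[OF n] unfolding dist_real_def by linarith
  qed
  show ?thesis using fm bd coeff by (intro bexI[of _ ?f] conjI ballI) auto
qed

theorem corollary1p2:
  shows "\<exists>B\<in>Linf torus. \<exists>G. is_P_plus B G \<and>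
    L2_tendsto torus
      (\<lambda>N z. 1 + (\<Sum>n=2..N. bohr_char n z / complex_of_real (sqrt (real n) * ln (real n)))) G"
proof -
  have "\<exists>B\<in>borel_measurable torus. (AE z in torus. cmod (B z) \<le> 2 ^ 20 + 5) \<and>
      (\<forall>n\<ge>1. L2_inner torus B (bohr_char n) = of_real (symbol_coeff n))"
    by (rule bounded_weak_limit[OF prob_space_torus bohr_char_L2 approximate_symbol])
  then obtain B where B: "B \<in> borel_measurable torus" "AE z in torus. cmod (B z) \<le> 2 ^ 20 + 5"
    and coeff: "\<And>n. n \<ge> 1 \<Longrightarrow> L2_inner torus B (bohr_char n) = of_real (symbol_coeff n)" by auto
  have "B \<in> Linf torus" using B by (auto simp: Linf_def)
  have "B \<in> L2 torus" by (rule L2_bounded[OF finite_measure_torus B])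
  from P_plus_fourier_series[OF this coeff] obtain G where G: "is_P_plus B G"
    and lim: "L2_tendsto torus (\<lambda>N z. \<Sum>n=1..N. of_real (symbol_coeff n) * bohr_char n z) G" by auto
  let ?s = "\<lambda>N z. \<Sum>n=1..N. complex_of_real (symbol_coeff n) * bohr_char n z"
  let ?u = "\<lambda>N z. 1 + (\<Sum>n=2..N. bohr_char n z / complex_of_real (sqrt (real n) * ln (real n)))"
  have su: "?s N = ?u N" if "N \<ge> 1" for N
  proof
    fix z
    have "?s N z = of_real (symbol_coeff 1) * bohr_char 1 z + (\<Sum>n\<in>{Suc 1..N}. complex_of_real (symbol_coeff n) * bohr_char n z)"
      using that by (rule sum.atLeast_Suc_atMost)
    also have "\<dots> = 1 + (\<Sum>n\<in>{Suc 1..N}. complex_of_real (symbol_coeff n) * bohr_char n z)"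
      by (simp only: bohr_char_1) (simp add: symbol_coeff_def)
    also have "(\<Sum>n\<in>{Suc 1..N}. complex_of_real (symbol_coeff n) * bohr_char n z)
        = (\<Sum>n=2..N. bohr_char n z / complex_of_real (sqrt (real n) * ln (real n)))"
      by (intro sum.cong) (auto simp: symbol_coeff_def)
    finally show "?s N z = ?u N z" .
  qed
  have one: "(\<lambda>z. 1) \<in> L2 torus" by (rule L2_bounded[OF finite_measure_torus, of _ 1]) auto
  have uL2: "?u N \<in> L2 torus" for N
  proof (cases "N \<ge> 1")
    case True
    then show ?thesis using lim su[OF True] unfolding L2_tendsto_def by metis
  next
    case False
    then show ?thesis using one by simp
  qed
  have "(\<lambda>N. L2_norm torus (\<lambda>z. ?u N z - G z)) \<longlonglongrightarrow> 0"
  proof (rule Lim_transform_eventually)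
    show "(\<lambda>N. L2_norm torus (\<lambda>z. ?s N z - G z)) \<longlonglongrightarrow> 0" using lim by (simp add: L2_tendsto_def)
    show "\<forall>\<^sub>F N in sequentially. L2_norm torus (\<lambda>z. ?s N z - G z) = L2_norm torus (\<lambda>z. ?u N z - G z)"
      using eventually_ge_at_top[of 1]
    proof eventually_elim
      case (elim N)
      show ?case using fun_cong[OF su[OF elim]] by simp
    qed
  qed
  then have "L2_tendsto torus ?u G" using uL2 lim by (simp add: L2_tendsto_def)
  with G \<open>B \<in> Linf torus\<close> show ?thesis by blast
qed

end
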